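(* Let $m\in\mathbb N$, let $\mathcal X$ be the GK curve, let $G=\sum_{P\in\mathcal X(\mathbb F_{q^2})}mP$ and $D=\sum_{P\in\mathcal X(\mathbb F_{q^6})\setminus\mathcal X(\mathbb F_{q^2})}P$, and let $k$ be the dimension over $\mathbb F_{q^6}$ of the functional AG code $C=C_{\mathcal L}(D,G)$. If $q^2-1\le m\le q^5-q^3-1$, then $$k=m(q^3+1)-\frac12\left(q^5-2q^3+q^2-2\right).$$
   Context: Let $q$ be a prime power. The GK curve $\mathcal X$ is the non-singular projective curve in $PG(3,\overline{\mathbb F}_q)$ defined by the affine equations $Y^{q+1}=X^q+X$, $Z^{q^2-q+1}=Y^{q^2}-Y$. It has a unique point at infinity $P_\infty$, which is $\mathbb F_{q^2}$-rational, genus $g=\frac{q^5-2q^3+q^2}{2}$, and $|\mathcal X(\mathbb F_{q^6})|=q^8-q^6+q^5+1$, $|\mathcal X(\mathbb F_{q^2})|=q^3+1$, where $\mathcal X(\mathbb F_{q^i})$ is the set of $\mathbb F_{q^i}$-rational points. Functional code: for an $\mathbb F_{q^6}$-rational divisor $G$, $\mathcal L(G)=\{f\in\mathbb F_{q^6}(\mathcal X)\setminus\{0\}: (f)+G\ge 0\}\cup\{0\}$. For $D=P_1+\cdots+P_n$ with distinct $\mathbb F_{q^6}$-rational $P_i$ not in $\mathrm{supp}(G)$, $C_{\mathcal L}(D,G)=\{(f(P_1),\ldots,f(P_n)) : f\in\mathcal L(G)\}\subseteq\mathbb F_{q^6}^n$. *)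

theory Defs
  imports
    "HOL-Analysis.Analysis"
    "HOL-Library.Poly_Mapping"
    "HOL-Number_Theory.Prime_Powers"
    "HOL-Algebra.Algebraic_Closure_Type"
begin

unbundle no fps_syntax

section \<open>Polynomials in four variables\<close>

type_synonym 'a poly4 = "(4 \<Rightarrow>\<^sub>0 nat) \<Rightarrow>\<^sub>0 'a"

definition eval4 :: "'a::comm_semiring_1 poly4 \<Rightarrow> 'a ^ 4 \<Rightarrow> 'a" where
  "eval4 F v = (\<Sum>e\<in>Poly_Mapping.keys F.
     Poly_Mapping.lookup F e * (\<Prod>i\<in>UNIV. v $ i ^ Poly_Mapping.lookup e i))"

text \<open>The zero polynomial is homogeneous of every degree.\<close>

definition homogeneous4 :: "nat \<Rightarrow> 'a::zero poly4 \<Rightarrow> bool" where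
  "homogeneous4 d F \<longleftrightarrow> (\<forall>e\<in>Poly_Mapping.keys F. (\<Sum>i\<in>UNIV. Poly_Mapping.lookup e i) = d)"


section \<open>Projective space and projective closures\<close>

text \<open>A point of projective 3-space is the set of all its vectors of homogeneous coordinates.\<close>

type_synonym 'a proj_point = "('a ^ 4) set"

definition proj_class :: "'a::field ^ 4 \<Rightarrow> 'a proj_point" where
  "proj_class v = {c *s v | c. c \<noteq> 0}"

definition PG3 :: "'a::field proj_point set" where
  "PG3 = proj_class ` {v. v \<noteq> 0}"

definition vanishes_on :: "'a::field proj_point set \<Rightarrow> 'a poly4 \<Rightarrow> bool" where
  "vanishes_on S F \<longleftrightarrow> (\<forall>P\<in>S. \<forall>v\<in>P. eval4 F v = 0)"

text \<open>The affine point \<open>(x, y, z)\<close> is embedded as \<open>(1 : x : y : z)\<close>, so the first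
  coordinate is the homogenizing one.\<close>

definition affine_point :: "'a::field \<times> 'a \<times> 'a \<Rightarrow> 'a proj_point" where
  "affine_point = (\<lambda>(x, y, z). proj_class (vector [1, x, y, z]))"

definition projective_closure :: "('a::field \<times> 'a \<times> 'a) set \<Rightarrow> 'a proj_point set" where
  "projective_closure A = {P \<in> PG3. \<forall>F d. homogeneous4 d F \<longrightarrow>
     vanishes_on (affine_point ` A) F \<longrightarrow> vanishes_on {P} F}"

text \<open>In the algebraic closure of a field of characteristic \<open>p\<close>, the equation \<open>a ^ N = a\<close>
  with \<open>N\<close> a power of \<open>p\<close> cuts out the subfield with \<open>N\<close> elements.\<close>

definition rational_points :: "'a::field proj_point set \<Rightarrow> nat \<Rightarrow> 'a proj_point set" where
  "rational_points \<X> N = {P \<in> \<X>. \<exists>v\<in>P. \<forall>i. (v $ i) ^ N = v $ i}"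


section \<open>The function field of a projective curve\<close>

text \<open>The definitions of this section and the next are meant for \<open>\<X>\<close> an irreducible
  non-singular curve over an algebraically closed field. A rational function on \<open>\<X>\<close> is a class
  of fractions \<open>F / H\<close> of homogeneous polynomials of the same degree, \<open>H\<close> not vanishing
  identically on \<open>\<X>\<close>.\<close>

type_synonym 'a rat_fun = "('a poly4 \<times> 'a poly4) set"

definition fractions :: "'a::field proj_point set \<Rightarrow> ('a poly4 \<times> 'a poly4) set" where
  "fractions \<X> = {(F, H). (\<exists>d. homogeneous4 d F \<and> homogeneous4 d H) \<and> \<not> vanishes_on \<X> H}"

definition fraction_rel ::
  "'a::field proj_point set \<Rightarrow> (('a poly4 \<times> 'a poly4) \<times> ('a poly4 \<times> 'a poly4)) set" where
  "fraction_rel \<X> = {((F, H), (F', H')). (F, H) \<in> fractions \<X> \<and> (F', H') \<in> fractions \<X> \<and>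
     vanishes_on \<X> (F * H' - F' * H)}"

definition function_field :: "'a::field proj_point set \<Rightarrow> 'a rat_fun ring" where
  "function_field \<X> = \<lparr>
     carrier = fractions \<X> // fraction_rel \<X>,
     mult = (\<lambda>f g. \<Union>(F, H)\<in>f. \<Union>(F', H')\<in>g. fraction_rel \<X> `` {(F * F', H * H')}),
     one = fraction_rel \<X> `` {(1, 1)},
     zero = fraction_rel \<X> `` {(0, 1)},
     add = (\<lambda>f g. \<Union>(F, H)\<in>f. \<Union>(F', H')\<in>g. fraction_rel \<X> `` {(F * H' + F' * H, H * H')})\<rparr>"

text \<open>The rational functions on \<open>\<X>\<close> defined over the field \<open>'f\<close>.\<close>

definition function_field_over ::
  "'f::field alg_closure proj_point set \<Rightarrow> 'f alg_closure rat_fun set" where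
  "function_field_over \<X> = {f \<in> carrier (function_field \<X>). \<exists>(F, H)\<in>f.
     \<forall>e. Poly_Mapping.lookup F e \<in> range to_ac \<and> Poly_Mapping.lookup H e \<in> range to_ac}"

definition local_ring :: "'a::field proj_point set \<Rightarrow> 'a proj_point \<Rightarrow> 'a rat_fun set" where
  "local_ring \<X> P = {f \<in> carrier (function_field \<X>). \<exists>(F, H)\<in>f. \<not> vanishes_on {P} H}"

text \<open>The value of a rational function at a point where it is regular.\<close>

definition value_at :: "'a::field rat_fun \<Rightarrow> 'a proj_point \<Rightarrow> 'a" where
  "value_at f P = (THE a. \<exists>(F, H)\<in>f. \<exists>v\<in>P. eval4 H v \<noteq> 0 \<and> a = eval4 F v / eval4 H v)"

definition max_ideal :: "'a::field proj_point set \<Rightarrow> 'a proj_point \<Rightarrow> 'a rat_fun set" where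
  "max_ideal \<X> P = {f \<in> local_ring \<X> P. value_at f P = 0}"

definition uniformizer :: "'a::field proj_point set \<Rightarrow> 'a proj_point \<Rightarrow> 'a rat_fun \<Rightarrow> bool" where
  "uniformizer \<X> P t \<longleftrightarrow> t \<in> max_ideal \<X> P \<and>
     max_ideal \<X> P = {s \<otimes>\<^bsub>function_field \<X>\<^esub> t | s. s \<in> local_ring \<X> P}"

text \<open>The discrete valuation at \<open>P\<close> of a nonzero rational function: \<open>f = u t\<^sup>n\<close> with \<open>t\<close> a
  uniformizer and \<open>u\<close> a unit of the local ring.\<close>

definition ord_at :: "'a::field proj_point set \<Rightarrow> 'a proj_point \<Rightarrow> 'a rat_fun \<Rightarrow> int" where
  "ord_at \<X> P f = (THE n. \<exists>t u. uniformizer \<X> P t \<and> u \<in> local_ring \<X> P - max_ideal \<X> P \<and>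
     f = u \<otimes>\<^bsub>function_field \<X>\<^esub> (t [^]\<^bsub>function_field \<X>\<^esub> n))"


section \<open>Divisors and functional codes\<close>

type_synonym 'a divisor = "'a proj_point \<Rightarrow>\<^sub>0 int"

text \<open>The condition \<open>(f) + G \<ge> 0\<close> is coefficientwise; the order that \<open>Poly_Mapping\<close> provides
  on \<open>\<Rightarrow>\<^sub>0\<close> is lexicographic and is not used.\<close>

definition riemann_roch_space :: "'f::field alg_closure proj_point set \<Rightarrow>
    'f alg_closure divisor \<Rightarrow> 'f alg_closure rat_fun set" where
  "riemann_roch_space \<X> G =
     {f \<in> function_field_over \<X> - {\<zero>\<^bsub>function_field \<X>\<^esub>}.
        \<forall>P\<in>\<X>. ord_at \<X> P f + Poly_Mapping.lookup G P \<ge> 0} \<union> {\<zero>\<^bsub>function_field \<X>\<^esub>}"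

text \<open>The code of the divisor \<open>P\<^sub>1 + \<dots> + P\<^sub>n\<close>, given through the family of its points. If these
  are rational over \<open>'f\<close> and outside the support of \<open>G\<close>, the values lie in the image of
  \<open>'f\<close> in its algebraic closure, and \<open>of_ac\<close> takes them back to \<open>'f\<close>.\<close>

definition functional_code :: "'f::field alg_closure proj_point set \<Rightarrow>
    ('n::finite \<Rightarrow> 'f alg_closure proj_point) \<Rightarrow> 'f alg_closure divisor \<Rightarrow> ('f ^ 'n) set" where
  "functional_code \<X> P G = (\<lambda>f. \<chi> i. of_ac (value_at f (P i))) ` riemann_roch_space \<X> G"


section \<open>The GK curve\<close>

definition gk_affine :: "nat \<Rightarrow> ('a::field \<times> 'a \<times> 'a) set" where
  "gk_affine q = {(x, y, z). y ^ (q + 1) = x ^ q + x \<and> z ^ (q\<^sup>2 - q + 1) = y ^ q\<^sup>2 - y}"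

text \<open>The curve is the projective closure: homogenizing the two equations one by one would add
  a line at infinity.\<close>

definition gk_curve :: "nat \<Rightarrow> 'a::field proj_point set" where
  "gk_curve q = projective_closure (gk_affine q)"

end

theory Submission
  imports Defs
begin

text \<open>
  Write \<open>N = q\<^sup>2 - q + 1\<close>, so that \<open>N (q + 1) = q\<^sup>3 + 1\<close>. The plane \<open>Z = 0\<close> meets the curve exactly in its
  \<open>q\<^sup>3 + 1\<close> points over the field with \<open>q\<^sup>2\<close> elements, each with multiplicity one. Hence \<open>G\<close> is \<open>m\<close> times a
  plane section, and the functions with poles bounded by \<open>G\<close> turn out to be precisely the forms of
  degree \<open>m\<close> divided by \<open>Z\<^sup>m\<close>. On the curve \<open>y\<^sup>q\<^sup>+\<^sup>1 = x\<^sup>q + x\<close> and \<open>z\<^sup>N\<close> is a polynomial of degree \<open>N\<close> in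
  \<open>x\<close> and \<open>y\<close>, so the monomials \<open>x\<^sup>i y\<^sup>j z\<^sup>k\<close> with \<open>j \<le> q\<close>, \<open>k \<le> q\<^sup>2 - q\<close> and \<open>i + j + k \<le> m\<close> span this space;
  they are independent because almost all fibres over the \<open>x\<close>-line have \<open>(q + 1) N\<close> points
  (\<open>rep1_indep\<close>). For \<open>m \<ge> q\<^sup>2 - 1\<close> their number is \<open>(q\<^sup>3 + 1) (m + 1 - q\<^sup>2 / 2)\<close> (\<open>card_monos\<close>), which is
  the asserted dimension. No Riemann-Roch theorem is needed.

  The difficult inclusion is that a function without other poles is a form over \<open>Z\<^sup>m\<close>. Over the \<open>z\<close>-line
  the affine curve is an unramified Galois covering with \<open>q\<^sup>3\<close> points in every fibre. Norms therefore
  turn any denominator into a polynomial in \<open>z\<close> (\<open>norm_to_z\<close>), and if a function is regular at all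
  points over \<open>c\<close>, then a factor \<open>z - c\<close> of its denominator cancels (\<open>polyfuns_divide\<close>); so a function
  that is regular at all affine points is a polynomial (\<open>regular_quotient\<close>). The degree of this
  polynomial is read off at the point at infinity, where \<open>Z / X\<close> is a local parameter and the top
  monomials of a reduced polynomial of degree \<open>d\<close>, divided by \<open>X\<^sup>d\<close>, have the distinct orders
  \<open>N j + k \<le> q\<^sup>3\<close>, while all other monomials have larger order (\<open>rep1_order\<close>,
  \<open>degree_bound_infinity\<close>). The same computation shows that the curve is irreducible
  (\<open>forms_domain\<close>). The orders in the function field are tied to these computations with forms in
  \<open>ord_at_ge\<close>.

  Evaluation at the points of \<open>D\<close> is injective for \<open>m < q\<^sup>3 (q\<^sup>2 - 1)\<close>: there are \<open>(q\<^sup>3 + 1) (q\<^sup>2 - 1)\<close>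
  values of \<open>z\<close> over which all \<open>q\<^sup>3\<close> points of the fibre are rational over the field with \<open>q\<^sup>6\<close> elements
  (\<open>rational_z_values\<close>), and a form of degree \<open>m\<close>, written as a combination of \<open>x\<^sup>i y\<^sup>j\<close> with \<open>i < q\<close> and
  \<open>j < q\<^sup>2\<close>, has coefficients in \<open>z\<close> of smaller degree than this (\<open>evaluation_injective\<close>). Finally the
  coefficients with respect to the monomial basis lie in the finite field by Frobenius invariance
  (\<open>coefficients_descend\<close>).
\<close>

(* the dollar sign always denotes a component of a vector *)
no_notation fps_nth (infixl \<open>$\<close> 75)

section \<open>Homogeneous forms as functions\<close>

lemma eval4_superset:
  assumes "finite S" "Poly_Mapping.keys F \<subseteq> S"
  shows "eval4 F v = (\<Sum>e\<in>S. Poly_Mapping.lookup F e * (\<Prod>i\<in>UNIV. v $ i ^ Poly_Mapping.lookup e i))"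
  unfolding eval4_def
  by (rule sum.mono_neutral_left) (use assms in \<open>auto simp: in_keys_iff\<close>)

lemma eval4_zero [simp]: "eval4 0 v = 0"
  by (simp add: eval4_def)

lemma eval4_single:
  "eval4 (Poly_Mapping.single e c) v = c * (\<Prod>i\<in>UNIV. v $ i ^ Poly_Mapping.lookup e i)"
  by (subst eval4_superset[of "{e}"]) auto

lemma eval4_one [simp]: "eval4 1 v = 1"
  unfolding single_one[symmetric] eval4_single by simp

lemma eval4_add: "eval4 (F + G) v = eval4 F v + eval4 G v"
proof -
  let ?S = "Poly_Mapping.keys F \<union> Poly_Mapping.keys G"
  have "Poly_Mapping.keys (F + G) \<subseteq> ?S" by (rule Poly_Mapping.keys_add)
  then show ?thesis
    by (simp add: eval4_superset[of ?S] lookup_add distrib_right sum.distrib)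
qed

lemma eval4_diff: "eval4 (F - G) v = eval4 F v - eval4 (G :: 'a::comm_ring_1 poly4) v"
  using eval4_add[of "F - G" G v] by simp

lemma eval4_sum: "eval4 (sum f I) v = (\<Sum>i\<in>I. eval4 (f i) v)"
  by (induction I rule: infinite_finite_induct) (auto simp: eval4_add)

lemma poly4_decompose:
  fixes F :: "'a::comm_monoid_add poly4"
  shows "F = (\<Sum>e\<in>Poly_Mapping.keys F. Poly_Mapping.single e (Poly_Mapping.lookup F e))"
proof (rule poly_mapping_eqI)
  fix e
  show "Poly_Mapping.lookup F e = Poly_Mapping.lookup
    (\<Sum>e\<in>Poly_Mapping.keys F. Poly_Mapping.single e (Poly_Mapping.lookup F e)) e"
    by (auto simp: lookup_sum lookup_single when_def sum.delta in_keys_iff)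
qed

lemma eval4_mult: "eval4 (F * G) v = eval4 F v * eval4 G v"
proof -
  have 1: "eval4 (Poly_Mapping.single e c * Poly_Mapping.single e' c') v =
     eval4 (Poly_Mapping.single e c) v * eval4 (Poly_Mapping.single e' c') v" for e e' c c'
    by (simp add: mult_single eval4_single lookup_add power_add prod.distrib mult_ac)
  have "eval4 (F * G) v = eval4 ((\<Sum>e\<in>Poly_Mapping.keys F. Poly_Mapping.single e (Poly_Mapping.lookup F e))
     * (\<Sum>e\<in>Poly_Mapping.keys G. Poly_Mapping.single e (Poly_Mapping.lookup G e))) v"
    by (simp flip: poly4_decompose)
  also have "\<dots> = eval4 (\<Sum>e\<in>Poly_Mapping.keys F. Poly_Mapping.single e (Poly_Mapping.lookup F e)) v
     * eval4 (\<Sum>e\<in>Poly_Mapping.keys G. Poly_Mapping.single e (Poly_Mapping.lookup G e)) v"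
    by (simp add: sum_product eval4_sum 1)
  finally show ?thesis by (simp flip: poly4_decompose)
qed

lemma homogeneous4_mult:
  assumes "homogeneous4 d F" "homogeneous4 e G"
  shows "homogeneous4 (d + e) (F * G)"
  unfolding homogeneous4_def
proof
  fix k assume "k \<in> Poly_Mapping.keys (F * G)"
  then obtain a b where "a \<in> Poly_Mapping.keys F" "b \<in> Poly_Mapping.keys G" "k = a + b"
    using Poly_Mapping.keys_mult[of F G] by blast
  then show "(\<Sum>i\<in>UNIV. Poly_Mapping.lookup k i) = d + e"
    using assms by (simp add: homogeneous4_def lookup_add sum.distrib)
qed

lemma homogeneous4_add:
  "homogeneous4 d F \<Longrightarrow> homogeneous4 d G \<Longrightarrow> homogeneous4 d (F + G)"
  unfolding homogeneous4_def using Poly_Mapping.keys_add[of F G] by blast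

lemma homogeneous4_diff:
  "homogeneous4 d F \<Longrightarrow> homogeneous4 d G \<Longrightarrow> homogeneous4 d (F - G :: 'a::ab_group_add poly4)"
  unfolding homogeneous4_def using Poly_Mapping.keys_diff[of F G] by blast

text \<open>The functions given by the homogeneous polynomials of degree \<open>d\<close> with coefficients in \<open>S\<close>.\<close>

definition forms :: "'a set \<Rightarrow> nat \<Rightarrow> ('a::comm_ring_1 ^ 4 \<Rightarrow> 'a) set" where
  "forms S d = {eval4 F | F. homogeneous4 d F \<and> (\<forall>e. Poly_Mapping.lookup F e \<in> S)}"

text \<open>Closure under negation is not needed.\<close>

definition coeff_ring :: "'a::comm_ring_1 set \<Rightarrow> bool" where
  "coeff_ring S \<longleftrightarrow> 0 \<in> S \<and> 1 \<in> S \<and> (\<forall>a\<in>S. \<forall>b\<in>S. a + b \<in> S \<and> a * b \<in> S)"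

lemma coeff_ring_UNIV [simp]: "coeff_ring UNIV"
  by (simp add: coeff_ring_def)

lemma coeff_ring_sum:
  assumes "coeff_ring S" "\<And>i. i \<in> I \<Longrightarrow> f i \<in> S"
  shows "sum f I \<in> S"
  using assms(2) by (induction I rule: infinite_finite_induct) (use assms(1) in \<open>auto simp: coeff_ring_def\<close>)

lemma forms_eval4: "homogeneous4 d F \<Longrightarrow> eval4 F \<in> forms UNIV d"
  by (auto simp: forms_def)

lemma forms_add:
  assumes "coeff_ring S" "g \<in> forms S d" "h \<in> forms S d"
  shows "(\<lambda>v. g v + h v) \<in> forms S d"
proof -
  obtain F G where "homogeneous4 d F" "\<forall>e. Poly_Mapping.lookup F e \<in> S" "g = eval4 F"
    "homogeneous4 d G" "\<forall>e. Poly_Mapping.lookup G e \<in> S" "h = eval4 G"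
    using assms by (auto simp: forms_def)
  then show ?thesis using assms(1) unfolding forms_def
    by (intro CollectI exI[of _ "F + G"])
       (auto simp: homogeneous4_add eval4_add lookup_add coeff_ring_def)
qed

lemma forms_mult:
  assumes "coeff_ring S" "g \<in> forms S d" "h \<in> forms S e"
  shows "(\<lambda>v. g v * h v) \<in> forms S (d + e)"
proof -
  obtain F G where FG: "homogeneous4 d F" "\<forall>e. Poly_Mapping.lookup F e \<in> S" "g = eval4 F"
    "homogeneous4 e G" "\<forall>e. Poly_Mapping.lookup G e \<in> S" "h = eval4 G"
    using assms by (auto simp: forms_def)
  have "Poly_Mapping.lookup (F * G) k \<in> S" for k
  proof -
    have "F * G = (\<Sum>e\<in>Poly_Mapping.keys F. Poly_Mapping.single e (Poly_Mapping.lookup F e))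
     * (\<Sum>e\<in>Poly_Mapping.keys G. Poly_Mapping.single e (Poly_Mapping.lookup G e))"
      by (simp flip: poly4_decompose)
    also have "\<dots> = (\<Sum>a\<in>Poly_Mapping.keys F. \<Sum>b\<in>Poly_Mapping.keys G.
        Poly_Mapping.single (a + b) (Poly_Mapping.lookup F a * Poly_Mapping.lookup G b))"
      by (simp add: sum_product mult_single)
    finally show ?thesis
      using FG assms(1) by (auto simp: lookup_sum lookup_single when_def coeff_ring_def
          intro!: coeff_ring_sum[OF assms(1)])
  qed
  with FG show ?thesis unfolding forms_def
    by (intro CollectI exI[of _ "F * G"]) (auto simp: homogeneous4_mult eval4_mult)
qed

lemma forms_zero: "coeff_ring S \<Longrightarrow> (\<lambda>v. 0) \<in> forms S d"
  unfolding forms_def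
  by (intro CollectI exI[of _ 0]) (auto simp: homogeneous4_def coeff_ring_def)

lemma forms_const: "coeff_ring S \<Longrightarrow> c \<in> S \<Longrightarrow> (\<lambda>v. c) \<in> forms S 0"
  unfolding forms_def
  by (intro CollectI exI[of _ "Poly_Mapping.single 0 c"])
     (auto simp: homogeneous4_def coeff_ring_def eval4_single lookup_single when_def split: if_splits)

lemma forms_coord:
  assumes "coeff_ring S"
  shows "(\<lambda>v :: 'a::comm_ring_1 ^ 4. v $ i) \<in> forms S 1"
proof -
  let ?e = "Poly_Mapping.single i (1::nat)"
  have s: "(\<Sum>j\<in>UNIV. Poly_Mapping.lookup ?e j) = 1"
    by (simp add: lookup_single when_def)
  have "(\<Prod>j\<in>UNIV. v $ j ^ Poly_Mapping.lookup ?e j) = v $ i" for v :: "'a ^ 4"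
  proof -
    have "(\<Prod>j\<in>UNIV. v $ j ^ Poly_Mapping.lookup ?e j) = (\<Prod>j\<in>UNIV. if j = i then v $ j else 1)"
      by (intro prod.cong) (auto simp: lookup_single when_def)
    then show ?thesis by simp
  qed
  then have "eval4 (Poly_Mapping.single ?e 1) = (\<lambda>v. v $ i :: 'a)"
    by (auto simp: eval4_single)
  moreover have "homogeneous4 1 (Poly_Mapping.single ?e (1::'a))"
    using s by (auto simp: homogeneous4_def)
  moreover have "Poly_Mapping.lookup (Poly_Mapping.single ?e (1::'a)) k \<in> S" for k
    using assms by (auto simp: lookup_single when_def coeff_ring_def)
  ultimately show ?thesis unfolding forms_def by force
qed

lemma forms_scale:
  assumes "coeff_ring S" "c \<in> S" "g \<in> forms S d"
  shows "(\<lambda>v. c * g v) \<in> forms S d"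
  using forms_mult[OF assms(1) forms_const[OF assms(1,2)] assms(3)] by simp

lemma forms_power:
  assumes "coeff_ring S" "g \<in> forms S d"
  shows "(\<lambda>v. g v ^ n) \<in> forms S (n * d)"
proof (induction n)
  case 0
  then show ?case using forms_const[OF assms(1), of 1] assms(1) by (simp add: coeff_ring_def)
next
  case (Suc n)
  then show ?case using forms_mult[OF assms(1) assms(2) Suc] by simp
qed

lemma forms_sum:
  assumes "coeff_ring S" "\<And>i. i \<in> I \<Longrightarrow> g i \<in> forms S d"
  shows "(\<lambda>v. \<Sum>i\<in>I. g i v) \<in> forms S d"
  using assms(2)
  by (induction I rule: infinite_finite_induct) (auto intro: forms_zero forms_add assms(1))

lemma forms_prod:
  assumes "coeff_ring S" "finite I" "\<And>i. i \<in> I \<Longrightarrow> g i \<in> forms S d"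
  shows "(\<lambda>v. \<Prod>i\<in>I. g i v) \<in> forms S (card I * d)"
  using assms(2,3)
proof (induction I rule: finite_induct)
  case empty
  then show ?case using forms_const[OF assms(1), of 1] assms(1) by (simp add: coeff_ring_def)
next
  case (insert x I)
  then show ?case using forms_mult[OF assms(1), of "g x" d "\<lambda>v. \<Prod>i\<in>I. g i v" "card I * d"] by simp
qed

text \<open>Forms are generated from constants by addition and by multiplication with coordinates.\<close>

lemma forms_induct [consumes 1, case_names zero const add coord]:
  fixes Q :: "nat \<Rightarrow> ('a::comm_ring_1 ^ 4 \<Rightarrow> 'a) \<Rightarrow> bool"
  assumes g: "g \<in> forms S d"
    and zero: "\<And>d. Q d (\<lambda>_. 0)"
    and const: "\<And>c. c \<in> S \<Longrightarrow> Q 0 (\<lambda>_. c)"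
    and add: "\<And>d g h. Q d g \<Longrightarrow> Q d h \<Longrightarrow> Q d (\<lambda>v. g v + h v)"
    and coord: "\<And>d i g. Q d g \<Longrightarrow> Q (Suc d) (\<lambda>v. v $ i * g v)"
  shows "Q d g"
proof -
  have pow: "Q (n + d) (\<lambda>v. v $ i ^ n * g v)" if "Q d g" for n d i g
    using that
  proof (induction n)
    case (Suc n)
    then show ?case using coord[of "n + d" "\<lambda>v. v $ i ^ n * g v" i] by (simp add: mult.assoc)
  qed simp
  have mono: "Q (\<Sum>i\<in>UNIV. Poly_Mapping.lookup e i) (\<lambda>v. c * (\<Prod>i\<in>UNIV. v $ i ^ Poly_Mapping.lookup e i))"
    if c: "c \<in> S" for c and e :: "4 \<Rightarrow>\<^sub>0 nat"
  proof -
    have "Q (Poly_Mapping.lookup e 1 + (Poly_Mapping.lookup e 2 + (Poly_Mapping.lookup e 3 + (Poly_Mapping.lookup e 4 + 0))))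
      (\<lambda>v. v $ 1 ^ Poly_Mapping.lookup e 1 * (v $ 2 ^ Poly_Mapping.lookup e 2 *
         (v $ 3 ^ Poly_Mapping.lookup e 3 * (v $ 4 ^ Poly_Mapping.lookup e 4 * c))))"
      by (intro pow const c)
    moreover have "(\<lambda>v. v $ 1 ^ Poly_Mapping.lookup e 1 * (v $ 2 ^ Poly_Mapping.lookup e 2 *
         (v $ 3 ^ Poly_Mapping.lookup e 3 * (v $ 4 ^ Poly_Mapping.lookup e 4 * c)))) =
        (\<lambda>v. c * (\<Prod>i\<in>UNIV. v $ i ^ Poly_Mapping.lookup e i))"
      unfolding UNIV_4 by (simp add: mult_ac)
    moreover have "Poly_Mapping.lookup e 1 + (Poly_Mapping.lookup e 2 + (Poly_Mapping.lookup e 3 + (Poly_Mapping.lookup e 4 + 0)))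
        = (\<Sum>i\<in>UNIV. Poly_Mapping.lookup e i)"
      by (simp add: sum_4)
    ultimately show ?thesis by metis
  qed
  obtain F where F: "homogeneous4 d F" "\<And>e. Poly_Mapping.lookup F e \<in> S" "g = eval4 F"
    using g unfolding forms_def by blast
  have "Q d (\<lambda>v. \<Sum>e\<in>I. Poly_Mapping.lookup F e * (\<Prod>i\<in>UNIV. v $ i ^ Poly_Mapping.lookup e i))"
    if "finite I" "I \<subseteq> Poly_Mapping.keys F" for I
    using that
  proof (induction I rule: finite_induct)
    case empty
    then show ?case using zero by simp
  next
    case (insert e I)
    have "(\<Sum>i\<in>UNIV. Poly_Mapping.lookup e i) = d"
      using insert F(1) by (auto simp: homogeneous4_def)
    with mono[OF F(2)[of e], of e] insert show ?case by (auto intro: add)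
  qed
  from this[of "Poly_Mapping.keys F"] show ?thesis
    using F(3) by (simp add: eval4_def[abs_def])
qed

lemma forms_homogeneous:
  assumes "g \<in> forms S d"
  shows "g (c *s v) = c ^ d * g v"
  using assms by (induction rule: forms_induct) (auto simp: algebra_simps)

lemma forms_UNIV_coord: "(\<lambda>v :: 'a::comm_ring_1 ^ 4. v $ i) \<in> forms UNIV 1"
  by (rule forms_coord[OF coeff_ring_UNIV])

lemmas forms_UNIV_intros =
  forms_add[OF coeff_ring_UNIV] forms_scale[OF coeff_ring_UNIV UNIV_I]
  forms_zero[OF coeff_ring_UNIV] forms_const[OF coeff_ring_UNIV UNIV_I]

lemma forms_diff:
  assumes "g \<in> forms UNIV d" "h \<in> forms UNIV d"
  shows "(\<lambda>v. g v - h v) \<in> forms UNIV d"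
  using forms_add[OF coeff_ring_UNIV assms(1) forms_scale[OF coeff_ring_UNIV UNIV_I[of "-1"] assms(2)]]
  by simp

lemma forms_linear_subst:
  fixes L :: "'a::comm_ring_1 ^ 4 \<Rightarrow> 'a ^ 4"
  assumes "g \<in> forms UNIV d" and "\<And>i. (\<lambda>v. L v $ i) \<in> forms UNIV 1"
  shows "(\<lambda>v. g (L v)) \<in> forms UNIV d"
  using assms(1)
proof (induction rule: forms_induct)
  case (coord d i g)
  then show ?case using forms_mult[OF coeff_ring_UNIV assms(2)[of i] coord] by simp
qed (auto intro: forms_UNIV_intros)


section \<open>Interpolation and separable polynomials\<close>

lemma poly_coeffs_zero:
  fixes c :: "nat \<Rightarrow> 'a::idom"
  assumes "finite Y" "n \<le> card Y" "\<And>y. y \<in> Y \<Longrightarrow> (\<Sum>j<n. c j * y ^ j) = 0" "j < n"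
  shows "c j = 0"
proof -
  define p where "p = (\<Sum>j<n. Polynomial.monom (c j) j)"
  have ev: "poly p y = (\<Sum>j<n. c j * y ^ j)" for y
    by (simp add: p_def poly_sum poly_monom)
  have co: "Polynomial.coeff p i = (if i < n then c i else 0)" for i
    by (simp add: p_def coeff_sum sum.delta)
  have "p = 0"
  proof (rule ccontr)
    assume p: "p \<noteq> 0"
    have "Polynomial.degree p < n"
    proof (rule ccontr)
      assume "\<not> Polynomial.degree p < n"
      then have "Polynomial.lead_coeff p = 0" by (simp add: co)
      with p show False by simp
    qed
    moreover have "card Y \<le> card {x. poly p x = 0}"
      using p assms(3) by (intro card_mono poly_roots_finite) (auto simp: ev)
    moreover have "card {x. poly p x = 0} \<le> Polynomial.degree p"
      by (rule card_poly_roots_bound[OF p])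
    ultimately show False using assms(2) by linarith
  qed
  then show ?thesis using co[of j] assms(4) by simp
qed

lemma bivariate_coeffs_zero:
  fixes c :: "nat \<Rightarrow> nat \<Rightarrow> 'a::idom"
  assumes "finite Y" "n \<le> card Y"
    and "\<And>y. y \<in> Y \<Longrightarrow> finite (Xs y) \<and> m \<le> card (Xs y)"
    and zero: "\<And>x y. y \<in> Y \<Longrightarrow> x \<in> Xs y \<Longrightarrow> (\<Sum>i<m. \<Sum>j<n. c i j * x ^ i * y ^ j) = 0"
    and "i < m" "j < n"
  shows "c i j = 0"
proof -
  have "(\<Sum>j<n. c i j * y ^ j) = 0" if y: "y \<in> Y" for y
  proof (rule poly_coeffs_zero[of "Xs y" m "\<lambda>i. \<Sum>j<n. c i j * y ^ j"])
    fix x assume "x \<in> Xs y"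
    with zero[OF y this] show "(\<Sum>i<m. (\<Sum>j<n. c i j * y ^ j) * x ^ i) = 0"
      by (simp add: sum_distrib_right sum_distrib_left mult_ac)
  qed (use assms y in auto)
  then show ?thesis
    using poly_coeffs_zero[of Y n "c i" j] assms by blast
qed

lemma card_separable_roots:
  fixes p :: "'a::alg_closed_field poly"
  assumes "\<And>x. poly p x = 0 \<Longrightarrow> poly (pderiv p) x \<noteq> 0"
  shows "finite {x. poly p x = 0}" "card {x. poly p x = 0} = Polynomial.degree p"
proof -
  have p0: "p \<noteq> 0" using assms by auto
  have sq: "Polynomial.order a p = 1" if a: "poly p a = 0" for a
  proof -
    have "\<not> [:-a, 1:] ^ 2 dvd p"
    proof
      assume "[:-a, 1:] ^ 2 dvd p"
      then obtain r where "p = [:-a, 1:] ^ 2 * r" by (elim dvdE)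
      moreover define l where "l = [:-a, 1:]"
      ultimately have "p = l * (l * r)" by (simp only: power2_eq_square mult.assoc)
      moreover have "poly l a = 0" by (simp add: l_def)
      ultimately have "poly (pderiv p) a = 0" by (simp add: pderiv_mult)
      with assms a show False by blast
    qed
    then have "Polynomial.order a p < 2"
      using p0 by (simp add: order_divides)
    moreover have "Polynomial.order a p \<noteq> 0"
      using a p0 by (simp add: order_root)
    ultimately show ?thesis by linarith
  qed
  show fin: "finite {x. poly p x = 0}" using p0 by (rule poly_roots_finite)
  obtain M where M: "size M = Polynomial.degree p" "p = Polynomial.smult (Polynomial.lead_coeff p) (\<Prod>x\<in>#M. [:-x, 1:])"
    using alg_closed_imp_factorization[OF p0] by blast
  have "Polynomial.lead_coeff p \<noteq> 0" using p0 by simp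
  then have "proots p = proots (\<Prod>x\<in>#M. [:-x, 1:])"
    by (subst M(2)) simp
  also have "\<dots> = M"
  proof (induction M)
    case (add a M)
    have "(\<Prod>x\<in>#M. [:-x, 1:]) \<noteq> 0" by (auto simp: prod_mset_zero_iff)
    then have "proots ([:-a, 1:] * (\<Prod>x\<in>#M. [:-x, 1:])) = add_mset a M"
      by (subst proots_mult) (auto simp: add simp del: mult_pCons_left)
    then show ?case by simp
  qed simp
  finally have pM: "proots p = M" .
  have "size (proots p) = (\<Sum>x\<in>set_mset (proots p). count (proots p) x)"
    by (rule size_multiset_overloaded_eq)
  also have "\<dots> = (\<Sum>x\<in>{x. poly p x = 0}. 1)"
    using p0 sq by (intro sum.cong) (auto simp: sq)
  finally show "card {x. poly p x = 0} = Polynomial.degree p" using pM M(1) by simp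
qed

section \<open>The affine curve and its two projections to a line\<close>

definition vec4 :: "'a::field \<Rightarrow> 'a \<Rightarrow> 'a \<Rightarrow> 'a \<Rightarrow> 'a ^ 4" where
  "vec4 w x y z = vector [w, x, y, z]"

lemma vec4_nth [simp]:
  "vec4 w x y z $ 1 = w" "vec4 w x y z $ 2 = x" "vec4 w x y z $ 3 = y" "vec4 w x y z $ 4 = z"
  by (simp_all add: vec4_def vector_def)

lemma vec4_eq_iff: "v = v' \<longleftrightarrow> v $ 1 = v' $ 1 \<and> v $ 2 = v' $ 2 \<and> v $ 3 = v' $ 3 \<and> v $ 4 = v' $ (4::4)"
  by (simp add: vec_eq_iff forall_4)

text \<open>An algebraically closed field whose characteristic \<open>p\<close> is such that \<open>q\<close> is a power of \<open>p\<close>.\<close>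

locale gk =
  fixes q :: nat and K :: "'a::alg_closed_field itself"
  assumes prime_char: "Factorial_Ring.prime CHAR('a)" and q_char: "\<exists>e>0. q = CHAR('a) ^ e"
begin

lemma q_ge_2: "2 \<le> q"
proof -
  obtain e where e: "e > 0" "q = CHAR('a) ^ e" using q_char by blast
  have "2 \<le> CHAR('a)" using prime_char by (rule prime_ge_2_nat)
  also have "\<dots> \<le> q" using e self_le_power[of "CHAR('a)" e] calculation by simp
  finally show ?thesis .
qed

lemma frob_add: "((a::'a) + b) ^ q ^ n = a ^ q ^ n + b ^ q ^ n"
proof -
  obtain e where "q = CHAR('a) ^ e" using q_char by blast
  then show ?thesis
    using freshmans_dream'[OF prime_char, of "q ^ n" "e * n" a b] by (simp add: power_mult)
qed

lemma frob_add1: "((a::'a) + b) ^ q = a ^ q + b ^ q"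
  using frob_add[of a b 1] by simp

lemma frob_add2: "((a::'a) + b) ^ q\<^sup>2 = a ^ q\<^sup>2 + b ^ q\<^sup>2"
  by (rule frob_add)

lemma frob_diff: "((a::'a) - b) ^ q ^ n = a ^ q ^ n - b ^ q ^ n"
  using frob_add[of "a - b" b n] by simp

lemma frob_inj: "(a::'a) ^ q ^ n = b ^ q ^ n \<longleftrightarrow> a = b"
  using frob_diff[of a b n] q_ge_2 by (metis power_eq_0_iff right_minus_eq)

lemma frob_surj: "\<exists>b::'a. b ^ q ^ n = a"
proof -
  have "q ^ n > 0" using q_ge_2 by simp
  then show ?thesis using nth_root_exists[of "q ^ n" a] by blast
qed

lemma of_nat_q: "of_nat q = (0::'a)"
proof -
  obtain e where e: "e > 0" "q = CHAR('a) ^ e" using q_char by blast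
  then show ?thesis by (simp add: of_nat_eq_0_iff_char_dvd dvd_power)
qed

definition N :: nat where "N = q * (q - 1) + 1"

lemma N_alt: "N = q\<^sup>2 - q + 1"
  by (simp add: N_def power2_eq_square diff_mult_distrib2)

lemma N_pos: "N > 0" by (simp add: N_def)

lemma N_mult: "N * (q + 1) = q ^ 3 + 1"
proof -
  obtain r where r: "q = Suc r" using q_ge_2 by (cases q) auto
  show ?thesis unfolding N_def unfolding r by (simp add: power3_eq_cube algebra_simps)
qed

lemma N_q: "N + q = q\<^sup>2 + 1"
proof -
  obtain r where r: "q = Suc r" using q_ge_2 by (cases q) auto
  show ?thesis unfolding N_def unfolding r by (simp add: power2_eq_square algebra_simps)
qed

lemma of_nat_N: "of_nat N = (1::'a)"
  by (simp add: N_def of_nat_q)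

lemma of_nat_q1: "of_nat (q + 1) = (1::'a)"
  by (simp add: of_nat_q)

text \<open>The affine curve, in homogeneous coordinates normalized by \<open>v $ 1 = 1\<close>.\<close>

definition C :: "('a ^ 4) set" where
  "C = {v. v $ 1 = 1 \<and> v $ 3 ^ (q + 1) = v $ 2 ^ q + v $ 2 \<and> v $ 4 ^ N = v $ 3 ^ q\<^sup>2 - v $ 3}"

lemma C_D:
  assumes "v \<in> C"
  shows "v $ 1 = 1" "v $ 3 ^ (q + 1) = v $ 2 ^ q + v $ 2" "v $ 4 ^ N = v $ 3 ^ q\<^sup>2 - v $ 3"
  using assms by (auto simp: C_def)

lemma vec4_in_C: "vec4 w x y z \<in> C \<longleftrightarrow> w = 1 \<and> y ^ (q + 1) = x ^ q + x \<and> z ^ N = y ^ q\<^sup>2 - y"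
  by (simp add: C_def)

lemma C_expand: "v \<in> C \<Longrightarrow> v = vec4 1 (v $ 2) (v $ 3) (v $ 4)"
  by (simp add: vec4_eq_iff C_D)

lemma card_additive_fibre:
  assumes "c \<noteq> 0" "n > 0"
  shows "finite {y::'a. y ^ q ^ n + c * y = u}" "card {y::'a. y ^ q ^ n + c * y = u} = q ^ n"
proof -
  define p where "p = Polynomial.monom 1 (q ^ n) + [:- u, c:]"
  have qn: "q ^ n > 1" using one_less_power[of q n] q_ge_2 assms(2) by linarith
  have ev: "poly p y = 0 \<longleftrightarrow> y ^ q ^ n + c * y = u" for y
    by (simp add: p_def poly_monom algebra_simps)
  have deg: "Polynomial.degree p = q ^ n"
    unfolding p_def using qn q_ge_2
    by (subst degree_add_eq_left) (auto simp: degree_monom_eq)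
  have "of_nat (q ^ n) = (0::'a)" using assms(2) by (simp add: of_nat_q)
  then have "pderiv p = [:c:]"
    unfolding p_def by (simp add: pderiv_add pderiv_monom pderiv_pCons)
  then have sep: "poly (pderiv p) y \<noteq> 0" for y using assms(1) by simp
  show "finite {y::'a. y ^ q ^ n + c * y = u}" "card {y::'a. y ^ q ^ n + c * y = u} = q ^ n"
    using card_separable_roots[of p] sep by (simp_all add: ev deg)
qed

lemma card_radical_fibre:
  assumes "a \<noteq> 0" "n > 0" "of_nat n \<noteq> (0::'a)"
  shows "finite {y::'a. y ^ n = a}" "card {y::'a. y ^ n = a} = n"
proof -
  define p where "p = Polynomial.monom 1 n - [:a:]"
  have ev: "poly p y = 0 \<longleftrightarrow> y ^ n = a" for y by (simp add: p_def poly_monom)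
  have deg: "Polynomial.degree p = n"
    unfolding p_def using assms(2)
    by (subst diff_conv_add_uminus, subst degree_add_eq_left) (auto simp: degree_monom_eq)
  have "pderiv p = Polynomial.monom (of_nat n) (n - 1)"
    unfolding p_def by (simp add: pderiv_diff pderiv_monom pderiv_pCons)
  then have sep: "poly (pderiv p) y \<noteq> 0" if "poly p y = 0" for y
    using that assms by (auto simp: ev poly_monom power_0_left)
  show "finite {y::'a. y ^ n = a}" "card {y::'a. y ^ n = a} = n"
    using card_separable_roots[of p] sep by (simp_all add: ev deg)
qed

lemma infinite_K: "infinite (UNIV :: 'a set)"
proof
  assume fin: "finite (UNIV :: 'a set)"
  let ?n = "card (UNIV :: 'a set)"
  have "?n > 0" using fin by (simp add: card_gt_0_iff)
  then have "q ^ ?n \<le> ?n"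
    using card_additive_fibre(2)[of 1 ?n 0] card_mono[OF fin, of "{y::'a. y ^ q ^ ?n + 1 * y = 0}"] by simp
  moreover have "?n < 2 ^ ?n" by (rule less_exp)
  moreover have "2 ^ ?n \<le> q ^ ?n" using q_ge_2 by (rule power_mono) simp
  ultimately show False by linarith
qed

lemma poly_zero_if_all_roots: "(\<And>x::'a. poly p x = 0) \<Longrightarrow> p = 0"
  using poly_roots_finite[of p] infinite_K by auto

text \<open>The functions that agree on the affine curve with a sum of terms \<open>c\<^sub>j\<^sub>k(v\<^sub>s) v\<^sub>t\<^sup>j v\<^sub>u\<^sup>k\<close> over \<open>j < m\<close> and
  \<open>k < n\<close>, where the \<open>c\<^sub>j\<^sub>k\<close> are polynomials in the coordinate \<open>v\<^sub>s\<close> and \<open>P\<close> restricts their degrees.\<close>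

definition rep :: "4 \<Rightarrow> 4 \<Rightarrow> nat \<Rightarrow> 4 \<Rightarrow> nat \<Rightarrow> (nat \<Rightarrow> nat \<Rightarrow> nat \<Rightarrow> bool) \<Rightarrow> ('a ^ 4 \<Rightarrow> 'a) set" where
  "rep s t m u n P = {\<phi>. \<exists>c. (\<forall>j k. c j k \<noteq> 0 \<longrightarrow> P (Polynomial.degree (c j k)) j k) \<and>
     (\<forall>v\<in>C. \<phi> v = (\<Sum>j<m. \<Sum>k<n. poly (c j k) (v $ s) * v $ t ^ j * v $ u ^ k))}"

text \<open>Lowering the degree of a coefficient keeps it admissible.\<close>

definition deg_closed :: "(nat \<Rightarrow> nat \<Rightarrow> nat \<Rightarrow> bool) \<Rightarrow> bool" where
  "deg_closed P \<longleftrightarrow> (\<forall>a b j k. a \<le> b \<longrightarrow> P b j k \<longrightarrow> P a j k)"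

lemma repI:
  assumes "\<And>j k. c j k \<noteq> 0 \<Longrightarrow> P (Polynomial.degree (c j k)) j k"
    and "\<And>v. v \<in> C \<Longrightarrow> \<phi> v = (\<Sum>j<m. \<Sum>k<n. poly (c j k) (v $ s) * v $ t ^ j * v $ u ^ k)"
  shows "\<phi> \<in> rep s t m u n P"
  unfolding rep_def using assms by blast

lemma repE:
  assumes "\<phi> \<in> rep s t m u n P"
  obtains c where "\<And>j k. c j k \<noteq> 0 \<Longrightarrow> P (Polynomial.degree (c j k)) j k"
    and "\<And>v. v \<in> C \<Longrightarrow> \<phi> v = (\<Sum>j<m. \<Sum>k<n. poly (c j k) (v $ s) * v $ t ^ j * v $ u ^ k)"
  using assms unfolding rep_def by blast

lemma rep_zero: "(\<lambda>v. 0) \<in> rep s t m u n P"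
  by (rule repI[of "\<lambda>_ _. 0"]) simp_all

lemma rep_cong:
  assumes "\<phi> \<in> rep s t m u n P" "\<And>v. v \<in> C \<Longrightarrow> \<psi> v = \<phi> v"
  shows "\<psi> \<in> rep s t m u n P"
  using assms(1)
proof (rule repE)
  fix c
  assume c: "\<And>j k. c j k \<noteq> 0 \<Longrightarrow> P (Polynomial.degree (c j k)) j k"
    "\<And>v. v \<in> C \<Longrightarrow> \<phi> v = (\<Sum>j<m. \<Sum>k<n. poly (c j k) (v $ s) * v $ t ^ j * v $ u ^ k)"
  show ?thesis by (rule repI[of c]) (simp_all only: c assms(2) not_False_eq_True)
qed

lemma rep_mono:
  assumes "\<phi> \<in> rep s t m u n P" "\<And>a j k. P a j k \<Longrightarrow> P' a j k"
  shows "\<phi> \<in> rep s t m u n P'"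
  using assms(1)
proof (rule repE)
  fix c
  assume c: "\<And>j k. c j k \<noteq> 0 \<Longrightarrow> P (Polynomial.degree (c j k)) j k"
    "\<And>v. v \<in> C \<Longrightarrow> \<phi> v = (\<Sum>j<m. \<Sum>k<n. poly (c j k) (v $ s) * v $ t ^ j * v $ u ^ k)"
  have "P' (Polynomial.degree (c j k)) j k" if "c j k \<noteq> 0" for j k
    by (rule assms(2)[OF c(1)[OF that]])
  then show ?thesis using c(2) by (rule repI[of c])
qed

lemma rep_add:
  assumes "deg_closed P" "\<phi> \<in> rep s t m u n P" "\<psi> \<in> rep s t m u n P"
  shows "(\<lambda>v. \<phi> v + \<psi> v) \<in> rep s t m u n P"
proof -
  obtain c where c: "\<And>j k. c j k \<noteq> 0 \<Longrightarrow> P (Polynomial.degree (c j k)) j k"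
    "\<And>v. v \<in> C \<Longrightarrow> \<phi> v = (\<Sum>j<m. \<Sum>k<n. poly (c j k) (v $ s) * v $ t ^ j * v $ u ^ k)"
    using assms(2) by (rule repE) blast
  obtain c' where c': "\<And>j k. c' j k \<noteq> 0 \<Longrightarrow> P (Polynomial.degree (c' j k)) j k"
    "\<And>v. v \<in> C \<Longrightarrow> \<psi> v = (\<Sum>j<m. \<Sum>k<n. poly (c' j k) (v $ s) * v $ t ^ j * v $ u ^ k)"
    using assms(3) by (rule repE) blast
  have "P (Polynomial.degree (c j k + c' j k)) j k" if "c j k + c' j k \<noteq> 0" for j k
  proof -
    consider "c j k = 0" | "c' j k = 0" | "c j k \<noteq> 0" "c' j k \<noteq> 0" by blast
    then show ?thesis
    proof cases
      case 3
      then have "P (max (Polynomial.degree (c j k)) (Polynomial.degree (c' j k))) j k"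
        using c(1) c'(1) by (simp add: max_def)
      then show ?thesis using assms(1) degree_add_le_max unfolding deg_closed_def by blast
    qed (use that c(1) c'(1) in auto)
  qed
  moreover have "\<phi> v + \<psi> v = (\<Sum>j<m. \<Sum>k<n. poly (c j k + c' j k) (v $ s) * v $ t ^ j * v $ u ^ k)"
    if "v \<in> C" for v
    using that by (simp add: c(2) c'(2) sum.distrib distrib_right)
  ultimately show ?thesis by (rule repI[of "\<lambda>j k. c j k + c' j k"])
qed

lemma rep_sum:
  assumes "deg_closed P" "\<And>i. i \<in> I \<Longrightarrow> \<phi> i \<in> rep s t m u n P"
  shows "(\<lambda>v. \<Sum>i\<in>I. \<phi> i v) \<in> rep s t m u n P"
  using assms(2) by (induction I rule: infinite_finite_induct) (auto intro: rep_zero rep_add assms(1))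

lemma rep_term:
  assumes "a \<noteq> 0 \<Longrightarrow> P (Polynomial.degree a) j k" "j < m" "k < n"
  shows "(\<lambda>v. poly a (v $ s) * v $ t ^ j * v $ u ^ k) \<in> rep s t m u n P"
proof -
  have "(\<Sum>j'<m. \<Sum>k'<n. poly (if j' = j \<and> k' = k then a else 0) (v $ s) * v $ t ^ j' * v $ u ^ k')
     = poly a (v $ s) * v $ t ^ j * v $ u ^ k" for v
  proof -
    have "(\<Sum>j'<m. \<Sum>k'<n. poly (if j' = j \<and> k' = k then a else 0) (v $ s) * v $ t ^ j' * v $ u ^ k')
      = (\<Sum>j'<m. if j' = j then poly a (v $ s) * v $ t ^ j * v $ u ^ k else 0)"
    proof (intro sum.cong refl)
      fix j'
      have "(\<Sum>k'<n. poly (if j' = j \<and> k' = k then a else 0) (v $ s) * v $ t ^ j' * v $ u ^ k')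
        = (\<Sum>k'<n. if k' = k then (if j' = j then poly a (v $ s) * v $ t ^ j * v $ u ^ k else 0) else 0)"
        by (intro sum.cong) auto
      then show "(\<Sum>k'<n. poly (if j' = j \<and> k' = k then a else 0) (v $ s) * v $ t ^ j' * v $ u ^ k')
        = (if j' = j then poly a (v $ s) * v $ t ^ j * v $ u ^ k else 0)"
        using assms(3) by simp
    qed
    then show ?thesis using assms(2) by simp
  qed
  moreover have "P (Polynomial.degree (if j' = j \<and> k' = k then a else 0)) j' k'"
    if "(if j' = j \<and> k' = k then a else 0) \<noteq> 0" for j' k'
    using that assms(1) by (auto split: if_splits)
  ultimately show ?thesis
    by (intro repI[of "\<lambda>j' k'. if j' = j \<and> k' = k then a else 0"]) (simp_all only:)
qed

lemma rep_mult:
  assumes "deg_closed P'" "\<phi> \<in> rep s t m u n P"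
    and "\<And>a j k. a \<noteq> 0 \<Longrightarrow> P (Polynomial.degree a) j k \<Longrightarrow> j < m \<Longrightarrow> k < n \<Longrightarrow>
       (\<lambda>v. T v * (poly a (v $ s) * v $ t ^ j * v $ u ^ k)) \<in> rep s t m u n P'"
  shows "(\<lambda>v. T v * \<phi> v) \<in> rep s t m u n P'"
proof -
  obtain c where c: "\<And>j k. c j k \<noteq> 0 \<Longrightarrow> P (Polynomial.degree (c j k)) j k"
    "\<And>v. v \<in> C \<Longrightarrow> \<phi> v = (\<Sum>j<m. \<Sum>k<n. poly (c j k) (v $ s) * v $ t ^ j * v $ u ^ k)"
    using assms(2) by (rule repE) blast
  have "(\<lambda>v. T v * (poly (c j k) (v $ s) * v $ t ^ j * v $ u ^ k)) \<in> rep s t m u n P'"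
    if "j < m" "k < n" for j k
  proof (cases "c j k = 0")
    case True
    then show ?thesis using rep_zero by simp
  qed (use assms(3) c(1) that in blast)
  then have "(\<lambda>v. \<Sum>j<m. \<Sum>k<n. T v * (poly (c j k) (v $ s) * v $ t ^ j * v $ u ^ k)) \<in> rep s t m u n P'"
    by (intro rep_sum assms(1)) auto
  then show ?thesis by (rule rep_cong) (simp add: c(2) sum_distrib_left)
qed

subsection \<open>Coordinates over the x-line\<close>

text \<open>The degree of the term is at most \<open>d\<close>; the flag \<open>b\<close> forbids the pure power \<open>x\<^sup>d\<close>.\<close>

definition adm1 :: "bool \<Rightarrow> nat \<Rightarrow> nat \<Rightarrow> nat \<Rightarrow> nat \<Rightarrow> bool" where
  "adm1 b d a j k \<longleftrightarrow> a + j + k \<le> d \<and> (b \<and> j = 0 \<and> k = 0 \<longrightarrow> a < d)"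

lemma deg_closed_adm1 [simp]: "deg_closed (adm1 b d)"
  by (auto simp: deg_closed_def adm1_def)

text \<open>Functions represented by the monomials \<open>x\<^sup>i y\<^sup>j z\<^sup>k\<close> with \<open>i + j + k \<le> d\<close>, \<open>j \<le> q\<close> and
  \<open>k \<le> q\<^sup>2 - q\<close>; if the flag is set, the monomial \<open>x\<^sup>d\<close> is excluded.\<close>

abbreviation rep1 :: "bool \<Rightarrow> nat \<Rightarrow> ('a ^ 4 \<Rightarrow> 'a) set" where
  "rep1 b d \<equiv> rep 2 3 (q + 1) 4 N (adm1 b d)"

lemma rep1_mono: "\<phi> \<in> rep1 b d \<Longrightarrow> d \<le> d' \<Longrightarrow> \<phi> \<in> rep1 b d'"
  by (erule rep_mono) (auto simp: adm1_def)

lemma rep1_mono': "\<phi> \<in> rep1 b d \<Longrightarrow> d < d' \<Longrightarrow> \<phi> \<in> rep1 b' d'"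
  by (erule rep_mono) (auto simp: adm1_def)

lemma rep1_False: "\<phi> \<in> rep1 b d \<Longrightarrow> \<phi> \<in> rep1 False d"
  by (erule rep_mono) (auto simp: adm1_def)

lemma rep1_poly:
  assumes "\<phi> \<in> rep1 b d" "Polynomial.degree p \<le> n"
  shows "(\<lambda>v. poly p (v $ 2) * \<phi> v) \<in> rep1 False (d + n)"
proof (rule rep_mult[OF deg_closed_adm1 assms(1)])
  fix a :: "'a poly" and j k assume "adm1 b d (Polynomial.degree a) j k" and jk: "j < q + 1" "k < N"
  then have "adm1 False (d + n) (Polynomial.degree (p * a)) j k"
    using degree_mult_le[of p a] assms(2) by (auto simp: adm1_def)
  then have "(\<lambda>v. poly (p * a) (v $ 2) * v $ 3 ^ j * v $ 4 ^ k) \<in> rep1 False (d + n)"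
    using jk by (intro rep_term)
  then show "(\<lambda>v. poly p (v $ 2) * (poly a (v $ 2) * v $ 3 ^ j * v $ 4 ^ k)) \<in> rep1 False (d + n)"
    by (simp add: mult_ac)
qed

lemma rep1_x:
  assumes "\<phi> \<in> rep1 b d"
  shows "(\<lambda>v. v $ 2 * \<phi> v) \<in> rep1 b (Suc d)"
proof (rule rep_mult[OF deg_closed_adm1 assms(1)])
  fix a :: "'a poly" and j k assume a: "a \<noteq> 0" "adm1 b d (Polynomial.degree a) j k" and jk: "j < q + 1" "k < N"
  then have "adm1 b (Suc d) (Polynomial.degree (pCons 0 a)) j k"
    by (auto simp: adm1_def)
  then have "(\<lambda>v. poly (pCons 0 a) (v $ 2) * v $ 3 ^ j * v $ 4 ^ k) \<in> rep1 b (Suc d)"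
    using jk by (intro rep_term)
  then show "(\<lambda>v. v $ 2 * (poly a (v $ 2) * v $ 3 ^ j * v $ 4 ^ k)) \<in> rep1 b (Suc d)"
    by (simp add: mult_ac)
qed

lemma rep1_y:
  assumes "\<phi> \<in> rep1 b d"
  shows "(\<lambda>v. v $ 3 * \<phi> v) \<in> rep1 True (Suc d)"
proof (rule rep_mult[OF deg_closed_adm1 assms(1)])
  fix a :: "'a poly" and j k assume a: "a \<noteq> 0" "adm1 b d (Polynomial.degree a) j k" and jk: "j < q + 1" "k < N"
  show "(\<lambda>v. v $ 3 * (poly a (v $ 2) * v $ 3 ^ j * v $ 4 ^ k)) \<in> rep1 True (Suc d)"
  proof (cases "j < q")
    case True
    have "adm1 True (Suc d) (Polynomial.degree a) (Suc j) k"
      using a(2) by (auto simp: adm1_def)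
    then have "(\<lambda>v. poly a (v $ 2) * v $ 3 ^ Suc j * v $ 4 ^ k) \<in> rep1 True (Suc d)"
      using True jk by (intro rep_term) auto
    then show ?thesis by (simp add: mult_ac)
  next
    case False
    then have j: "j = q" using jk by simp
    let ?p = "Polynomial.monom 1 q + Polynomial.monom (1::'a) 1"
    have "Polynomial.degree ?p \<le> q"
      using q_ge_2 by (intro degree_add_le) (auto intro: order_trans[OF degree_monom_le])
    then have "Polynomial.degree (?p * a) \<le> q + Polynomial.degree a"
      using degree_mult_le[of ?p a] by linarith
    then have "adm1 True (Suc d) (Polynomial.degree (?p * a)) 0 k"
      using a(2) j by (auto simp: adm1_def)
    then have "(\<lambda>v. poly (?p * a) (v $ 2) * v $ 3 ^ 0 * v $ 4 ^ k) \<in> rep1 True (Suc d)"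
      using jk by (intro rep_term) auto
    then show ?thesis
    proof (rule rep_cong)
      fix v assume "v \<in> C"
      have "v $ 3 * (poly a (v $ 2) * v $ 3 ^ j * v $ 4 ^ k) = v $ 3 ^ (q + 1) * (poly a (v $ 2) * v $ 4 ^ k)"
        by (simp add: j mult_ac)
      also have "\<dots> = poly (?p * a) (v $ 2) * v $ 3 ^ 0 * v $ 4 ^ k"
        by (simp only: C_D(2)[OF \<open>v \<in> C\<close>]) (simp add: poly_monom algebra_simps)
      finally show "v $ 3 * (poly a (v $ 2) * v $ 3 ^ j * v $ 4 ^ k) =
        poly (?p * a) (v $ 2) * v $ 3 ^ 0 * v $ 4 ^ k" .
    qed
  qed
qed

lemma power_q_square: "(y::'a) ^ q\<^sup>2 = y * (y ^ (q + 1)) ^ (q - 1)"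
proof -
  have "q\<^sup>2 = Suc ((q + 1) * (q - 1))"
    using q_ge_2 by (cases q) (simp_all add: power2_eq_square)
  then show ?thesis by (simp only: power_Suc power_mult)
qed

text \<open>On the curve, \<open>z\<^sup>N\<close> is a polynomial of the same degree \<open>N\<close> in \<open>x\<close> and \<open>y\<close>.\<close>

lemma zN_eq: "v \<in> C \<Longrightarrow> v $ 4 ^ N = v $ 3 * ((v $ 2 ^ q + v $ 2) ^ (q - 1) - 1)"
proof -
  assume v: "v \<in> C"
  have "v $ 4 ^ N = v $ 3 * (v $ 2 ^ q + v $ 2) ^ (q - 1) - v $ 3"
    by (simp only: C_D(2)[OF v] C_D(3)[OF v] power_q_square)
  then show ?thesis by (simp only: right_diff_distrib mult_1_right)
qed

lemma rep1_z:
  assumes "\<phi> \<in> rep1 b d"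
  shows "(\<lambda>v. v $ 4 * \<phi> v) \<in> rep1 True (Suc d)"
proof (rule rep_mult[OF deg_closed_adm1 assms(1)])
  fix a :: "'a poly" and j k assume a: "a \<noteq> 0" "adm1 b d (Polynomial.degree a) j k" and jk: "j < q + 1" "k < N"
  show "(\<lambda>v. v $ 4 * (poly a (v $ 2) * v $ 3 ^ j * v $ 4 ^ k)) \<in> rep1 True (Suc d)"
  proof (cases "Suc k < N")
    case True
    have "adm1 True (Suc d) (Polynomial.degree a) j (Suc k)"
      using a(2) by (auto simp: adm1_def)
    then have "(\<lambda>v. poly a (v $ 2) * v $ 3 ^ j * v $ 4 ^ Suc k) \<in> rep1 True (Suc d)"
      using True jk by (intro rep_term) auto
    then show ?thesis by (simp add: mult_ac)
  next
    case False
    then have k: "N = Suc k" using jk by simp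
    let ?p = "(Polynomial.monom 1 q + Polynomial.monom (1::'a) 1) ^ (q - 1) - 1"
    have "Polynomial.degree (Polynomial.monom 1 q + Polynomial.monom (1::'a) 1) \<le> q"
      using q_ge_2 by (intro degree_add_le) (auto intro: order_trans[OF degree_monom_le])
    then have "Polynomial.degree ((Polynomial.monom 1 q + Polynomial.monom (1::'a) 1) ^ (q - 1)) \<le> q * (q - 1)"
      using degree_power_le[of "Polynomial.monom 1 q + Polynomial.monom (1::'a) 1" "q - 1"]
      by (meson le_trans mult_le_mono1)
    then have deg: "Polynomial.degree ?p \<le> q * (q - 1)"
      by (intro degree_diff_le) auto
    have "adm1 False (Polynomial.degree a + j) (Polynomial.degree a) j 0"
      by (auto simp: adm1_def)
    then have "(\<lambda>v. poly a (v $ 2) * v $ 3 ^ j * v $ 4 ^ 0) \<in> rep1 False (Polynomial.degree a + j)"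
      using jk N_pos by (intro rep_term) auto
    from rep1_y[OF rep1_poly[OF this deg]]
    have "(\<lambda>v. v $ 3 * (poly ?p (v $ 2) * (poly a (v $ 2) * v $ 3 ^ j * v $ 4 ^ 0)))
       \<in> rep1 True (Suc (Polynomial.degree a + j + q * (q - 1)))" .
    moreover have "Polynomial.degree a + j + q * (q - 1) \<le> d"
      using a(2) k by (simp add: adm1_def N_def)
    ultimately have "(\<lambda>v. v $ 3 * (poly ?p (v $ 2) * (poly a (v $ 2) * v $ 3 ^ j * v $ 4 ^ 0)))
       \<in> rep1 True (Suc d)"
      by (rule rep1_mono[OF _ iffD2[OF Suc_le_mono]])
    then show ?thesis
    proof (rule rep_cong)
      fix v assume "v \<in> C"
      have "v $ 4 * (poly a (v $ 2) * v $ 3 ^ j * v $ 4 ^ k) = v $ 4 ^ N * (poly a (v $ 2) * v $ 3 ^ j)"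
        by (simp add: k mult_ac)
      also have "\<dots> = v $ 3 * (poly ?p (v $ 2) * (poly a (v $ 2) * v $ 3 ^ j * v $ 4 ^ 0))"
        by (simp add: zN_eq[OF \<open>v \<in> C\<close>] poly_monom poly_power mult_ac)
      finally show "v $ 4 * (poly a (v $ 2) * v $ 3 ^ j * v $ 4 ^ k) =
        v $ 3 * (poly ?p (v $ 2) * (poly a (v $ 2) * v $ 3 ^ j * v $ 4 ^ 0))" .
    qed
  qed
qed

lemma rep1_const: "(\<lambda>v. c) \<in> rep1 False d"
  using rep_term[of "[:c:]" "adm1 False d" 0 0 "q + 1" N 2 3 4] N_pos by (simp add: adm1_def)

text \<open>Reduction to the monomials above does not raise the degree. The second conjunct singles out the coefficient of \<open>x\<^sup>d\<close>, which is the value at the point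
  at infinity.\<close>

lemma forms_rep1:
  assumes "\<phi> \<in> forms UNIV d"
  shows "\<phi> \<in> rep1 False d \<and> (\<lambda>v. \<phi> v - \<phi> (vec4 0 1 0 0) * v $ 2 ^ d) \<in> rep1 True d"
  using assms
proof (induction rule: forms_induct)
  case (zero d)
  then show ?case using rep_zero by simp
next
  case (const c)
  then show ?case using rep_zero rep1_const by simp
next
  case (add d g h)
  have "(\<lambda>v. (g v - g (vec4 0 1 0 0) * v $ 2 ^ d) + (h v - h (vec4 0 1 0 0) * v $ 2 ^ d)) \<in> rep1 True d"
    using add by (intro rep_add) auto
  moreover have "(\<lambda>v. g v + h v) \<in> rep1 False d"
    using add by (intro rep_add) auto
  ultimately show ?case by (simp add: algebra_simps)
next
  case (coord d i g)
  consider "i = 1" | "i = 2" | "i = 3" | "i = 4" using exhaust_4 by metis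
  then show ?case
  proof cases
    case 1
    have "g \<in> rep1 b (Suc d)" for b
      by (rule rep1_mono'[of g False d]) (use coord in auto)
    then have "(\<lambda>v. v $ i * g v) \<in> rep1 b (Suc d)" for b
      by (rule rep_cong) (simp add: 1 C_D)
    then show ?thesis by (simp add: 1)
  next
    case 2
    have "(\<lambda>v. v $ 2 * (g v - g (vec4 0 1 0 0) * v $ 2 ^ d)) \<in> rep1 True (Suc d)"
      using coord by (intro rep1_x) auto
    moreover have "(\<lambda>v. v $ 2 * g v) \<in> rep1 False (Suc d)"
      by (rule rep1_x) (use coord in blast)
    ultimately show ?thesis unfolding 2 by (simp add: algebra_simps)
  next
    case 3
    have *: "(\<lambda>v. v $ 3 * g v) \<in> rep1 True (Suc d)"
      by (rule rep1_y) (use coord in blast)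
    show ?thesis unfolding 3 using * rep1_False[OF *] by simp
  next
    case 4
    have *: "(\<lambda>v. v $ 4 * g v) \<in> rep1 True (Suc d)"
      by (rule rep1_z) (use coord in blast)
    show ?thesis unfolding 4 using * rep1_False[OF *] by simp
  qed
qed

text \<open>The monomials \<open>x\<^sup>i y\<^sup>j z\<^sup>k\<close> with \<open>j \<le> q\<close> and \<open>k \<le> q\<^sup>2 - q\<close> are linearly independent: almost
  every fibre over the \<open>x\<close>-line has \<open>(q + 1) N\<close> points.\<close>

lemma rep1_indep:
  assumes "\<And>v. v \<in> C \<Longrightarrow> v $ 2 \<noteq> 0 \<Longrightarrow> v $ 4 \<noteq> 0 \<Longrightarrow>
      (\<Sum>j<q + 1. \<Sum>k<N. poly (c j k) (v $ 2) * v $ 3 ^ j * v $ 4 ^ k) = 0"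
    and "j < q + 1" "k < N"
  shows "c j k = 0"
proof -
  define A where "A = Polynomial.monom 1 q + Polynomial.monom (1::'a) 1"
  define B where "B = A ^ (q - 1) - 1"
  have evA: "poly A x = x ^ q + x" for x by (simp add: A_def poly_monom)
  have evB: "poly B x = (x ^ q + x) ^ (q - 1) - 1" for x by (simp add: B_def evA poly_power)
  have "Polynomial.coeff A 1 = 1" using q_ge_2 by (simp add: A_def)
  then have A0: "A \<noteq> 0" by auto
  have "poly B 0 = -1" using q_ge_2 by (simp add: evB power_0_left)
  then have B0: "B \<noteq> 0" by auto
  have *: "poly (c j k) x = 0" if x: "poly A x \<noteq> 0" "poly B x \<noteq> 0" for x
  proof (rule bivariate_coeffs_zero[of "{y. y ^ (q + 1) = x ^ q + x}" "q + 1"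
        "\<lambda>y. {z. z ^ N = y ^ q\<^sup>2 - y}" N "\<lambda>k j. poly (c j k) x"])
    have x0: "x \<noteq> 0" using x(1) q_ge_2 by (auto simp: evA power_0_left)
    show "finite {y. y ^ (q + 1) = x ^ q + x}" "q + 1 \<le> card {y. y ^ (q + 1) = x ^ q + x}"
      using card_radical_fibre[of "x ^ q + x" "q + 1"] x(1) of_nat_q1 by (simp_all add: evA)
    have uy: "y ^ q\<^sup>2 - y \<noteq> 0" if "y ^ (q + 1) = x ^ q + x" for y
    proof -
      have "y \<noteq> 0" using that x(1) by (auto simp: evA)
      moreover have "y ^ q\<^sup>2 - y = y * poly B x"
        by (simp only: power_q_square that evB right_diff_distrib mult_1_right)
      ultimately show ?thesis using x(2) by simp
    qed
    show "finite {z. z ^ N = y ^ q\<^sup>2 - y} \<and> N \<le> card {z. z ^ N = y ^ q\<^sup>2 - y}"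
      if "y \<in> {y. y ^ (q + 1) = x ^ q + x}" for y
      using card_radical_fibre[of "y ^ q\<^sup>2 - y" N] uy[of y] that N_pos by (simp add: of_nat_N)
    show "(\<Sum>i<N. \<Sum>j<q + 1. poly (c j i) x * z ^ i * y ^ j) = 0"
      if "y \<in> {y. y ^ (q + 1) = x ^ q + x}" "z \<in> {z. z ^ N = y ^ q\<^sup>2 - y}" for y z
    proof -
      have "z \<noteq> 0" using that uy[of y] N_pos by (auto simp: power_0_left)
      moreover have "vec4 1 x y z \<in> C" using that by (simp add: vec4_in_C)
      ultimately have "(\<Sum>j<q + 1. \<Sum>k<N. poly (c j k) x * y ^ j * z ^ k) = 0"
        using assms(1)[of "vec4 1 x y z"] x0 by simp
      then show ?thesis by (subst sum.swap) (simp add: mult_ac)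
    qed
  qed (use assms in auto)
  have "c j k * (A * B) = 0"
  proof (rule poly_zero_if_all_roots)
    fix x show "poly (c j k * (A * B)) x = 0" using *[of x] by auto
  qed
  then show ?thesis using A0 B0 by simp
qed

text \<open>The restriction to points with \<open>x \<noteq> 0\<close> and \<open>z \<noteq> 0\<close> will allow division by \<open>x\<close> and \<open>z\<close>.\<close>

lemma form_zero_generic:
  assumes "\<phi> \<in> rep1 False d" "\<And>v. v \<in> C \<Longrightarrow> v $ 2 \<noteq> 0 \<Longrightarrow> v $ 4 \<noteq> 0 \<Longrightarrow> \<phi> v = 0" "v \<in> C"
  shows "\<phi> v = 0"
proof -
  obtain c where c: "\<And>v. v \<in> C \<Longrightarrow> \<phi> v = (\<Sum>j<q + 1. \<Sum>k<N. poly (c j k) (v $ 2) * v $ 3 ^ j * v $ 4 ^ k)"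
    using assms(1) unfolding rep_def by blast
  have "c j k = 0" if "j < q + 1" "k < N" for j k
    by (rule rep1_indep[OF _ that]) (use c assms(2) in force)
  then show ?thesis using c[OF assms(3)] by (simp del: sum.lessThan_Suc)
qed

text \<open>A form that vanishes on the affine curve vanishes at the point \<open>(0 : 1 : 0 : 0)\<close>.\<close>

lemma form_zero_infinity:
  assumes "\<phi> \<in> forms UNIV d" "\<And>v. v \<in> C \<Longrightarrow> \<phi> v = 0"
  shows "\<phi> (vec4 0 1 0 0) = 0"
proof -
  let ?a = "\<phi> (vec4 0 1 0 0)"
  obtain c where c: "\<And>j k. c j k \<noteq> 0 \<Longrightarrow> adm1 True d (Polynomial.degree (c j k)) j k"
     "\<And>v. v \<in> C \<Longrightarrow> \<phi> v - ?a * v $ 2 ^ d = (\<Sum>j<q + 1. \<Sum>k<N. poly (c j k) (v $ 2) * v $ 3 ^ j * v $ 4 ^ k)"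
    using forms_rep1[OF assms(1)] unfolding rep_def by blast
  let ?c = "\<lambda>j k. if j = 0 \<and> k = 0 then c 0 0 + Polynomial.monom ?a d else c j k"
  have "?c 0 0 = 0"
  proof (rule rep1_indep[of ?c 0 0])
    fix v assume v: "v \<in> C"
    have "(\<Sum>j<q + 1. \<Sum>k<N. poly (?c j k) (v $ 2) * v $ 3 ^ j * v $ 4 ^ k) =
      (\<Sum>j<q + 1. \<Sum>k<N. poly (c j k) (v $ 2) * v $ 3 ^ j * v $ 4 ^ k
         + (if j = 0 then if k = 0 then ?a * v $ 2 ^ d else 0 else 0))"
      by (intro sum.cong refl) (auto simp: poly_monom)
    also have "\<dots> = (\<Sum>j<q + 1. \<Sum>k<N. poly (c j k) (v $ 2) * v $ 3 ^ j * v $ 4 ^ k)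
        + (\<Sum>j<q + 1. \<Sum>k<N. if j = 0 then if k = 0 then ?a * v $ 2 ^ d else 0 else 0)"
      by (simp only: sum.distrib)
    also have "(\<Sum>j<q + 1. \<Sum>k<N. if j = 0 then if k = 0 then ?a * v $ 2 ^ d else 0 else 0)
       = (\<Sum>j<q + 1. if j = 0 then ?a * v $ 2 ^ d else 0)"
      using N_pos by (intro sum.cong refl) auto
    also have "\<dots> = ?a * v $ 2 ^ d" by (subst sum.delta) auto
    also have "(\<Sum>j<q + 1. \<Sum>k<N. poly (c j k) (v $ 2) * v $ 3 ^ j * v $ 4 ^ k) = - (?a * v $ 2 ^ d)"
      using c(2)[OF v] assms(2)[OF v] by simp
    finally show "(\<Sum>j<q + 1. \<Sum>k<N. poly (?c j k) (v $ 2) * v $ 3 ^ j * v $ 4 ^ k) = 0" by simp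
  qed (use N_pos in auto)
  then have z: "c 0 0 + Polynomial.monom ?a d = 0" by simp
  have "Polynomial.coeff (c 0 0) d + ?a = Polynomial.coeff (c 0 0 + Polynomial.monom ?a d) d" by simp
  then have "Polynomial.coeff (c 0 0) d + ?a = 0" by (simp only: z Polynomial.coeff_0)
  moreover have "Polynomial.coeff (c 0 0) d = 0"
    using c(1)[of 0 0] by (cases "c 0 0 = 0") (auto simp: adm1_def coeff_eq_0)
  ultimately show ?thesis by simp
qed

subsection \<open>Coordinates over the z-line\<close>

text \<open>The pole order at infinity of \<open>x\<^sup>i y\<^sup>j z\<^sup>a\<close> is at most \<open>w\<close>; note that \<open>q N = q\<^sup>3 - q\<^sup>2 + q\<close>.\<close>

definition adm2 :: "nat \<Rightarrow> nat \<Rightarrow> nat \<Rightarrow> nat \<Rightarrow> bool" where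
  "adm2 w a i j \<longleftrightarrow> q ^ 3 * a + (q ^ 3 + 1) * i + q * N * j \<le> w"

lemma deg_closed_adm2 [simp]: "deg_closed (adm2 w)"
  unfolding deg_closed_def adm2_def
  by (meson add_le_mono le_trans mult_le_mono2 order_refl)

text \<open>Functions represented by the monomials \<open>x\<^sup>i y\<^sup>j z\<^sup>k\<close> with \<open>i < q\<close> and \<open>j < q\<^sup>2\<close> whose pole order
  \<open>(q\<^sup>3 + 1) i + (q\<^sup>3 - q\<^sup>2 + q) j + q\<^sup>3 k\<close> at infinity is at most \<open>w\<close>.\<close>

abbreviation rep2 :: "nat \<Rightarrow> ('a ^ 4 \<Rightarrow> 'a) set" where
  "rep2 w \<equiv> rep 4 2 q 3 (q\<^sup>2) (adm2 w)"

lemma rep2_mono: "\<phi> \<in> rep2 w \<Longrightarrow> w \<le> w' \<Longrightarrow> \<phi> \<in> rep2 w'"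
  by (erule rep_mono) (auto simp: adm2_def)

lemma weight_xy: "(q + 1) * (q * N) = q * (q ^ 3 + 1)"
  using N_mult by (metis mult.assoc mult.commute)

lemma rep2_z:
  assumes "\<phi> \<in> rep2 w"
  shows "(\<lambda>v. v $ 4 * \<phi> v) \<in> rep2 (w + q ^ 3)"
proof (rule rep_mult[OF deg_closed_adm2 assms(1)])
  fix a :: "'a poly" and i j assume a: "a \<noteq> 0" "adm2 w (Polynomial.degree a) i j" and ij: "i < q" "j < q\<^sup>2"
  then have "adm2 (w + q ^ 3) (Polynomial.degree (pCons 0 a)) i j"
    by (auto simp: adm2_def)
  then have "(\<lambda>v. poly (pCons 0 a) (v $ 4) * v $ 2 ^ i * v $ 3 ^ j) \<in> rep2 (w + q ^ 3)"
    using ij by (intro rep_term)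
  then show "(\<lambda>v. v $ 4 * (poly a (v $ 4) * v $ 2 ^ i * v $ 3 ^ j)) \<in> rep2 (w + q ^ 3)"
    by (simp add: mult_ac)
qed

lemma rep2_y:
  assumes "\<phi> \<in> rep2 w"
  shows "(\<lambda>v. v $ 3 * \<phi> v) \<in> rep2 (w + q * N)"
proof (rule rep_mult[OF deg_closed_adm2 assms(1)])
  fix a :: "'a poly" and i j assume a: "a \<noteq> 0" "adm2 w (Polynomial.degree a) i j" and ij: "i < q" "j < q\<^sup>2"
  show "(\<lambda>v. v $ 3 * (poly a (v $ 4) * v $ 2 ^ i * v $ 3 ^ j)) \<in> rep2 (w + q * N)"
  proof (cases "Suc j < q\<^sup>2")
    case True
    have "adm2 (w + q * N) (Polynomial.degree a) i (Suc j)"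
      using a(2) by (auto simp: adm2_def)
    then have "(\<lambda>v. poly a (v $ 4) * v $ 2 ^ i * v $ 3 ^ Suc j) \<in> rep2 (w + q * N)"
      using True ij by (intro rep_term) auto
    then show ?thesis by (simp add: mult_ac)
  next
    case False
    then have j: "q\<^sup>2 = Suc j" using ij by simp
    have j1: "1 \<le> j" using j q_ge_2 power_mono[of 2 q 2] by simp
    have w: "q ^ 3 * Polynomial.degree a + (q ^ 3 + 1) * i + q * N * q\<^sup>2 \<le> w + q * N"
      using a(2) by (simp add: adm2_def j)
    have "Polynomial.degree (Polynomial.monom 1 N * a) \<le> N + Polynomial.degree a"
      using degree_mult_le[of "Polynomial.monom 1 N" a] degree_monom_le[of "1::'a" N] by linarith
    then have "q ^ 3 * Polynomial.degree (Polynomial.monom 1 N * a) \<le> q ^ 3 * (N + Polynomial.degree a)"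
      by (rule mult_le_mono2)
    also have "\<dots> = q ^ 3 * Polynomial.degree a + q * N * q\<^sup>2"
      by (simp add: distrib_left power3_eq_cube power2_eq_square mult_ac)
    finally have "adm2 (w + q * N) (Polynomial.degree (Polynomial.monom 1 N * a)) i 0"
      using w by (simp add: adm2_def)
    then have 1: "(\<lambda>v. poly (Polynomial.monom 1 N * a) (v $ 4) * v $ 2 ^ i * v $ 3 ^ 0) \<in> rep2 (w + q * N)"
      using ij by (intro rep_term) auto
    have "q * N * 1 \<le> q * N * j" using j1 by (rule mult_le_mono2)
    then have "adm2 (w + q * N) (Polynomial.degree a) i 1"
      using a(2) by (simp add: adm2_def)
    then have 2: "(\<lambda>v. poly a (v $ 4) * v $ 2 ^ i * v $ 3 ^ 1) \<in> rep2 (w + q * N)"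
      using ij j1 j by (intro rep_term) auto
    from rep_add[OF deg_closed_adm2 1 2] show ?thesis
    proof (rule rep_cong)
      fix v assume "v \<in> C"
      have "v $ 3 * (poly a (v $ 4) * v $ 2 ^ i * v $ 3 ^ j) = poly a (v $ 4) * v $ 2 ^ i * v $ 3 ^ q\<^sup>2"
        by (simp add: j)
      also have "v $ 3 ^ q\<^sup>2 = v $ 4 ^ N + v $ 3" using C_D(3)[OF \<open>v \<in> C\<close>] by simp
      finally show "v $ 3 * (poly a (v $ 4) * v $ 2 ^ i * v $ 3 ^ j) =
          poly (Polynomial.monom 1 N * a) (v $ 4) * v $ 2 ^ i * v $ 3 ^ 0
            + poly a (v $ 4) * v $ 2 ^ i * v $ 3 ^ 1"
        by (simp add: poly_monom algebra_simps)
    qed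
  qed
qed

lemma rep2_y_power: "\<phi> \<in> rep2 w \<Longrightarrow> (\<lambda>v. v $ 3 ^ n * \<phi> v) \<in> rep2 (w + n * (q * N))"
proof (induction n)
  case (Suc n)
  have "(\<lambda>v. v $ 3 * (v $ 3 ^ n * \<phi> v)) \<in> rep2 (w + n * (q * N) + q * N)"
    by (rule rep2_y[OF Suc.IH[OF Suc.prems]])
  then show ?case by (simp add: mult.assoc add_ac)
qed simp

lemma rep2_x:
  assumes "\<phi> \<in> rep2 w"
  shows "(\<lambda>v. v $ 2 * \<phi> v) \<in> rep2 (w + (q ^ 3 + 1))"
proof (rule rep_mult[OF deg_closed_adm2 assms(1)])
  fix a :: "'a poly" and i j assume a: "a \<noteq> 0" "adm2 w (Polynomial.degree a) i j" and ij: "i < q" "j < q\<^sup>2"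
  show "(\<lambda>v. v $ 2 * (poly a (v $ 4) * v $ 2 ^ i * v $ 3 ^ j)) \<in> rep2 (w + (q ^ 3 + 1))"
  proof (cases "Suc i < q")
    case True
    have "adm2 (w + (q ^ 3 + 1)) (Polynomial.degree a) (Suc i) j"
      using a(2) by (auto simp: adm2_def)
    then have "(\<lambda>v. poly a (v $ 4) * v $ 2 ^ Suc i * v $ 3 ^ j) \<in> rep2 (w + (q ^ 3 + 1))"
      using True ij by (intro rep_term) auto
    then show ?thesis by (simp add: mult_ac)
  next
    case False
    then have i: "q = Suc i" using ij by simp
    have i1: "1 \<le> i" using i q_ge_2 by simp
    have "adm2 (q ^ 3 * Polynomial.degree a + q * N * j) (Polynomial.degree a) 0 j"
      by (simp add: adm2_def)
    then have "(\<lambda>v. poly a (v $ 4) * v $ 2 ^ 0 * v $ 3 ^ j) \<in> rep2 (q ^ 3 * Polynomial.degree a + q * N * j)"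
      using ij by (intro rep_term) auto
    from rep2_y_power[OF this, of "q + 1"]
    have "(\<lambda>v. v $ 3 ^ (q + 1) * (poly a (v $ 4) * v $ 2 ^ 0 * v $ 3 ^ j))
       \<in> rep2 (q ^ 3 * Polynomial.degree a + q * N * j + (q + 1) * (q * N))" .
    moreover have "q ^ 3 * Polynomial.degree a + q * N * j + (q + 1) * (q * N) \<le> w + (q ^ 3 + 1)"
    proof -
      have "q * (q ^ 3 + 1) = (q ^ 3 + 1) * i + (q ^ 3 + 1)" using i by (metis mult.commute mult_Suc_right add.commute)
      then show ?thesis using a(2) unfolding adm2_def weight_xy by linarith
    qed
    ultimately have 1: "(\<lambda>v. v $ 3 ^ (q + 1) * (poly a (v $ 4) * v $ 2 ^ 0 * v $ 3 ^ j)) \<in> rep2 (w + (q ^ 3 + 1))"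
      by (rule rep2_mono)
    have "(q ^ 3 + 1) * 1 \<le> (q ^ 3 + 1) * i" using i1 by (rule mult_le_mono2)
    then have "adm2 (w + (q ^ 3 + 1)) (Polynomial.degree (- a)) 1 j"
      using a(2) by (simp add: adm2_def)
    then have 2: "(\<lambda>v. poly (- a) (v $ 4) * v $ 2 ^ 1 * v $ 3 ^ j) \<in> rep2 (w + (q ^ 3 + 1))"
      using ij i1 i by (intro rep_term) auto
    from rep_add[OF deg_closed_adm2 1 2] show ?thesis
    proof (rule rep_cong)
      fix v assume "v \<in> C"
      have "v $ 2 * (poly a (v $ 4) * v $ 2 ^ i * v $ 3 ^ j) = poly a (v $ 4) * v $ 2 ^ Suc i * v $ 3 ^ j"
        by simp
      also have "v $ 2 ^ Suc i = v $ 3 ^ (q + 1) - v $ 2"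
        unfolding i[symmetric] using C_D(2)[OF \<open>v \<in> C\<close>] by simp
      finally show "v $ 2 * (poly a (v $ 4) * v $ 2 ^ i * v $ 3 ^ j) =
          v $ 3 ^ (q + 1) * (poly a (v $ 4) * v $ 2 ^ 0 * v $ 3 ^ j) + poly (- a) (v $ 4) * v $ 2 ^ 1 * v $ 3 ^ j"
        by (simp add: algebra_simps)
    qed
  qed
qed

lemma forms_rep2:
  assumes "\<phi> \<in> forms UNIV d"
  shows "\<phi> \<in> rep2 ((q ^ 3 + 1) * d)"
  using assms
proof (induction rule: forms_induct)
  case (zero d)
  then show ?case by (rule rep_zero)
next
  case (const c)
  have "(\<lambda>v. poly [:c:] (v $ 4) * v $ 2 ^ 0 * v $ 3 ^ 0) \<in> rep2 ((q ^ 3 + 1) * 0)"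
    using q_ge_2 by (intro rep_term) (auto simp: adm2_def)
  then show ?case by simp
next
  case (add d g h)
  then show ?case by (intro rep_add) auto
next
  case (coord d i g)
  have w: "(q ^ 3 + 1) * Suc d = (q ^ 3 + 1) * d + (q ^ 3 + 1)" by simp
  have yw: "q * N \<le> q ^ 3 + 1"
    using N_mult by (metis le_add1 mult.commute mult_le_mono2)
  consider "i = 1" | "i = 2" | "i = 3" | "i = 4" using exhaust_4 by metis
  then show ?case unfolding w
  proof cases
    case 1
    have "(\<lambda>v. v $ i * g v) \<in> rep2 ((q ^ 3 + 1) * d)"
      by (rule rep_cong[OF coord]) (simp add: 1 C_D)
    then show "(\<lambda>v. v $ i * g v) \<in> rep2 ((q ^ 3 + 1) * d + (q ^ 3 + 1))"
      by (rule rep2_mono) simp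
  next
    case 2
    then show "(\<lambda>v. v $ i * g v) \<in> rep2 ((q ^ 3 + 1) * d + (q ^ 3 + 1))" using rep2_x[OF coord] by simp
  next
    case 3
    have "(\<lambda>v. v $ 3 * g v) \<in> rep2 ((q ^ 3 + 1) * d + (q ^ 3 + 1))"
      by (rule rep2_mono[OF rep2_y[OF coord]]) (use yw in linarith)
    then show "(\<lambda>v. v $ i * g v) \<in> rep2 ((q ^ 3 + 1) * d + (q ^ 3 + 1))" by (simp add: 3)
  next
    case 4
    have "(\<lambda>v. v $ 4 * g v) \<in> rep2 ((q ^ 3 + 1) * d + (q ^ 3 + 1))"
      by (rule rep2_mono[OF rep2_z[OF coord]]) simp
    then show "(\<lambda>v. v $ i * g v) \<in> rep2 ((q ^ 3 + 1) * d + (q ^ 3 + 1))" by (simp add: 4)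
  qed
qed

text \<open>Every fibre over the \<open>z\<close>-line consists of \<open>q\<^sup>3\<close> points, so a function that vanishes on the
  fibre over \<open>z\<close> has all its coefficients vanishing at \<open>z\<close>.\<close>

lemma fibre_coeffs_zero:
  assumes "\<And>x y. vec4 1 x y z \<in> C \<Longrightarrow> (\<Sum>i<q. \<Sum>j<q\<^sup>2. c i j * x ^ i * y ^ j) = 0"
    and "i < q" "j < q\<^sup>2"
  shows "c i j = 0"
proof (rule bivariate_coeffs_zero[of "{y::'a. y ^ q\<^sup>2 - y = z ^ N}" "q\<^sup>2"
      "\<lambda>y::'a. {x::'a. x ^ q + x = y ^ (q + 1)}" q c])
  have "{y::'a. y ^ q\<^sup>2 - y = z ^ N} = {y::'a. y ^ q\<^sup>2 + (- 1) * y = z ^ N}" by simp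
  then show "finite {y::'a. y ^ q\<^sup>2 - y = z ^ N}" "q\<^sup>2 \<le> card {y::'a. y ^ q\<^sup>2 - y = z ^ N}"
    using card_additive_fibre[of "-1" 2 "z ^ N"] by simp_all
  show "finite {x::'a. x ^ q + x = y ^ (q + 1)} \<and> q \<le> card {x::'a. x ^ q + x = y ^ (q + 1)}" for y
    using card_additive_fibre[of 1 1 "y ^ (q + 1)"] by simp
  show "(\<Sum>i<q. \<Sum>j<q\<^sup>2. c i j * x ^ i * y ^ j) = 0"
    if "y \<in> {y::'a. y ^ q\<^sup>2 - y = z ^ N}" "x \<in> {x::'a. x ^ q + x = y ^ (q + 1)}" for x y
    using that assms(1)[of x y] by (simp add: vec4_in_C)
qed (use assms in auto)


section \<open>The point at infinity\<close>

text \<open>The coordinate vector of the point at infinity.\<close>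

definition einf :: "'a ^ 4" where "einf = vec4 0 1 0 0"

lemma einf_nth [simp]: "einf $ 1 = 0" "einf $ 2 = 1" "einf $ 3 = 0" "einf $ 4 = 0"
  by (simp_all add: einf_def)

text \<open>The closure properties of forms, for arbitrary coefficients.\<close>

lemmas F_add = forms_add[OF coeff_ring_UNIV]
lemmas F_mult = forms_mult[OF coeff_ring_UNIV]
lemmas F_scale = forms_scale[OF coeff_ring_UNIV UNIV_I]
lemmas F_zero = forms_zero[OF coeff_ring_UNIV]
lemmas F_const = forms_const[OF coeff_ring_UNIV UNIV_I]
lemmas F_sum = forms_sum[OF coeff_ring_UNIV]
lemmas F_prod = forms_prod[OF coeff_ring_UNIV]
lemmas F_power = forms_power[OF coeff_ring_UNIV]
lemmas F_coord = forms_UNIV_coord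

lemma F_multI:
  "g \<in> forms UNIV a \<Longrightarrow> h \<in> forms UNIV b \<Longrightarrow> a + b = d \<Longrightarrow> (\<lambda>v. g v * h v :: 'a) \<in> forms UNIV d"
  using F_mult by blast

lemma F_powerI:
  "g \<in> forms UNIV a \<Longrightarrow> n * a = d \<Longrightarrow> (\<lambda>v. g v ^ n :: 'a) \<in> forms UNIV d"
  using F_power by blast

lemma F_coord_power: "(\<lambda>v. v $ i ^ n :: 'a) \<in> forms UNIV n"
  by (rule F_powerI[OF F_coord]) simp

text \<open>The points of the projective curve are represented by the vectors in \<open>C\<close> and by \<open>einf\<close>.\<close>

lemma form_eq_at:
  assumes "\<phi> \<in> forms UNIV d" "\<psi> \<in> forms UNIV d" "\<And>v. v \<in> C \<Longrightarrow> \<phi> v = \<psi> v" "e \<in> insert einf C"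
  shows "\<phi> e = \<psi> e"
proof (cases "e \<in> C")
  case False
  then have e: "e = einf" using assms(4) by simp
  have "(\<lambda>v. \<phi> v - \<psi> v) (vec4 0 1 0 0) = 0"
    by (rule form_zero_infinity[OF forms_diff[OF assms(1,2)]]) (simp add: assms(3))
  then show ?thesis by (simp add: e einf_def)
qed (use assms in blast)

lemma form_eq_generic:
  assumes "\<phi> \<in> forms UNIV d" "\<psi> \<in> forms UNIV d"
    and "\<And>v. v \<in> C \<Longrightarrow> v $ 4 \<noteq> 0 \<Longrightarrow> \<phi> v = \<psi> v" "v \<in> C"
  shows "\<phi> v = \<psi> v"
proof -
  have "(\<lambda>v. \<phi> v - \<psi> v) v = 0"
    by (rule form_zero_generic[of _ d])
       (use forms_rep1[OF forms_diff[OF assms(1,2)]] assms(3,4) in auto)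
  then show ?thesis by simp
qed

text \<open>In homogeneous coordinates \<open>Z\<^sup>N = Y E1\<close> and \<open>Y\<^sup>q\<^sup>+\<^sup>1 = W E2\<close> hold on the curve, with forms \<open>E1\<close> and \<open>E2\<close>
  that take the value \<open>1\<close> at infinity. So \<open>Y / X\<close> and \<open>W / X\<close> are, up to units, the powers of \<open>Z / X\<close> with
  exponents \<open>N\<close> and \<open>q\<^sup>3 + 1\<close>.\<close>

definition E1 :: "'a ^ 4 \<Rightarrow> 'a" where
  "E1 v = (v $ 2 ^ q + v $ 2 * v $ 1 ^ (q - 1)) ^ (q - 1) - v $ 1 ^ (q * (q - 1))"

definition E2 :: "'a ^ 4 \<Rightarrow> 'a" where
  "E2 v = v $ 2 ^ q + v $ 2 * v $ 1 ^ (q - 1)"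

text \<open>The common unit in \<open>W EE = Z\<close> to the power \<open>q\<^sup>3 + 1\<close>.\<close>

definition EE :: "'a ^ 4 \<Rightarrow> 'a" where
  "EE v = E1 v ^ (q + 1) * E2 v"

lemma E2_form: "E2 \<in> forms UNIV q"
proof -
  have "(\<lambda>v. v $ 2 ^ q + v $ 2 * v $ 1 ^ (q - 1) :: 'a) \<in> forms UNIV q"
    using q_ge_2 by (intro F_add F_coord_power F_multI[OF F_coord F_coord_power]) auto
  then show ?thesis by (simp add: E2_def[abs_def])
qed

lemma E1_form: "E1 \<in> forms UNIV (q * (q - 1))"
proof -
  have "(\<lambda>v. E2 v ^ (q - 1) - v $ 1 ^ (q * (q - 1)) :: 'a) \<in> forms UNIV (q * (q - 1))"
    by (intro forms_diff F_coord_power F_powerI[OF E2_form]) (simp add: mult.commute)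
  then show ?thesis by (simp add: E1_def[abs_def] E2_def)
qed

lemma EE_form: "EE \<in> forms UNIV (q ^ 3)"
proof -
  obtain r where r: "q = Suc r" using q_ge_2 by (cases q) auto
  have "(q + 1) * (q * (q - 1)) + q = q ^ 3"
    unfolding r by (simp add: power3_eq_cube algebra_simps)
  then show ?thesis unfolding EE_def[abs_def]
    by (intro F_multI[OF F_powerI[OF E1_form refl] E2_form])
qed

lemma E_einf: "E1 einf = 1" "E2 einf = 1" "EE einf = 1"
  using q_ge_2 by (simp_all add: E1_def E2_def EE_def power_0_left)

lemma yE1: "v \<in> C \<Longrightarrow> v $ 3 * E1 v = v $ 4 ^ N"
  by (simp add: zN_eq E1_def C_D(1))

lemma wE2: "v \<in> C \<Longrightarrow> v $ 1 * E2 v = v $ 3 ^ (q + 1)"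
  by (simp only: C_D E2_def power_one mult_1_left mult_1_right)

lemma wEE: "v \<in> C \<Longrightarrow> v $ 1 * EE v = v $ 4 ^ (q ^ 3 + 1)"
proof -
  assume v: "v \<in> C"
  have "v $ 1 * EE v = (v $ 1 * E2 v) * E1 v ^ (q + 1)" by (simp only: EE_def mult_ac)
  also have "\<dots> = (v $ 3 * E1 v) ^ (q + 1)" by (simp only: wE2[OF v] power_mult_distrib)
  also have "\<dots> = v $ 4 ^ (q ^ 3 + 1)" by (simp only: yE1[OF v] power_mult[symmetric] N_mult)
  finally show ?thesis .
qed

text \<open>As \<open>W = 1\<close> on \<open>C\<close>, the lower terms of a polynomial of degree \<open>n\<close> form \<open>W\<close> times a form of degree
  \<open>n - 1\<close>.\<close>

lemma poly_top_term:
  assumes "Polynomial.degree p \<le> n"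
  obtains l where "l \<in> forms UNIV (n - 1)" "n = 0 \<longrightarrow> l = (\<lambda>_. 0)"
    "\<And>v. v \<in> C \<Longrightarrow> poly p (v $ 2) = Polynomial.coeff p n * v $ 2 ^ n + l v"
proof
  let ?l = "\<lambda>v :: 'a ^ 4. \<Sum>i<n. Polynomial.coeff p i * (v $ 2 ^ i * v $ 1 ^ (n - 1 - i))"
  show "?l \<in> forms UNIV (n - 1)"
    by (intro F_sum F_scale F_multI[OF F_coord_power F_coord_power]) auto
  show "n = 0 \<longrightarrow> ?l = (\<lambda>_. 0)" by auto
  fix v assume v: "v \<in> C"
  have "poly p (v $ 2) = (\<Sum>i\<le>n. Polynomial.coeff p i * v $ 2 ^ i)"
    unfolding poly_altdef using assms
    by (intro sum.mono_neutral_left) (auto intro: coeff_eq_0)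
  also have "{..n} = insert n {..<n}" by auto
  finally show "poly p (v $ 2) = Polynomial.coeff p n * v $ 2 ^ n + ?l v"
    by (simp add: C_D(1)[OF v])
qed

text \<open>A polynomial of exact degree \<open>D\<close> in reduced form has order at most \<open>q\<^sup>3\<close> at infinity after
  division by \<open>x\<^sup>D\<close>: its top monomials \<open>x\<^sup>i y\<^sup>j z\<^sup>k\<close> have the distinct orders \<open>N j + k\<close>, all
  others have order greater than \<open>q\<^sup>3\<close>.\<close>

lemma rep1_order:
  assumes c: "\<And>v. v \<in> C \<Longrightarrow> r v = (\<Sum>j<q + 1. \<Sum>k<N. poly (c j k) (v $ 2) * v $ 3 ^ j * v $ 4 ^ k)"
    and D: "\<And>j k. j < q + 1 \<Longrightarrow> k < N \<Longrightarrow> c j k \<noteq> 0 \<Longrightarrow> Polynomial.degree (c j k) + j + k \<le> D"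
    and top: "j1 < q + 1" "k1 < N" "c j1 k1 \<noteq> 0" "Polynomial.degree (c j1 k1) + j1 + k1 = D"
  obtains e0 g where "e0 \<le> q ^ 3" "g \<in> forms UNIV (D + q ^ 3 - e0)" "g einf \<noteq> 0"
    "\<And>v. v \<in> C \<Longrightarrow> r v * EE v = v $ 4 ^ e0 * g v"
proof -
  define I where "I = {..<q + 1} \<times> {..<N}"
  define a where "a = (\<lambda>(j, k). if j + k \<le> D then Polynomial.coeff (c j k) (D - j - k) else 0)"
  define S where "S = {p \<in> I. a p \<noteq> 0}"
  have finI: "finite I" by (simp add: I_def)
  have finS: "finite S" by (simp add: S_def finI)
  have "a (j1, k1) = Polynomial.lead_coeff (c j1 k1)"
    using top(4) by (auto simp: a_def)
  then have "(j1, k1) \<in> S" using top by (auto simp: S_def I_def)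
  then have S0: "S \<noteq> {}" by auto
  \<comment> \<open>the order at infinity of the top monomial with exponents \<open>(j, k)\<close>\<close>
  define ht where "ht = (\<lambda>(j, k). N * j + k)"
  have ht_inj: "p = p'" if pI: "p \<in> I" "p' \<in> I" and h: "ht p = ht p'" for p p'
  proof -
    obtain j k where 1: "p = (j, k)" "j < q + 1" "k < N" using pI(1) by (auto simp: I_def)
    obtain j' k' where 2: "p' = (j', k')" "j' < q + 1" "k' < N" using pI(2) by (auto simp: I_def)
    note p = 1(1,3) 2(1,3)
    have eq: "N * j + k = N * j' + k'" using h by (simp add: ht_def 1(1) 2(1))
    have "(N * j + k) div N = j" "(N * j' + k') div N = j'" "(N * j + k) mod N = k" "(N * j' + k') mod N = k'"
      using p(2,4) by simp_all
    then have "j = j'" "k = k'" unfolding eq by simp_all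
    then show ?thesis using 1(1) 2(1) by simp
  qed
  define e0 where "e0 = Min (ht ` S)"
  have e0_le: "e0 \<le> ht p" if "p \<in> S" for p using that finS by (simp add: e0_def)
  have "e0 \<in> ht ` S" unfolding e0_def using finS S0 by (intro Min_in) auto
  then obtain p0 where p0: "p0 \<in> S" "ht p0 = e0" by auto
  have ht_le: "ht p \<le> q ^ 3" if pI: "p \<in> I" for p
  proof -
    obtain j k where p: "p = (j, k)" "j \<le> q" "k < N" using pI by (auto simp: I_def)
    have "N * j \<le> N * q" using p(2) by (rule mult_le_mono2)
    moreover have "N * q + N = q ^ 3 + 1" using N_mult by (simp add: distrib_left)
    moreover have "ht p = N * j + k" by (simp add: ht_def p(1))
    ultimately show ?thesis using p(3) by linarith
  qed
  have e0: "e0 \<le> q ^ 3" using ht_le[of p0] p0 by (auto simp: S_def)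
  define Q where "Q = (\<lambda>p l. l \<in> forms UNIV (D - 1) \<and> (D = 0 \<longrightarrow> l = (\<lambda>_. 0)) \<and>
     (\<forall>v\<in>C. poly (c (fst p) (snd p)) (v $ 2) * v $ 3 ^ fst p * v $ 4 ^ snd p
       = a p * (v $ 2 ^ (D - fst p - snd p) * v $ 3 ^ fst p * v $ 4 ^ snd p) + l v))"
  have ex: "\<exists>l. Q p l" if pI: "p \<in> I" for p
  proof -
    obtain j k where p: "p = (j, k)" "j < q + 1" "k < N" using pI by (auto simp: I_def)
    show ?thesis
    proof (cases "c j k = 0")
      case True
      then show ?thesis
        by (intro exI[of _ "\<lambda>_. 0"]) (simp add: Q_def p a_def F_zero)
    next
      case False
      from D[OF p(2,3) False] have jk: "Polynomial.degree (c j k) \<le> D - j - k" "j + k \<le> D" by auto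
      obtain l where l: "l \<in> forms UNIV (D - j - k - 1)" "D - j - k = 0 \<longrightarrow> l = (\<lambda>_. 0)"
        "\<And>v. v \<in> C \<Longrightarrow> poly (c j k) (v $ 2) = Polynomial.coeff (c j k) (D - j - k) * v $ 2 ^ (D - j - k) + l v"
        using poly_top_term[OF jk(1)] by blast
      have "(\<lambda>v. l v * (v $ 3 ^ j * v $ 4 ^ k)) \<in> forms UNIV (D - 1)"
      proof (cases "D - j - k = 0")
        case True
        with l(2) show ?thesis by (simp add: F_zero)
      next
        case False
        then show ?thesis using jk(2)
          by (intro F_multI[OF l(1) F_mult[OF F_coord_power F_coord_power]]) auto
      qed
      moreover have l0: "D = 0 \<Longrightarrow> l = (\<lambda>_. 0)" using l(2) by simp
      ultimately show ?thesis
        by (intro exI[of _ "\<lambda>v. l v * (v $ 3 ^ j * v $ 4 ^ k)"])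
           (simp add: Q_def l(3) jk(2) p a_def l0 distrib_right mult.assoc)
    qed
  qed
  have "\<forall>p\<in>I. \<exists>l. Q p l" using ex by (rule ballI)
  from bchoice[OF this] obtain l where lQ: "\<forall>p\<in>I. Q p (l p)" by (rule exE)
  have l1: "l p \<in> forms UNIV (D - 1)" if pI: "p \<in> I" for p
    using bspec[OF lQ pI] unfolding Q_def by (rule conjunct1)
  have l2: "l p = (\<lambda>_. 0)" if pI: "p \<in> I" and "D = 0" for p
    using bspec[OF lQ pI] that(2) unfolding Q_def by blast
  have l3: "poly (c (fst p) (snd p)) (v $ 2) * v $ 3 ^ fst p * v $ 4 ^ snd p
       = a p * (v $ 2 ^ (D - fst p - snd p) * v $ 3 ^ fst p * v $ 4 ^ snd p) + l p v"
    if pI: "p \<in> I" and vC: "v \<in> C" for p v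
    using bspec[OF lQ pI] vC unfolding Q_def by blast
  note l = l1 l2 l3
  define g1 where "g1 = (\<lambda>v. v $ 4 ^ (q ^ 3 + 1 - e0) * (\<Sum>p\<in>I. l p v))"
  define g2 where "g2 = (\<lambda>p v. v $ 2 ^ (D - fst p - snd p) * v $ 4 ^ (ht p - e0) * (E1 v ^ (q + 1 - fst p) * E2 v))"
  define g where "g = (\<lambda>v. g1 v + (\<Sum>p\<in>S. a p * g2 p v))"
  have g1: "g1 \<in> forms UNIV (D + q ^ 3 - e0)"
  proof (cases "D = 0")
    case True
    then have "g1 = (\<lambda>_. 0)" by (simp add: g1_def l(2))
    then show ?thesis by (simp add: F_zero)
  next
    case False
    have "(\<lambda>v. \<Sum>p\<in>I. l p v) \<in> forms UNIV (D - 1)" by (rule F_sum) (rule l(1))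
    from F_multI[OF F_coord_power this, of "q ^ 3 + 1 - e0" "D + q ^ 3 - e0"] show ?thesis
      unfolding g1_def using False e0 by simp
  qed
  have g2: "g2 p \<in> forms UNIV (D + q ^ 3 - e0)" if pS: "p \<in> S" for p
  proof -
    obtain j k where p: "p = (j, k)" "j \<le> q" "k < N" using pS by (auto simp: S_def I_def)
    have jk: "j + k \<le> D" using that by (auto simp: S_def a_def p split: if_splits)
    have "(q + 1 - j) * (q * (q - 1)) + j * (q * (q - 1)) + q = q ^ 3"
    proof -
      obtain r where r: "q = Suc r" using q_ge_2 by (cases q) auto
      have "(q + 1 - j) * (q * (q - 1)) + j * (q * (q - 1)) = (q + 1) * (q * (q - 1))"
        using p(2) by (simp flip: distrib_right)
      then show ?thesis unfolding r by (simp add: power3_eq_cube algebra_simps)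
    qed
    moreover have "N * j = j * (q * (q - 1)) + j" by (simp add: N_def algebra_simps)
    ultimately have deg: "(D - j - k + (ht p - e0)) + ((q + 1 - j) * (q * (q - 1)) + q) = D + q ^ 3 - e0"
    proof -
      assume A: "(q + 1 - j) * (q * (q - 1)) + j * (q * (q - 1)) + q = q ^ 3"
        and B: "N * j = j * (q * (q - 1)) + j"
      have h: "e0 \<le> ht p" "ht p = N * j + k" using e0_le[OF pS] by (simp_all add: ht_def p)
      show ?thesis using A B h jk by linarith
    qed
    have "g2 p \<in> forms UNIV ((D - j - k + (ht p - e0)) + ((q + 1 - j) * (q * (q - 1)) + q))"
      unfolding g2_def p fst_conv snd_conv
      by (intro F_mult[OF F_mult[OF F_coord_power F_coord_power] F_mult[OF F_power[OF E1_form] E2_form]])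
    then show ?thesis by (simp only: deg)
  qed
  have "g einf = (\<Sum>p\<in>S. a p * (if p = p0 then 1 else 0))"
  proof -
    have "g1 einf = 0" using e0 by (simp add: g1_def power_0_left)
    moreover have "g2 p einf = (if p = p0 then 1 else 0)" if "p \<in> S" for p
    proof (cases "p = p0")
      case True
      then show ?thesis by (simp add: g2_def E_einf p0)
    next
      case False
      then have "ht p \<noteq> e0" using ht_inj[of p p0] that p0 by (auto simp: S_def)
      then show ?thesis using False e0_le[OF that] by (simp add: g2_def power_0_left)
    qed
    ultimately show ?thesis by (simp add: g_def)
  qed
  also have "\<dots> = (\<Sum>p\<in>S. if p = p0 then a p else 0)" by (intro sum.cong) auto
  also have "\<dots> = a p0" using p0 finS by simp
  finally have ge: "g einf \<noteq> 0" using p0(1) by (simp add: S_def)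
  have main: "r v * EE v = v $ 4 ^ e0 * g v" if v: "v \<in> C" for v
  proof -
    have t: "poly (c (fst p) (snd p)) (v $ 2) * v $ 3 ^ fst p * v $ 4 ^ snd p * EE v
       = v $ 4 ^ (q ^ 3 + 1) * l p v +
         a p * (v $ 2 ^ (D - fst p - snd p) * v $ 4 ^ ht p * (E1 v ^ (q + 1 - fst p) * E2 v))"
      if p: "p \<in> I" for p
    proof -
      obtain j k where jk: "p = (j, k)" "j \<le> q" "k < N" using p by (auto simp: I_def)
      have EEv: "EE v = v $ 4 ^ (q ^ 3 + 1)" using wEE[OF v] C_D(1)[OF v] by simp
      have "v $ 3 ^ j * v $ 4 ^ k * EE v = v $ 3 ^ j * v $ 4 ^ k * (E1 v ^ (j + (q + 1 - j)) * E2 v)"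
        using jk(2) by (simp add: EE_def)
      also have "\<dots> = (v $ 3 * E1 v) ^ j * v $ 4 ^ k * (E1 v ^ (q + 1 - j) * E2 v)"
        by (simp only: power_add power_mult_distrib mult_ac)
      also have "\<dots> = v $ 4 ^ ht p * (E1 v ^ (q + 1 - j) * E2 v)"
        by (simp only: yE1[OF v] jk(1) ht_def prod.case power_add power_mult)
      finally have y: "v $ 3 ^ j * v $ 4 ^ k * EE v = v $ 4 ^ ht p * (E1 v ^ (q + 1 - j) * E2 v)" .
      have "poly (c (fst p) (snd p)) (v $ 2) * v $ 3 ^ fst p * v $ 4 ^ snd p * EE v =
          a p * v $ 2 ^ (D - fst p - snd p) * (v $ 3 ^ fst p * v $ 4 ^ snd p * EE v) + EE v * l p v"
        by (simp only: l(3)[OF p v]) (simp add: algebra_simps)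
      also have "v $ 3 ^ fst p * v $ 4 ^ snd p * EE v = v $ 4 ^ ht p * (E1 v ^ (q + 1 - fst p) * E2 v)"
        using y by (simp only: jk(1) fst_conv snd_conv)
      finally show ?thesis using EEv by (simp add: mult_ac add_ac)
    qed
    have "r v * EE v = (\<Sum>p\<in>I. poly (c (fst p) (snd p)) (v $ 2) * v $ 3 ^ fst p * v $ 4 ^ snd p * EE v)"
      unfolding c[OF v] I_def by (simp only: sum_distrib_right sum.cartesian_product case_prod_unfold)
    also have "\<dots> = (\<Sum>p\<in>I. v $ 4 ^ (q ^ 3 + 1) * l p v +
         a p * (v $ 2 ^ (D - fst p - snd p) * v $ 4 ^ ht p * (E1 v ^ (q + 1 - fst p) * E2 v)))"
      by (intro sum.cong refl t)
    also have "\<dots> = v $ 4 ^ (q ^ 3 + 1) * (\<Sum>p\<in>I. l p v) +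
       (\<Sum>p\<in>I. a p * (v $ 2 ^ (D - fst p - snd p) * v $ 4 ^ ht p * (E1 v ^ (q + 1 - fst p) * E2 v)))"
      by (simp only: sum.distrib sum_distrib_left)
    also have "(\<Sum>p\<in>I. a p * (v $ 2 ^ (D - fst p - snd p) * v $ 4 ^ ht p * (E1 v ^ (q + 1 - fst p) * E2 v)))
      = (\<Sum>p\<in>S. a p * (v $ 2 ^ (D - fst p - snd p) * v $ 4 ^ ht p * (E1 v ^ (q + 1 - fst p) * E2 v)))"
      by (rule sum.mono_neutral_right[OF finI]) (auto simp: S_def)
    also have "\<dots> = (\<Sum>p\<in>S. v $ 4 ^ e0 * (a p * g2 p v))"
    proof (intro sum.cong refl)
      fix p assume "p \<in> S"
      then have "v $ 4 ^ ht p = v $ 4 ^ e0 * v $ 4 ^ (ht p - e0)"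
        using e0_le by (simp flip: power_add)
      then show "a p * (v $ 2 ^ (D - fst p - snd p) * v $ 4 ^ ht p * (E1 v ^ (q + 1 - fst p) * E2 v))
        = v $ 4 ^ e0 * (a p * g2 p v)"
        unfolding g2_def by (simp only: mult_ac)
    qed
    also have "v $ 4 ^ (q ^ 3 + 1) * (\<Sum>p\<in>I. l p v) = v $ 4 ^ e0 * g1 v"
    proof -
      have "v $ 4 ^ (q ^ 3 + 1) = v $ 4 ^ e0 * v $ 4 ^ (q ^ 3 + 1 - e0)"
        using e0 by (simp flip: power_add)
      then show ?thesis unfolding g1_def by (simp only: mult.assoc)
    qed
    finally show ?thesis unfolding g_def by (simp only: distrib_left sum_distrib_left)
  qed
  have "g \<in> forms UNIV (D + q ^ 3 - e0)"
    unfolding g_def by (intro F_add F_sum F_scale g1 g2)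
  from that[OF e0 this ge main] show thesis .
qed

text \<open>Not identically zero on the affine curve.\<close>

definition nonvanishing :: "('a ^ 4 \<Rightarrow> 'a) \<Rightarrow> bool" where
  "nonvanishing \<phi> \<longleftrightarrow> (\<exists>v\<in>C. \<phi> v \<noteq> 0)"

text \<open>The exact degree \<open>D\<close> of a reduced polynomial, with the order at infinity.\<close>

lemma rep1_reduced:
  assumes "\<phi> \<in> rep1 False d" "nonvanishing \<phi>"
  obtains D e0 g where "D \<le> d" "\<phi> \<in> rep1 False D"
    "e0 \<le> q ^ 3" "g \<in> forms UNIV (D + q ^ 3 - e0)" "g einf \<noteq> 0"
    "\<And>v. v \<in> C \<Longrightarrow> \<phi> v * EE v = v $ 4 ^ e0 * g v"
proof -
  obtain c where c: "\<And>j k. c j k \<noteq> 0 \<Longrightarrow> adm1 False d (Polynomial.degree (c j k)) j k"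
    "\<And>v. v \<in> C \<Longrightarrow> \<phi> v = (\<Sum>j<q + 1. \<Sum>k<N. poly (c j k) (v $ 2) * v $ 3 ^ j * v $ 4 ^ k)"
    using assms(1) by (rule repE) blast
  define S where "S = {(j, k). j < q + 1 \<and> k < N \<and> c j k \<noteq> 0}"
  have "S \<subseteq> {..<q + 1} \<times> {..<N}" by (auto simp: S_def)
  then have finS: "finite S" by (rule finite_subset) simp
  have "S \<noteq> {}"
  proof
    assume "S = {}"
    then have "c j k = 0" if "j < q + 1" "k < N" for j k using that by (auto simp: S_def)
    then have "\<phi> v = 0" if "v \<in> C" for v using c(2)[OF that] by (simp del: sum.lessThan_Suc)
    then show False using assms(2) by (auto simp: nonvanishing_def)
  qed
  define w where "w = (\<lambda>(j, k). Polynomial.degree (c j k) + j + k)"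
  define D where "D = Max (w ` S)"
  have "D \<in> w ` S" unfolding D_def using finS \<open>S \<noteq> {}\<close> by (intro Max_in) auto
  then obtain j1 k1 where 1: "(j1, k1) \<in> S" "D = w (j1, k1)" by auto
  have le: "w p \<le> D" if "p \<in> S" for p unfolding D_def using finS that by simp
  have Dd: "D \<le> d" using 1 c(1)[of j1 k1] by (simp add: S_def w_def adm1_def)
  define c' where "c' = (\<lambda>j k. if j < q + 1 \<and> k < N then c j k else 0)"
  have c': "\<phi> v = (\<Sum>j<q + 1. \<Sum>k<N. poly (c' j k) (v $ 2) * v $ 3 ^ j * v $ 4 ^ k)" if "v \<in> C" for v
    unfolding c(2)[OF that] by (intro sum.cong refl) (simp add: c'_def)
  have Dc: "Polynomial.degree (c' j k) + j + k \<le> D" if "c' j k \<noteq> 0" for j k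
    using that le[of "(j, k)"] by (auto simp: c'_def S_def w_def split: if_splits)
  then have repD: "\<phi> \<in> rep1 False D"
    using c' by (intro repI[of c']) (auto simp: adm1_def)
  have t: "j1 < q + 1" "k1 < N" "c' j1 k1 \<noteq> 0" "Polynomial.degree (c' j1 k1) + j1 + k1 = D"
    using 1 by (auto simp: S_def w_def c'_def)
  obtain e0 g where "e0 \<le> q ^ 3" "g \<in> forms UNIV (D + q ^ 3 - e0)" "g einf \<noteq> 0"
    "\<And>v. v \<in> C \<Longrightarrow> \<phi> v * EE v = v $ 4 ^ e0 * g v"
    by (rule rep1_order[of \<phi> c' D, OF c' Dc t]) auto
  from that[OF Dd repD this] show thesis .
qed

text \<open>\<open>\<phi> = T\<^sup>n \<cdot> g / h\<close> on the curve, with forms \<open>g\<close> and \<open>h\<close> that do not vanish at \<open>e\<close>.\<close>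

definition factors :: "'a ^ 4 \<Rightarrow> ('a ^ 4 \<Rightarrow> 'a) \<Rightarrow> nat \<Rightarrow> ('a ^ 4 \<Rightarrow> 'a) \<Rightarrow> nat \<Rightarrow> bool" where
  "factors e T d \<phi> n \<longleftrightarrow> (\<exists>a b h g. h \<in> forms UNIV a \<and> g \<in> forms UNIV b \<and> d + a = n + b \<and>
     h e \<noteq> 0 \<and> g e \<noteq> 0 \<and> (\<forall>v\<in>C. \<phi> v * h v = T v ^ n * g v))"

lemma factors_infinity:
  assumes "\<phi> \<in> forms UNIV d" "nonvanishing \<phi>"
  shows "\<exists>n. factors einf (\<lambda>v. v $ 4) d \<phi> n"
proof -
  have "\<phi> \<in> rep1 False d" using forms_rep1[OF assms(1)] by blast
  then obtain D e0 g where D: "D \<le> d" "e0 \<le> q ^ 3" "g \<in> forms UNIV (D + q ^ 3 - e0)" "g einf \<noteq> 0"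
    "\<And>v. v \<in> C \<Longrightarrow> \<phi> v * EE v = v $ 4 ^ e0 * g v"
    by (rule rep1_reduced[OF _ assms(2)]) blast
  let ?n = "e0 + (q ^ 3 + 1) * (d - D)"
  have h: "(\<lambda>v. EE v ^ (1 + (d - D))) \<in> forms UNIV ((1 + (d - D)) * q ^ 3)"
    by (rule F_power[OF EE_form])
  have "\<phi> v * EE v ^ (1 + (d - D)) = v $ 4 ^ ?n * g v" if v: "v \<in> C" for v
  proof -
    have "\<phi> v * EE v ^ (1 + (d - D)) = \<phi> v * EE v * (v $ 1 * EE v) ^ (d - D)"
      by (simp add: C_D(1)[OF v])
    also have "\<dots> = v $ 4 ^ e0 * (v $ 4 ^ (q ^ 3 + 1)) ^ (d - D) * g v"
      by (simp only: D(5)[OF v] wEE[OF v] mult_ac)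
    also have "v $ 4 ^ e0 * (v $ 4 ^ (q ^ 3 + 1)) ^ (d - D) = v $ 4 ^ ?n"
      by (subst power_add) (simp only: power_mult)
    finally show ?thesis .
  qed
  moreover have "d + (1 + (d - D)) * q ^ 3 = ?n + (D + q ^ 3 - e0)"
  proof -
    obtain \<delta> where "d = D + \<delta>" using D(1) le_Suc_ex by blast
    then show ?thesis using D(2) by (simp add: algebra_simps)
  qed
  ultimately show ?thesis unfolding factors_def
    by (intro exI[of _ ?n] exI[of _ "(1 + (d - D)) * q ^ 3"] exI[of _ "D + q ^ 3 - e0"]
        exI[of _ "\<lambda>v. EE v ^ (1 + (d - D))"] exI[of _ g]) (use h D(3,4) E_einf in auto)
qed

text \<open>The curve is irreducible: near the point at infinity each form is a power of one local parameter
  up to a unit, and a unit does not vanish identically.\<close>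

lemma forms_domain:
  assumes "\<phi> \<in> forms UNIV d" "\<psi> \<in> forms UNIV d'" "nonvanishing \<phi>" "nonvanishing \<psi>"
  shows "nonvanishing (\<lambda>v. \<phi> v * \<psi> v)"
proof (rule ccontr)
  assume "\<not> nonvanishing (\<lambda>v. \<phi> v * \<psi> v)"
  then have z: "\<phi> v * \<psi> v = 0" if "v \<in> C" for v using that by (auto simp: nonvanishing_def)
  obtain n a b h g where 1: "g \<in> forms UNIV b" "g einf \<noteq> 0"
    "\<And>v. v \<in> C \<Longrightarrow> \<phi> v * h v = v $ 4 ^ n * g v"
    using factors_infinity[OF assms(1,3)] unfolding factors_def by metis
  obtain n' a' b' h' g' where 2: "g' \<in> forms UNIV b'" "g' einf \<noteq> 0"
    "\<And>v. v \<in> C \<Longrightarrow> \<psi> v * h' v = v $ 4 ^ n' * g' v"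
    using factors_infinity[OF assms(2,4)] unfolding factors_def by metis
  have "g v * g' v = 0" if "v \<in> C" "v $ 4 \<noteq> 0" for v
  proof -
    have "(v $ 4 ^ n * g v) * (v $ 4 ^ n' * g' v) = (\<phi> v * \<psi> v) * (h v * h' v)"
      unfolding 1(3)[OF that(1), symmetric] 2(3)[OF that(1), symmetric] by (simp only: mult_ac)
    then show ?thesis using z that by auto
  qed
  then have "g v * g' v = 0" if "v \<in> C" for v
    using form_eq_generic[OF F_mult[OF 1(1) 2(1)] F_zero _ that] by blast
  then have "g einf * g' einf = 0"
    using form_eq_at[OF F_mult[OF 1(1) 2(1)] F_zero] by blast
  then show False using 1(2) 2(2) by simp
qed

lemma forms_cancel:
  assumes "T \<in> forms UNIV t" "nonvanishing T" "A \<in> forms UNIV d" "B \<in> forms UNIV d"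
    and "\<And>v. v \<in> C \<Longrightarrow> T v * A v = T v * B v" "v \<in> C"
  shows "A v = B v"
proof (rule ccontr)
  assume "A v \<noteq> B v"
  then have "nonvanishing (\<lambda>v. A v - B v)" using assms(6) by (auto simp: nonvanishing_def)
  from forms_domain[OF assms(1) forms_diff[OF assms(3,4)] assms(2) this]
  show False using assms(5) by (auto simp: nonvanishing_def)
qed

lemma nonvanishing_prod:
  assumes "finite I" "\<And>i. i \<in> I \<Longrightarrow> \<phi> i \<in> forms UNIV d" "\<And>i. i \<in> I \<Longrightarrow> nonvanishing (\<phi> i)"
    and "C \<noteq> {}"
  shows "nonvanishing (\<lambda>v. \<Prod>i\<in>I. \<phi> i v)"
  using assms(1-3)
proof (induction I rule: finite_induct)
  case empty
  then show ?case using assms(4) by (auto simp: nonvanishing_def)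
next
  case (insert x I)
  have "nonvanishing (\<lambda>v. \<phi> x v * (\<Prod>i\<in>I. \<phi> i v))"
    by (rule forms_domain[of _ d _ "card I * d"]) (use insert in \<open>auto intro: F_prod\<close>)
  then show ?case using insert(1,2) by simp
qed

text \<open>If \<open>r / x\<^sup>m\<close> is regular at the point at infinity, then \<open>r\<close> has degree at most \<open>m\<close>.\<close>

lemma degree_bound_infinity:
  assumes r: "r \<in> rep1 False d"
    and UV: "U \<in> forms UNIV e" "V \<in> forms UNIV e" "V einf \<noteq> 0"
    and eq: "\<And>v. v \<in> C \<Longrightarrow> r v * V v = v $ 2 ^ m * U v"
  shows "r \<in> rep1 False m"
proof (cases "nonvanishing r")
  case False
  then show ?thesis
    by (intro rep_cong[OF rep_zero]) (auto simp: nonvanishing_def)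
next
  case True
  obtain D e0 g where D: "r \<in> rep1 False D" "e0 \<le> q ^ 3" "g \<in> forms UNIV (D + q ^ 3 - e0)" "g einf \<noteq> 0"
    "\<And>v. v \<in> C \<Longrightarrow> r v * EE v = v $ 4 ^ e0 * g v"
    using r by (rule rep1_reduced[OF _ True]) blast
  show ?thesis
  proof (cases "D \<le> m")
    case True
    then show ?thesis using D(1) rep1_mono by blast
  next
    case False
    let ?R = "\<lambda>v. v $ 4 ^ (q ^ 3 + 1 - e0) * (v $ 1 ^ (D - m - 1) * v $ 2 ^ m * U v)"
    have L: "(\<lambda>v. g v * V v) \<in> forms UNIV (D + q ^ 3 - e0 + e)" by (rule F_mult[OF D(3) UV(2)])
    have R: "?R \<in> forms UNIV (D + q ^ 3 - e0 + e)"
      by (rule F_multI[OF F_coord_power F_mult[OF F_mult[OF F_coord_power F_coord_power] UV(1)]])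
         (use D(2) False in simp)
    have eq1: "g v * V v = ?R v" if v: "v \<in> C" "v $ 4 \<noteq> 0" for v
    proof -
      have "v $ 4 ^ e0 * (g v * V v) = (r v * V v) * (v $ 1 * EE v)"
        using D(5)[OF v(1)] C_D(1)[OF v(1)] by (simp add: mult_ac)
      also have "\<dots> = v $ 2 ^ m * U v * v $ 4 ^ (q ^ 3 + 1)" by (simp only: eq[OF v(1)] wEE[OF v(1)])
      also have "v $ 4 ^ (q ^ 3 + 1) = v $ 4 ^ e0 * v $ 4 ^ (q ^ 3 + 1 - e0)"
        using D(2) by (simp flip: power_add)
      finally have "v $ 4 ^ e0 * (g v * V v) = v $ 4 ^ e0 * ?R v"
        by (simp add: C_D(1)[OF v(1)] mult_ac)
      then show ?thesis using v(2) by simp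
    qed
    have eq2: "g v * V v = ?R v" if "v \<in> C" for v
      using form_eq_generic[OF L R eq1 that] .
    have "g einf * V einf = ?R einf"
      using form_eq_at[OF L R eq2] by blast
    also have "?R einf = 0" using D(2) by (simp add: power_0_left)
    finally show ?thesis using D(4) UV(3) by simp
  qed
qed


section \<open>Norms over the z-line\<close>

text \<open>The translations \<open>(x, y, z) \<mapsto> (x + \<beta>\<^sup>q y + \<epsilon>, y + \<beta>, z)\<close> act simply transitively on each
  fibre over the \<open>z\<close>-line.\<close>

definition shifts :: "('a \<times> 'a) set" where
  "shifts = {(\<beta>, \<epsilon>). \<beta> ^ q\<^sup>2 = \<beta> \<and> \<epsilon> ^ q + \<epsilon> = \<beta> ^ (q + 1)}"

definition translate :: "'a \<times> 'a \<Rightarrow> 'a ^ 4 \<Rightarrow> 'a ^ 4" where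
  "translate = (\<lambda>(\<beta>, \<epsilon>) v. vec4 (v $ 1) (v $ 2 + \<beta> ^ q * v $ 3 + \<epsilon> * v $ 1) (v $ 3 + \<beta> * v $ 1) (v $ 4))"

lemma finite_translations: "finite shifts"
proof -
  have "shifts = Sigma {\<beta>. \<beta> ^ q ^ 2 + (- 1) * \<beta> = 0} (\<lambda>\<beta>. {\<epsilon>. \<epsilon> ^ q ^ 1 + 1 * \<epsilon> = \<beta> ^ (q + 1)})"
    by (auto simp: shifts_def)
  also have "finite \<dots>"
    by (intro finite_SigmaI card_additive_fibre(1)) auto
  finally show ?thesis .
qed

lemma zero_translation: "(0, 0) \<in> shifts" "translate (0, 0) v = v"
  using q_ge_2 by (auto simp: shifts_def translate_def power_0_left vec4_eq_iff)

lemma translate_C: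
  assumes "\<gamma> \<in> shifts"
  shows "translate \<gamma> v \<in> C \<longleftrightarrow> v \<in> C"
proof -
  obtain \<beta> \<epsilon> where g: "\<gamma> = (\<beta>, \<epsilon>)" by (cases \<gamma>)
  then have b: "\<beta> ^ q\<^sup>2 = \<beta>" "\<epsilon> ^ q + \<epsilon> = \<beta> ^ (q + 1)" using assms by (auto simp: shifts_def)
  have bq: "(\<beta> ^ q) ^ q = \<beta>" using b(1) by (simp add: power2_eq_square power_mult)
  show ?thesis
  proof (cases "v $ 1 = 1")
    case True
    have 1: "(v $ 3 + \<beta>) ^ q\<^sup>2 - (v $ 3 + \<beta>) = v $ 3 ^ q\<^sup>2 - v $ 3"
      by (simp add: frob_add2 b(1))
    have "(v $ 3 + \<beta>) ^ (q + 1) = (v $ 3 ^ q + \<beta> ^ q) * (v $ 3 + \<beta>)"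
      by (simp add: frob_add1 mult.commute)
    then have 2: "(v $ 3 + \<beta>) ^ (q + 1) = v $ 3 ^ (q + 1) + \<beta> * v $ 3 ^ q + \<beta> ^ q * v $ 3 + \<beta> ^ (q + 1)"
      by (simp add: algebra_simps)
    have 3: "(v $ 2 + \<beta> ^ q * v $ 3 + \<epsilon>) ^ q + (v $ 2 + \<beta> ^ q * v $ 3 + \<epsilon>) =
        (v $ 2 ^ q + v $ 2) + \<beta> * v $ 3 ^ q + \<beta> ^ q * v $ 3 + (\<epsilon> ^ q + \<epsilon>)"
      by (simp add: frob_add1 power_mult_distrib bq)
    show ?thesis
      unfolding g translate_def prod.case True mult_1_right vec4_in_C 1 2 3 b(2)
      by (simp add: C_def True)
  next
    case False
    then show ?thesis by (simp add: g translate_def C_def)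
  qed
qed

lemma translate_fibre:
  assumes v: "v \<in> C"
  shows "bij_betw (\<lambda>\<gamma>. translate \<gamma> v) shifts {u \<in> C. u $ 4 = v $ 4}"
proof (rule bij_betwI')
  fix \<gamma> \<gamma>' assume "\<gamma> \<in> shifts" "\<gamma>' \<in> shifts"
  show "translate \<gamma> v = translate \<gamma>' v \<longleftrightarrow> \<gamma> = \<gamma>'"
    by (cases \<gamma>; cases \<gamma>') (auto simp: translate_def vec4_eq_iff C_D(1)[OF v])
next
  fix \<gamma> assume "\<gamma> \<in> shifts"
  then show "translate \<gamma> v \<in> {u \<in> C. u $ 4 = v $ 4}"
    using v by (cases \<gamma>) (auto simp: translate_C, simp add: translate_def)
next
  fix u assume "u \<in> {u \<in> C. u $ 4 = v $ 4}"
  then have u: "u \<in> C" "u $ 4 = v $ 4" by auto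
  define \<beta> where "\<beta> = u $ 3 - v $ 3"
  define \<epsilon> where "\<epsilon> = u $ 2 - v $ 2 - \<beta> ^ q * v $ 3"
  have y: "u $ 3 = v $ 3 + \<beta>" and x: "u $ 2 = v $ 2 + \<beta> ^ q * v $ 3 + \<epsilon>"
    by (simp_all add: \<beta>_def \<epsilon>_def)
  have "u $ 3 ^ q\<^sup>2 - u $ 3 = v $ 3 ^ q\<^sup>2 - v $ 3" using C_D(3)[OF u(1)] C_D(3)[OF v] u(2) by simp
  then have b: "\<beta> ^ q\<^sup>2 = \<beta>" unfolding y by (simp add: frob_add2)
  have bq: "(\<beta> ^ q) ^ q = \<beta>" using b by (simp add: power2_eq_square power_mult)
  have "(v $ 3 ^ q + \<beta> ^ q) * (v $ 3 + \<beta>) = u $ 3 ^ (q + 1)"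
    unfolding y by (simp add: frob_add1 mult.commute)
  also have "\<dots> = u $ 2 ^ q + u $ 2" by (rule C_D(2)[OF u(1)])
  also have "\<dots> = (v $ 2 ^ q + v $ 2) + \<beta> * v $ 3 ^ q + \<beta> ^ q * v $ 3 + (\<epsilon> ^ q + \<epsilon>)"
    unfolding x by (simp add: frob_add1 power_mult_distrib bq)
  also have "v $ 2 ^ q + v $ 2 = v $ 3 ^ q * v $ 3" using C_D(2)[OF v] by (simp add: mult.commute)
  finally have "\<epsilon> ^ q + \<epsilon> = \<beta> ^ (q + 1)" by (simp add: algebra_simps)
  with b have "(\<beta>, \<epsilon>) \<in> shifts" by (simp add: shifts_def)
  moreover have "u = translate (\<beta>, \<epsilon>) v"
    using u C_D(1)[OF v] C_D(1)[OF u(1)] by (simp add: vec4_eq_iff translate_def x y)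
  ultimately show "\<exists>\<gamma>\<in>shifts. u = translate \<gamma> v" by blast
qed

lemma translate_form:
  assumes "\<phi> \<in> forms UNIV d"
  shows "(\<lambda>v. \<phi> (translate \<gamma> v)) \<in> forms UNIV d"
proof (rule forms_linear_subst[OF assms])
  fix i :: 4
  obtain \<beta> \<epsilon> where g: "\<gamma> = (\<beta>, \<epsilon>)" by (cases \<gamma>)
  have 1: "(\<lambda>v :: 'a ^ 4. v $ 2 + \<beta> ^ q * v $ 3 + \<epsilon> * v $ 1) \<in> forms UNIV 1"
    by (intro F_add F_scale F_coord)
  have 2: "(\<lambda>v :: 'a ^ 4. v $ 3 + \<beta> * v $ 1) \<in> forms UNIV 1"
    by (intro F_add F_scale F_coord)
  consider "i = 1" | "i = 2" | "i = 3" | "i = 4" using exhaust_4 by metis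
  then show "(\<lambda>v. translate \<gamma> v $ i) \<in> forms UNIV 1"
    by cases (use 1 2 F_coord in \<open>simp_all add: g translate_def\<close>)
qed

lemma nonvanishing_translate:
  assumes "nonvanishing \<phi>" "\<gamma> \<in> shifts"
  shows "nonvanishing (\<lambda>v. \<phi> (translate \<gamma> v))"
proof -
  obtain v where v: "v \<in> C" "\<phi> v \<noteq> 0" using assms(1) by (auto simp: nonvanishing_def)
  obtain \<beta> \<epsilon> where g: "\<gamma> = (\<beta>, \<epsilon>)" by (cases \<gamma>)
  define u where "u = vec4 1 (v $ 2 - \<beta> ^ q * (v $ 3 - \<beta>) - \<epsilon>) (v $ 3 - \<beta>) (v $ 4)"
  have "translate \<gamma> u = v"
    using C_D(1)[OF v(1)] by (simp add: g translate_def u_def vec4_eq_iff)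
  then have "u \<in> C" "\<phi> (translate \<gamma> u) \<noteq> 0" using translate_C[OF assms(2), of u] v by auto
  then show ?thesis by (auto simp: nonvanishing_def)
qed

text \<open>Every form that does not vanish identically on the curve divides a polynomial in \<open>z\<close>: its norm,
  the product of its translates, is constant on the fibres over the \<open>z\<close>-line.\<close>

lemma norm_to_z:
  assumes \<phi>: "\<phi> \<in> forms UNIV d" and nz: "nonvanishing \<phi>"
  shows "\<exists>e s p. s \<in> forms UNIV e \<and> p \<noteq> 0 \<and> (\<forall>v\<in>C. \<phi> v * s v = poly p (v $ 4))"
proof -
  define s where "s = (\<lambda>v. \<Prod>\<gamma>\<in>shifts - {(0, 0)}. \<phi> (translate \<gamma> v))"
  define M where "M = (\<lambda>v. \<Prod>\<gamma>\<in>shifts. \<phi> (translate \<gamma> v))"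
  have s: "s \<in> forms UNIV (card (shifts - {(0, 0)}) * d)"
    unfolding s_def by (rule F_prod) (use finite_translations in \<open>auto intro: translate_form[OF \<phi>]\<close>)
  have M: "M \<in> forms UNIV (card shifts * d)"
    unfolding M_def by (rule F_prod) (use finite_translations in \<open>auto intro: translate_form[OF \<phi>]\<close>)
  have split: "M v = \<phi> v * s v" for v
    unfolding M_def s_def
    by (subst prod.remove[OF finite_translations zero_translation(1)]) (simp add: zero_translation(2))
  have Mfib: "M v = (\<Prod>u\<in>{u \<in> C. u $ 4 = v $ 4}. \<phi> u)" if "v \<in> C" for v
    unfolding M_def using prod.reindex_bij_betw[OF translate_fibre[OF that], of \<phi>] by simp
  obtain c where c: "\<And>v. v \<in> C \<Longrightarrow> M v = (\<Sum>i<q. \<Sum>j<q\<^sup>2. poly (c i j) (v $ 4) * v $ 2 ^ i * v $ 3 ^ j)"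
    using forms_rep2[OF M] by (rule repE) blast
  have Mz: "M v = poly (c 0 0) (v $ 4)" if v: "v \<in> C" for v
  proof -
    let ?c = "\<lambda>i j. poly (c i j) (v $ 4) - (if i = 0 \<and> j = 0 then M v else 0)"
    have "?c 0 0 = 0"
    proof (rule fibre_coeffs_zero[of "v $ 4" ?c])
      fix x y assume u: "vec4 1 x y (v $ 4) \<in> C"
      have "M (vec4 1 x y (v $ 4)) = M v" using Mfib[OF u] Mfib[OF v] by simp
      then have eq: "(\<Sum>i<q. \<Sum>j<q\<^sup>2. poly (c i j) (v $ 4) * x ^ i * y ^ j) = M v"
        using c[OF u] by simp
      have "(\<Sum>i<q. \<Sum>j<q\<^sup>2. ?c i j * x ^ i * y ^ j) =
        (\<Sum>i<q. \<Sum>j<q\<^sup>2. poly (c i j) (v $ 4) * x ^ i * y ^ j - (if i = 0 then if j = 0 then M v else 0 else 0))"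
        by (intro sum.cong refl) (auto simp: left_diff_distrib)
      also have "\<dots> = (\<Sum>i<q. \<Sum>j<q\<^sup>2. poly (c i j) (v $ 4) * x ^ i * y ^ j)
         - (\<Sum>i<q. \<Sum>j<q\<^sup>2. if i = 0 then if j = 0 then M v else 0 else 0)"
        by (simp only: sum_subtractf)
      also have "(\<Sum>i<q. \<Sum>j<q\<^sup>2. if i = 0 then if j = 0 then M v else 0 else 0) = (\<Sum>i<q. if i = 0 then M v else 0)"
        using q_ge_2 by (intro sum.cong refl) auto
      also have "\<dots> = M v" using q_ge_2 by simp
      finally show "(\<Sum>i<q. \<Sum>j<q\<^sup>2. ?c i j * x ^ i * y ^ j) = 0" using eq by simp
    qed (use q_ge_2 in auto)
    then show ?thesis by simp
  qed
  have "C \<noteq> {}" using nz by (auto simp: nonvanishing_def)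
  then have "nonvanishing M" unfolding M_def
    using finite_translations translate_form[OF \<phi>] nonvanishing_translate[OF nz]
    by (intro nonvanishing_prod[where d = d]) auto
  then have "c 0 0 \<noteq> 0" using Mz by (auto simp: nonvanishing_def)
  then show ?thesis using s Mz split
    by (intro exI[of _ "card (shifts - {(0, 0)}) * d"] exI[of _ s] exI[of _ "c 0 0"]) simp
qed

section \<open>Local parameters\<close>

text \<open>\<open>T\<close> is a local parameter at the point \<open>e\<close>, normalized by \<open>e $ s = 1\<close>: up to units it divides all
  forms vanishing at \<open>e\<close>, and every form is a power of \<open>T\<close> up to a unit.\<close>

definition local_param :: "'a ^ 4 \<Rightarrow> 4 \<Rightarrow> ('a ^ 4 \<Rightarrow> 'a) \<Rightarrow> bool" where
  "local_param e s T \<longleftrightarrow> e \<in> insert einf C \<and> e $ s = 1 \<and> nonvanishing (\<lambda>v. v $ s) \<and>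
     T \<in> forms UNIV 1 \<and> T e = 0 \<and> nonvanishing T \<and>
     (\<forall>d. \<forall>\<phi>\<in>forms UNIV d. \<phi> e = 0 \<longrightarrow> (\<exists>a b h g. h \<in> forms UNIV a \<and> g \<in> forms UNIV b \<and>
        d + a = Suc b \<and> h e \<noteq> 0 \<and> (\<forall>v\<in>C. \<phi> v * h v = T v * g v))) \<and>
     (\<forall>d. \<forall>\<phi>\<in>forms UNIV d. nonvanishing \<phi> \<longrightarrow> (\<exists>n. factors e T d \<phi> n))"

lemma local_paramI:
  assumes "e \<in> insert einf C" "e $ s = 1" "nonvanishing (\<lambda>v. v $ s)"
    and "T \<in> forms UNIV 1" "T e = 0" "nonvanishing T"
    and "\<And>d \<phi>. \<phi> \<in> forms UNIV d \<Longrightarrow> \<phi> e = 0 \<Longrightarrow> \<exists>a b h g. h \<in> forms UNIV a \<and> g \<in> forms UNIV b \<and>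
        d + a = Suc b \<and> h e \<noteq> 0 \<and> (\<forall>v\<in>C. \<phi> v * h v = T v * g v)"
    and "\<And>d \<phi>. \<phi> \<in> forms UNIV d \<Longrightarrow> nonvanishing \<phi> \<Longrightarrow> \<exists>n. factors e T d \<phi> n"
  shows "local_param e s T"
  unfolding local_param_def
  by (intro conjI allI ballI impI) (rule assms; assumption)+

text \<open>It suffices that \<open>T\<close> divides the linear forms \<open>v $ i - e $ i * v $ s\<close> up to a common unit \<open>H\<close>, because
  these generate the ideal of forms vanishing at \<open>e\<close>.\<close>

lemma divisible_by_parameter:
  assumes s: "e $ s = (1::'a)" and H: "H \<in> forms UNIV a" "0 < a" "H e \<noteq> 0" and T: "T e = 0"
    and L: "\<And>i. \<exists>g\<in>forms UNIV a. \<forall>v\<in>C. (v $ i - e $ i * v $ s) * H v = T v * g v"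
    and \<phi>: "\<phi> \<in> forms UNIV d" "\<phi> e = 0"
  shows "\<exists>a b h g. h \<in> forms UNIV a \<and> g \<in> forms UNIV b \<and>
        d + a = Suc b \<and> h e \<noteq> 0 \<and> (\<forall>v\<in>C. \<phi> v * h v = T v * g v)"
proof -
  have "\<exists>g\<in>forms UNIV (d + a - 1). \<forall>v\<in>C. (\<phi> v - \<phi> e * v $ s ^ d) * H v = T v * g v"
    using \<phi>(1)
  proof (induction rule: forms_induct)
    case (zero d)
    then show ?case by (intro bexI[of _ "\<lambda>_. 0"]) (auto intro: F_zero)
  next
    case (const c)
    then show ?case by (intro bexI[of _ "\<lambda>_. 0"]) (auto intro: F_zero)
  next
    case (add d g h)
    then obtain g1 g2 where g: "g1 \<in> forms UNIV (d + a - 1)" "g2 \<in> forms UNIV (d + a - 1)"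
      "\<And>v. v \<in> C \<Longrightarrow> (g v - g e * v $ s ^ d) * H v = T v * g1 v"
      "\<And>v. v \<in> C \<Longrightarrow> (h v - h e * v $ s ^ d) * H v = T v * g2 v" by blast
    have "(g v + h v - (g e + h e) * v $ s ^ d) * H v = T v * (g1 v + g2 v)" if v: "v \<in> C" for v
    proof -
      have "(g v + h v - (g e + h e) * v $ s ^ d) * H v =
        (g v - g e * v $ s ^ d) * H v + (h v - h e * v $ s ^ d) * H v" by (simp add: algebra_simps)
      then show ?thesis by (simp only: g(3)[OF v] g(4)[OF v] distrib_left)
    qed
    then show ?case using F_add[OF g(1,2)] by (intro bexI[of _ "\<lambda>v. g1 v + g2 v"]) auto
  next
    case (coord d i g)
    then obtain g1 where g1: "g1 \<in> forms UNIV (d + a - 1)"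
      "\<And>v. v \<in> C \<Longrightarrow> (g v - g e * v $ s ^ d) * H v = T v * g1 v" by blast
    obtain gi where gi: "gi \<in> forms UNIV a" "\<And>v. v \<in> C \<Longrightarrow> (v $ i - e $ i * v $ s) * H v = T v * gi v"
      using L[of i] by blast
    let ?g = "\<lambda>v. v $ i * g1 v + g e * (v $ s ^ d * gi v)"
    have "?g \<in> forms UNIV (Suc d + a - 1)"
      using H(2) by (intro F_add F_scale F_multI[OF F_coord g1(1)] F_multI[OF F_coord_power gi(1)]) auto
    moreover have "(v $ i * g v - e $ i * g e * v $ s ^ Suc d) * H v = T v * ?g v" if v: "v \<in> C" for v
    proof -
      have "(v $ i * g v - e $ i * g e * v $ s ^ Suc d) * H v =
         v $ i * ((g v - g e * v $ s ^ d) * H v) + g e * v $ s ^ d * ((v $ i - e $ i * v $ s) * H v)"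
        by (simp add: algebra_simps)
      then show ?thesis by (simp only: g1(2)[OF v] gi(2)[OF v]) (simp add: algebra_simps)
    qed
    ultimately show ?case by (intro bexI[of _ ?g]) auto
  qed
  then obtain g where "g \<in> forms UNIV (d + a - 1)" "\<And>v. v \<in> C \<Longrightarrow> \<phi> v * H v = T v * g v"
    using \<phi>(2) by auto
  then show ?thesis using H by (intro exI[of _ a] exI[of _ "d + a - 1"] exI[of _ H] exI[of _ g]) auto
qed

lemma C_over_z: "\<exists>x y. vec4 1 x y z \<in> C"
proof -
  have "card {y::'a. y ^ q ^ 2 + (- 1) * y = z ^ N} \<noteq> 0"
    using card_additive_fibre(2)[of "-1" 2 "z ^ N"] q_ge_2 by simp
  then obtain y where y: "y ^ q\<^sup>2 - y = z ^ N" by (auto simp: card_eq_0_iff)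
  have "card {x::'a. x ^ q ^ 1 + 1 * x = y ^ (q + 1)} \<noteq> 0"
    using card_additive_fibre(2)[of 1 1 "y ^ (q + 1)"] q_ge_2 by simp
  then obtain x where "x ^ q + x = y ^ (q + 1)" by (auto simp: card_eq_0_iff)
  with y have "vec4 1 x y z \<in> C" by (simp add: vec4_in_C)
  then show ?thesis by blast
qed

lemma C_generic: "\<exists>v\<in>C. v $ 2 \<noteq> 0 \<and> v $ 4 \<noteq> 0"
proof (rule ccontr)
  assume "\<not> (\<exists>v\<in>C. v $ 2 \<noteq> 0 \<and> v $ 4 \<noteq> 0)"
  then have "1 = (0 :: 'a poly)"
    using N_pos by (intro rep1_indep[of "\<lambda>_ _. 1" 0 0]) auto
  then show False by simp
qed

lemma local_param_infinity: "local_param einf 2 (\<lambda>v. v $ 4)"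
proof -
  have a: "(\<lambda>v. E1 v * E2 v) \<in> forms UNIV (q\<^sup>2)"
    using q_ge_2 by (intro F_multI[OF E1_form E2_form]) (cases q; simp add: power2_eq_square)
  have q2: "q\<^sup>2 = (N - 1) + q" using N_q N_pos by linarith
  have zN: "v $ 4 ^ N = v $ 4 * v $ 4 ^ (N - 1)" for v :: "'a ^ 4"
    using N_pos by (simp add: power_eq_if)
  have L: "\<exists>g\<in>forms UNIV (q\<^sup>2). \<forall>v\<in>C. (v $ i - einf $ i * v $ 2) * (E1 v * E2 v) = v $ 4 * g v" for i :: 4
  proof -
    consider "i = 1" | "i = 2" | "i = 3" | "i = 4" using exhaust_4 by metis
    then show ?thesis
    proof cases
      case 1
      have "(\<lambda>v :: 'a ^ 4. v $ 3 ^ q * v $ 4 ^ (N - 1)) \<in> forms UNIV (q\<^sup>2)"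
        by (rule F_multI[OF F_coord_power F_coord_power]) (simp add: q2)
      moreover have "v $ 1 * (E1 v * E2 v) = v $ 4 * (v $ 3 ^ q * v $ 4 ^ (N - 1))" if v: "v \<in> C" for v
      proof -
        have "v $ 1 * (E1 v * E2 v) = (v $ 1 * E2 v) * E1 v" by (simp only: mult_ac)
        also have "\<dots> = v $ 3 ^ (q + 1) * E1 v" by (simp only: wE2[OF v])
        also have "\<dots> = v $ 3 ^ q * (v $ 3 * E1 v)" by (simp only: power_add power_one_right mult_ac)
        also have "\<dots> = v $ 3 ^ q * v $ 4 ^ N" by (simp only: yE1[OF v])
        also have "\<dots> = v $ 4 * (v $ 3 ^ q * v $ 4 ^ (N - 1))"
          by (subst zN) (simp only: mult_ac)
        finally show ?thesis .
      qed
      ultimately show ?thesis by (intro bexI[of _ "\<lambda>v. v $ 3 ^ q * v $ 4 ^ (N - 1)"]) (auto simp: 1)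
    next
      case 2
      then show ?thesis by (intro bexI[of _ "\<lambda>_. 0"]) (auto intro: F_zero)
    next
      case 3
      have "(\<lambda>v. v $ 4 ^ (N - 1) * E2 v) \<in> forms UNIV (q\<^sup>2)"
        by (rule F_multI[OF F_coord_power E2_form]) (simp add: q2)
      moreover have "v $ 3 * (E1 v * E2 v) = v $ 4 * (v $ 4 ^ (N - 1) * E2 v)" if v: "v \<in> C" for v
        using yE1[OF v] zN[of v] by (simp flip: mult.assoc)
      ultimately show ?thesis by (intro bexI[of _ "\<lambda>v. v $ 4 ^ (N - 1) * E2 v"]) (auto simp: 3)
    next
      case 4
      then show ?thesis using a by (intro bexI[of _ "\<lambda>v. E1 v * E2 v"]) auto
    qed
  qed
  have "\<exists>a b h g. h \<in> forms UNIV a \<and> g \<in> forms UNIV b \<and> d + a = Suc b \<and> h einf \<noteq> 0 \<and>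
       (\<forall>v\<in>C. \<phi> v * h v = v $ 4 * g v)" if "\<phi> \<in> forms UNIV d" "\<phi> einf = 0" for d \<phi>
    by (rule divisible_by_parameter[OF _ a _ _ _ L that]) (use q_ge_2 in \<open>auto simp: E_einf\<close>)
  note div = this
  have n: "nonvanishing (\<lambda>v. v $ 2)" "nonvanishing (\<lambda>v. v $ 4)"
    using C_generic by (auto simp: nonvanishing_def)
  show ?thesis
    by (rule local_paramI[OF insertI1 _ n(1) F_coord _ n(2) div factors_infinity]) simp_all
qed

text \<open>Dividing out the parameter one step at a time shows that the factors of a power of \<open>T\<close> are
  themselves powers of \<open>T\<close>, up to units.\<close>

lemma factors_of_product:
  assumes e: "e \<in> insert einf C" and T: "T \<in> forms UNIV 1" "T e = 0" "nonvanishing T"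
    and div: "\<And>d \<phi>. \<phi> \<in> forms UNIV d \<Longrightarrow> \<phi> e = 0 \<Longrightarrow>
      \<exists>a b h g. h \<in> forms UNIV a \<and> g \<in> forms UNIV b \<and>
        d + a = Suc b \<and> h e \<noteq> 0 \<and> (\<forall>v\<in>C. \<phi> v * h v = T v * g v)"
    and s: "s \<in> forms UNIV es"
  shows "\<phi> \<in> forms UNIV d \<Longrightarrow> factors e T (d + es) (\<lambda>v. \<phi> v * s v) n \<Longrightarrow> \<exists>k. factors e T d \<phi> k"
proof (induction n arbitrary: d \<phi>)
  case (0 d \<phi>)
  then obtain a b h g where f: "h \<in> forms UNIV a" "g \<in> forms UNIV b" "d + es + a = b" "h e \<noteq> 0" "g e \<noteq> 0"
    "\<And>v. v \<in> C \<Longrightarrow> \<phi> v * s v * h v = g v" unfolding factors_def by auto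
  have "(\<lambda>v. \<phi> v * s v * h v) \<in> forms UNIV b"
    by (rule F_multI[OF F_mult[OF 0(1) s] f(1) f(3)])
  from form_eq_at[OF this f(2) f(6) e] have "\<phi> e \<noteq> 0" using f(5) by auto
  then show ?case unfolding factors_def
    using 0(1) F_const[of 1]
    by (intro exI[of _ 0] exI[of _ d] exI[of _ "\<lambda>_. 1"] exI[of _ \<phi>]) auto
next
  case (Suc n d \<phi>)
  show ?case
  proof (cases "\<phi> e = 0")
    case False
    then show ?thesis unfolding factors_def
      using Suc.prems(1) F_const[of 1]
      by (intro exI[of _ 0] exI[of _ d] exI[of _ "\<lambda>_. 1"] exI[of _ \<phi>]) auto
  next
    case True
    from div[OF Suc.prems(1) True] obtain a b h1 \<phi>1 where 1: "h1 \<in> forms UNIV a" "\<phi>1 \<in> forms UNIV b"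
      "d + a = Suc b" "h1 e \<noteq> 0" "\<And>v. v \<in> C \<Longrightarrow> \<phi> v * h1 v = T v * \<phi>1 v" by blast
    obtain a' b' h g where f: "h \<in> forms UNIV a'" "g \<in> forms UNIV b'" "d + es + a' = Suc n + b'"
      "h e \<noteq> 0" "g e \<noteq> 0" "\<And>v. v \<in> C \<Longrightarrow> \<phi> v * s v * h v = T v ^ Suc n * g v"
      using Suc.prems(2) unfolding factors_def by blast
    have A: "(\<lambda>v. \<phi>1 v * s v * h v) \<in> forms UNIV (b + es + a')"
      by (rule F_mult[OF F_mult[OF 1(2) s] f(1)])
    have B: "(\<lambda>v. T v ^ n * (g v * h1 v)) \<in> forms UNIV (b + es + a')"
      by (rule F_multI[OF F_power[OF T(1)] F_mult[OF f(2) 1(1)]]) (use 1(3) f(3) in simp)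
    have eq: "\<phi>1 v * s v * h v = T v ^ n * (g v * h1 v)" if v: "v \<in> C" for v
    proof (rule forms_cancel[OF T(1) T(3) A B _ v])
      fix v assume v: "v \<in> C"
      have "T v * (\<phi>1 v * s v * h v) = (T v * \<phi>1 v) * (s v * h v)" by (simp only: mult_ac)
      also have "\<dots> = (\<phi> v * h1 v) * (s v * h v)" by (simp only: 1(5)[OF v])
      also have "\<dots> = (\<phi> v * s v * h v) * h1 v" by (simp only: mult_ac)
      also have "\<dots> = T v ^ Suc n * g v * h1 v" by (simp only: f(6)[OF v])
      finally show "T v * (\<phi>1 v * s v * h v) = T v * (T v ^ n * (g v * h1 v))"
        by (simp only: power_Suc mult_ac)
    qed
    have "factors e T (b + es) (\<lambda>v. \<phi>1 v * s v) n"
      unfolding factors_def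
      by (intro exI[of _ a'] exI[of _ "b' + a"] exI[of _ h] exI[of _ "\<lambda>v. g v * h1 v"])
         (use f 1 eq F_mult[OF f(2) 1(1)] in auto)
    from Suc.IH[OF 1(2) this] obtain k where "factors e T b \<phi>1 k" by blast
    then obtain a2 b2 h2 g2 where 2: "h2 \<in> forms UNIV a2" "g2 \<in> forms UNIV b2" "b + a2 = k + b2"
      "h2 e \<noteq> 0" "g2 e \<noteq> 0" "\<And>v. v \<in> C \<Longrightarrow> \<phi>1 v * h2 v = T v ^ k * g2 v"
      unfolding factors_def by blast
    have "\<phi> v * (h1 v * h2 v) = T v ^ Suc k * g2 v" if v: "v \<in> C" for v
    proof -
      have "\<phi> v * (h1 v * h2 v) = T v * (\<phi>1 v * h2 v)" using 1(5)[OF v] by (simp flip: mult.assoc)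
      then show ?thesis by (simp add: 2(6)[OF v] mult.assoc)
    qed
    then have "factors e T d \<phi> (Suc k)" unfolding factors_def
      by (intro exI[of _ "a + a2"] exI[of _ b2] exI[of _ "\<lambda>v. h1 v * h2 v"] exI[of _ g2])
         (use 1 2 F_mult[OF 1(1) 2(1)] in auto)
    then show ?thesis by blast
  qed
qed

text \<open>At an affine point \<open>(a, b, c)\<close> the parameter is \<open>z - c\<close>: it divides
  \<open>(y - b)\<^sup>Q - (y - b) = z\<^sup>N - c\<^sup>N\<close> with \<open>Q = q\<^sup>2\<close>, hence \<open>y - b\<close> up to a unit, and likewise \<open>x - a\<close>.\<close>

lemma local_param_affine:
  assumes e: "e \<in> C"
  shows "local_param e 1 (\<lambda>v. v $ 4 - e $ 4 * v $ 1)"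
proof -
  let ?T = "\<lambda>v :: 'a ^ 4. v $ 4 - e $ 4 * v $ 1"
  have e1: "e $ 1 = 1" using C_D(1)[OF e] .
  have lin: "(\<lambda>v :: 'a ^ 4. v $ i - c * v $ 1) \<in> forms UNIV 1" for i c
    by (intro forms_diff F_scale F_coord)
  note T = lin[of 4 "e $ 4"]
  \<comment> \<open>\<open>y - b\<close> and \<open>x - a\<close>, their cofactors \<open>hy\<close> and \<open>hx\<close>, which are units at \<open>e\<close>, and the quotients\<close>
  define Ly where "Ly = (\<lambda>v :: 'a ^ 4. v $ 3 - e $ 3 * v $ 1)"
  define Lx where "Lx = (\<lambda>v :: 'a ^ 4. v $ 2 - e $ 2 * v $ 1)"
  define hy where "hy = (\<lambda>v. Ly v ^ (q\<^sup>2 - 1) - v $ 1 ^ (q\<^sup>2 - 1))"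
  define hx where "hx = (\<lambda>v. Lx v ^ (q - 1) + v $ 1 ^ (q - 1))"
  define Gz where "Gz = (\<lambda>v :: 'a ^ 4. \<Sum>i<N. e $ 4 ^ (N - Suc i) * (v $ 4 ^ i * v $ 1 ^ (q\<^sup>2 - 1 - i)))"
  define Gy where "Gy = (\<lambda>v :: 'a ^ 4. \<Sum>i<q + 1. e $ 3 ^ (q + 1 - Suc i) * (v $ 3 ^ i * v $ 1 ^ (q - i)))"
  have q2: "q\<^sup>2 \<ge> 4" using power_mono[of 2 q 2] q_ge_2 by simp
  have Nq: "N \<le> q\<^sup>2" using N_q q_ge_2 by linarith
  have Lf: "Ly \<in> forms UNIV 1" "Lx \<in> forms UNIV 1" unfolding Ly_def Lx_def by (rule lin)+
  have hy: "hy \<in> forms UNIV (q\<^sup>2 - 1)" unfolding hy_def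
    by (intro forms_diff F_coord_power F_powerI[OF Lf(1)]) simp
  have hx: "hx \<in> forms UNIV (q - 1)" unfolding hx_def
    by (intro F_add F_coord_power F_powerI[OF Lf(2)]) simp
  have Gz: "Gz \<in> forms UNIV (q\<^sup>2 - 1)" unfolding Gz_def
    by (intro F_sum F_scale F_multI[OF F_coord_power F_coord_power]) (use Nq in auto)
  have Gy: "Gy \<in> forms UNIV q" unfolding Gy_def
    by (intro F_sum F_scale F_multI[OF F_coord_power F_coord_power]) auto
  let ?H = "\<lambda>v. hx v * hy v * v $ 1"
  let ?a = "q + q\<^sup>2 - 1"
  have H: "?H \<in> forms UNIV ?a"
    by (rule F_multI[OF F_mult[OF hx hy] F_coord]) (use q2 q_ge_2 in linarith)
  have "Ly e = 0" "Lx e = 0" using e1 by (auto simp: Ly_def Lx_def)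
  then have "hx e = 1" "hy e = - 1" using e1 q2 q_ge_2 by (auto simp: hx_def hy_def power_0_left)
  then have He: "?H e \<noteq> 0" using e1 by simp
  have Yeq: "Ly v * hy v = ?T v * Gz v" if v: "v \<in> C" for v
  proof -
    have "Ly v * hy v = Ly v ^ Suc (q\<^sup>2 - 1) - Ly v"
      using C_D(1)[OF v] by (simp add: hy_def right_diff_distrib)
    also have "Suc (q\<^sup>2 - 1) = q\<^sup>2" using q2 by simp
    also have "Ly v ^ q\<^sup>2 - Ly v = (v $ 3 ^ q\<^sup>2 - v $ 3) - (e $ 3 ^ q\<^sup>2 - e $ 3)"
      using C_D(1)[OF v] by (simp add: Ly_def frob_diff)
    also have "\<dots> = v $ 4 ^ N - e $ 4 ^ N" by (simp only: C_D(3)[OF v] C_D(3)[OF e])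
    also have "\<dots> = (v $ 4 - e $ 4) * (\<Sum>i<N. e $ 4 ^ (N - Suc i) * v $ 4 ^ i)"
      by (rule power_diff_sumr2)
    also have "\<dots> = ?T v * Gz v" using C_D(1)[OF v] by (simp add: Gz_def)
    finally show ?thesis .
  qed
  have Xeq: "Lx v * hx v = Ly v * Gy v" if v: "v \<in> C" for v
  proof -
    have "Lx v * hx v = Lx v ^ Suc (q - 1) + Lx v"
      using C_D(1)[OF v] by (simp add: hx_def distrib_left)
    also have "Suc (q - 1) = q" using q_ge_2 by simp
    also have "Lx v ^ q + Lx v = (v $ 2 ^ q + v $ 2) - (e $ 2 ^ q + e $ 2)"
      using C_D(1)[OF v] frob_diff[of "v $ 2" "e $ 2" 1] by (simp add: Lx_def)
    also have "\<dots> = v $ 3 ^ (q + 1) - e $ 3 ^ (q + 1)" by (simp only: C_D(2)[OF v] C_D(2)[OF e])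
    also have "\<dots> = (v $ 3 - e $ 3) * (\<Sum>i<q + 1. e $ 3 ^ (q + 1 - Suc i) * v $ 3 ^ i)"
      by (rule power_diff_sumr2)
    also have "\<dots> = Ly v * Gy v" using C_D(1)[OF v] by (simp add: Gy_def Ly_def del: sum.lessThan_Suc)
    finally show ?thesis .
  qed
  have L: "\<exists>g\<in>forms UNIV ?a. \<forall>v\<in>C. (v $ i - e $ i * v $ 1) * ?H v = ?T v * g v" for i :: 4
  proof -
    consider "i = 1" | "i = 2" | "i = 3" | "i = 4" using exhaust_4 by metis
    then show ?thesis
    proof cases
      case 1
      then show ?thesis using e1 by (intro bexI[of _ "\<lambda>_. 0"]) (auto intro: F_zero)
    next
      case 2
      have "(\<lambda>v. Gz v * Gy v) \<in> forms UNIV ?a"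
        by (rule F_multI[OF Gz Gy]) (use q2 in linarith)
      moreover have "(v $ 2 - e $ 2 * v $ 1) * ?H v = ?T v * (Gz v * Gy v)" if v: "v \<in> C" for v
      proof -
        have "(v $ 2 - e $ 2 * v $ 1) * ?H v = (Lx v * hx v) * hy v" using C_D(1)[OF v]
          by (simp add: Lx_def)
        also have "\<dots> = (Ly v * hy v) * Gy v" by (simp only: Xeq[OF v] mult_ac)
        also have "\<dots> = ?T v * (Gz v * Gy v)" by (simp only: Yeq[OF v] mult_ac)
        finally show ?thesis .
      qed
      ultimately show ?thesis by (intro bexI[of _ "\<lambda>v. Gz v * Gy v"]) (auto simp: 2)
    next
      case 3
      have "(\<lambda>v. Gz v * (hx v * v $ 1)) \<in> forms UNIV ?a"
        by (rule F_multI[OF Gz F_mult[OF hx F_coord]]) (use q2 q_ge_2 in linarith)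
      moreover have "(v $ 3 - e $ 3 * v $ 1) * ?H v = ?T v * (Gz v * (hx v * v $ 1))" if v: "v \<in> C" for v
      proof -
        have "(v $ 3 - e $ 3 * v $ 1) * ?H v = (Ly v * hy v) * (hx v * v $ 1)"
          by (simp add: Ly_def mult_ac)
        also have "\<dots> = ?T v * (Gz v * (hx v * v $ 1))" by (simp only: Yeq[OF v] mult_ac)
        finally show ?thesis .
      qed
      ultimately show ?thesis by (intro bexI[of _ "\<lambda>v. Gz v * (hx v * v $ 1)"]) (auto simp: 3)
    next
      case 4
      then show ?thesis using H by (intro bexI[of _ ?H]) auto
    qed
  qed
  have Te: "?T e = 0" using e1 by simp
  have a0: "0 < ?a" using q2 by linarith
  have div: "\<exists>a b h g. h \<in> forms UNIV a \<and> g \<in> forms UNIV b \<and> d + a = Suc b \<and> h e \<noteq> 0 \<and>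
       (\<forall>v\<in>C. \<phi> v * h v = ?T v * g v)" if "\<phi> \<in> forms UNIV d" "\<phi> e = 0" for d \<phi>
    using divisible_by_parameter[of e 1 ?H ?a ?T, OF e1 H a0 He Te L that] .
  have nT: "nonvanishing ?T"
  proof (rule ccontr)
    assume "\<not> nonvanishing ?T"
    then have "?T v = 0" if "v \<in> C" for v using that unfolding nonvanishing_def by blast
    then have z: "v $ 4 = e $ 4" if "v \<in> C" for v using that C_D(1)[of v] by fastforce
    define p where "p = (\<lambda>j k. if j = (0::nat) then if k = (0::nat) then [:- (e $ 4):] else if k = 1 then 1 else 0 else 0)"
    have N1: "1 < N" using q_ge_2 by (simp add: N_def)
    have "p 0 1 = 0"
    proof (rule rep1_indep[of p 0 1])
      fix v assume v: "v \<in> C"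
      have "(\<Sum>j<q + 1. \<Sum>k<N. poly (p j k) (v $ 2) * v $ 3 ^ j * v $ 4 ^ k) =
        (\<Sum>j<q + 1. if j = 0 then \<Sum>k<N. poly (p 0 k) (v $ 2) * v $ 4 ^ k else 0)"
        by (intro sum.cong refl) (auto simp: p_def)
      also have "\<dots> = (\<Sum>k<N. poly (p 0 k) (v $ 2) * v $ 4 ^ k)" by (subst sum.delta) auto
      also have "\<dots> = (\<Sum>k\<in>{0, 1}. poly (p 0 k) (v $ 2) * v $ 4 ^ k)"
        using N1 by (intro sum.mono_neutral_right) (auto simp: p_def)
      also have "\<dots> = 0" using z[OF v] by (simp add: p_def)
      finally show "(\<Sum>j<q + 1. \<Sum>k<N. poly (p j k) (v $ 2) * v $ 3 ^ j * v $ 4 ^ k) = 0" .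
    qed (use N1 in auto)
    then show False by (simp add: p_def)
  qed
  have fac: "\<exists>n. factors e ?T d \<phi> n" if \<phi>: "\<phi> \<in> forms UNIV d" and nz: "nonvanishing \<phi>" for d \<phi>
  proof -
    obtain es s p where s: "s \<in> forms UNIV es" "p \<noteq> 0" "\<And>v. v \<in> C \<Longrightarrow> \<phi> v * s v = poly p (v $ 4)"
      using norm_to_z[OF \<phi> nz] by blast
    obtain p1 where p1: "p = [:- (e $ 4), 1:] ^ Polynomial.order (e $ 4) p * p1" "\<not> [:- (e $ 4), 1:] dvd p1"
      using order_decomp[OF s(2)] by blast
    let ?n = "Polynomial.order (e $ 4) p"
    let ?m = "Polynomial.degree p1"
    define P1 where "P1 = (\<lambda>v :: 'a ^ 4. \<Sum>i\<le>?m. Polynomial.coeff p1 i * (v $ 4 ^ i * v $ 1 ^ (?m - i)))"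
    have P1: "P1 \<in> forms UNIV ?m" unfolding P1_def
      by (intro F_sum F_scale F_multI[OF F_coord_power F_coord_power]) auto
    have P1v: "P1 v = poly p1 (v $ 4)" if "v \<in> C" for v
      using C_D(1)[OF that] by (simp add: P1_def poly_altdef)
    have "poly p1 (e $ 4) \<noteq> 0" using p1(2) by (simp add: poly_eq_0_iff_dvd)
    then have P1e: "P1 e \<noteq> 0" using P1v[OF e] by simp
    let ?k = "d + es"
    have h: "(\<lambda>v :: 'a ^ 4. v $ 1 ^ (?n + ?m)) \<in> forms UNIV (?n + ?m)" by (rule F_coord_power)
    have g: "(\<lambda>v. v $ 1 ^ ?k * P1 v) \<in> forms UNIV (?k + ?m)" by (rule F_mult[OF F_coord_power P1])
    have "\<phi> v * s v * v $ 1 ^ (?n + ?m) = ?T v ^ ?n * (v $ 1 ^ ?k * P1 v)" if v: "v \<in> C" for v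
    proof -
      have "poly p (v $ 4) = (v $ 4 - e $ 4) ^ ?n * poly p1 (v $ 4)"
        by (subst p1(1)) (simp add: poly_power poly_mult)
      then show ?thesis using s(3)[OF v] C_D(1)[OF v] P1v[OF v] by simp
    qed
    then have "factors e ?T (d + es) (\<lambda>v. \<phi> v * s v) ?n"
      unfolding factors_def
      by (intro exI[of _ "?n + ?m"] exI[of _ "?k + ?m"] exI[of _ "\<lambda>v. v $ 1 ^ (?n + ?m)"]
          exI[of _ "\<lambda>v. v $ 1 ^ ?k * P1 v"]) (use h g e1 P1e in auto)
    from factors_of_product[OF _ T Te nT div s(1) \<phi> this] e show ?thesis by blast
  qed
  have n1: "nonvanishing (\<lambda>v. v $ 1)" unfolding nonvanishing_def using e e1 by (intro bexI[of _ e]) simp_all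
  show ?thesis by (rule local_paramI[OF insertI2[OF e] e1 n1 T Te nT div fac])
qed

section \<open>Functions without affine poles\<close>

text \<open>The polynomial functions on the affine curve. A quotient that is regular at every affine point is
  one of them. Its denominator may be taken to be a polynomial in \<open>z\<close>; a linear factor \<open>z - c\<close> of the
  denominator divides the numerator because the numerator vanishes on the whole fibre over \<open>c\<close>.\<close>

definition polyfuns :: "('a ^ 4 \<Rightarrow> 'a) set" where
  "polyfuns = {\<phi>. \<exists>d. \<exists>g\<in>forms UNIV d. \<forall>v\<in>C. \<phi> v = g v}"

lemma polyfuns_form: "g \<in> forms UNIV d \<Longrightarrow> g \<in> polyfuns"
  unfolding polyfuns_def by blast

lemma polyfuns_cong: "\<phi> \<in> polyfuns \<Longrightarrow> (\<And>v. v \<in> C \<Longrightarrow> \<psi> v = \<phi> v) \<Longrightarrow> \<psi> \<in> polyfuns"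
  unfolding polyfuns_def by fastforce

lemma polyfuns_mult: "\<phi> \<in> polyfuns \<Longrightarrow> \<psi> \<in> polyfuns \<Longrightarrow> (\<lambda>v. \<phi> v * \<psi> v) \<in> polyfuns"
proof -
  assume "\<phi> \<in> polyfuns" "\<psi> \<in> polyfuns"
  then obtain d g d' g' where "g \<in> forms UNIV d" "g' \<in> forms UNIV d'"
    "\<And>v. v \<in> C \<Longrightarrow> \<phi> v = g v" "\<And>v. v \<in> C \<Longrightarrow> \<psi> v = g' v" unfolding polyfuns_def by blast
  then show ?thesis using polyfuns_cong[OF polyfuns_form[OF F_mult]] by simp
qed

lemma polyfuns_add: "\<phi> \<in> polyfuns \<Longrightarrow> \<psi> \<in> polyfuns \<Longrightarrow> (\<lambda>v. \<phi> v + \<psi> v) \<in> polyfuns"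
proof -
  assume "\<phi> \<in> polyfuns" "\<psi> \<in> polyfuns"
  then obtain d g d' g' where g: "g \<in> forms UNIV d" "g' \<in> forms UNIV d'"
    "\<And>v. v \<in> C \<Longrightarrow> \<phi> v = g v" "\<And>v. v \<in> C \<Longrightarrow> \<psi> v = g' v" unfolding polyfuns_def by blast
  have "(\<lambda>v. g v * v $ 1 ^ d' + v $ 1 ^ d * g' v) \<in> forms UNIV (d + d')"
    by (intro F_add F_mult[OF g(1) F_coord_power] F_mult[OF F_coord_power g(2)])
  from polyfuns_form[OF this] show ?thesis
    by (rule polyfuns_cong) (simp add: g C_D(1))
qed

lemma polyfuns_sum: "(\<And>i. i \<in> I \<Longrightarrow> \<phi> i \<in> polyfuns) \<Longrightarrow> (\<lambda>v. \<Sum>i\<in>I. \<phi> i v) \<in> polyfuns"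
  by (induction I rule: infinite_finite_induct)
     (auto intro: polyfuns_add polyfuns_form[OF F_zero])

lemma polyfuns_poly: "(\<lambda>v. poly p (v $ i)) \<in> polyfuns"
proof (induction p)
  case 0
  then show ?case by (simp add: polyfuns_form[OF F_zero])
next
  case (pCons a p)
  then show ?case
    using polyfuns_add[OF polyfuns_form[OF F_const[of a]] polyfuns_mult[OF polyfuns_form[OF F_coord[of i]] pCons.IH]]
    by simp
qed

lemma polyfuns_rep2:
  assumes "\<phi> \<in> polyfuns"
  obtains c where "\<And>v. v \<in> C \<Longrightarrow> \<phi> v = (\<Sum>i<q. \<Sum>j<q\<^sup>2. poly (c i j) (v $ 4) * v $ 2 ^ i * v $ 3 ^ j)"
proof -
  obtain d g where g: "g \<in> forms UNIV d" "\<And>v. v \<in> C \<Longrightarrow> \<phi> v = g v"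
    using assms unfolding polyfuns_def by blast
  show thesis using forms_rep2[OF g(1)] by (rule repE) (use g(2) that in auto)
qed

lemma polyfuns_divide:
  assumes "\<phi> \<in> polyfuns" "\<And>v. v \<in> C \<Longrightarrow> v $ 4 = c \<Longrightarrow> \<phi> v = 0"
  obtains \<psi> where "\<psi> \<in> polyfuns" "\<And>v. v \<in> C \<Longrightarrow> \<phi> v = (v $ 4 - c) * \<psi> v"
proof -
  obtain a where a: "\<And>v. v \<in> C \<Longrightarrow> \<phi> v = (\<Sum>i<q. \<Sum>j<q\<^sup>2. poly (a i j) (v $ 4) * v $ 2 ^ i * v $ 3 ^ j)"
    using polyfuns_rep2[OF assms(1)] by blast
  have root: "poly (a i j) c = 0" if ij: "i < q" "j < q\<^sup>2" for i j
  proof (rule fibre_coeffs_zero[of c "\<lambda>i j. poly (a i j) c", OF _ ij])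
    fix x y assume v: "vec4 1 x y c \<in> C"
    show "(\<Sum>i<q. \<Sum>j<q\<^sup>2. poly (a i j) c * x ^ i * y ^ j) = 0"
      using a[OF v] assms(2)[OF v] by simp
  qed
  have dv: "poly (a i j) z = (z - c) * poly (a i j div [:-c, 1:]) z" if ij: "i < q" "j < q\<^sup>2" for i j z
  proof -
    have "[:-c, 1:] dvd a i j" using root[OF ij] by (simp add: poly_eq_0_iff_dvd)
    then have "a i j = [:-c, 1:] * (a i j div [:-c, 1:])"
      by (rule dvd_mult_div_cancel[symmetric])
    then have "poly (a i j) z = poly ([:-c, 1:] * (a i j div [:-c, 1:])) z" by simp
    then show ?thesis by (simp only: poly_mult) simp
  qed
  define \<psi> where "\<psi> = (\<lambda>v :: 'a ^ 4. \<Sum>i<q. \<Sum>j<q\<^sup>2. poly (a i j div [:-c, 1:]) (v $ 4) * v $ 2 ^ i * v $ 3 ^ j)"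
  have "\<psi> \<in> polyfuns" unfolding \<psi>_def
    by (intro polyfuns_sum polyfuns_mult polyfuns_poly polyfuns_form[OF F_coord_power])
  moreover have "\<phi> v = (v $ 4 - c) * \<psi> v" if v: "v \<in> C" for v
  proof -
    have "\<phi> v = (\<Sum>i<q. \<Sum>j<q\<^sup>2. (v $ 4 - c) * (poly (a i j div [:-c, 1:]) (v $ 4) * v $ 2 ^ i * v $ 3 ^ j))"
      unfolding a[OF v] by (intro sum.cong refl) (simp add: dv mult.assoc)
    then show ?thesis by (simp add: \<psi>_def sum_distrib_left)
  qed
  ultimately show thesis by (rule that)
qed

lemma polyfuns_domain:
  assumes "\<phi> \<in> polyfuns" "\<psi> \<in> polyfuns" "nonvanishing \<phi>" "\<And>v. v \<in> C \<Longrightarrow> \<phi> v * \<psi> v = 0" "v \<in> C"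
  shows "\<psi> v = 0"
proof (rule ccontr)
  assume "\<psi> v \<noteq> 0"
  obtain d g d' g' where g: "g \<in> forms UNIV d" "g' \<in> forms UNIV d'"
    "\<And>v. v \<in> C \<Longrightarrow> \<phi> v = g v" "\<And>v. v \<in> C \<Longrightarrow> \<psi> v = g' v" using assms(1,2) unfolding polyfuns_def by blast
  have "nonvanishing g" using assms(3) g(3) by (auto simp: nonvanishing_def)
  moreover have "nonvanishing g'" using \<open>\<psi> v \<noteq> 0\<close> g(4) assms(5) by (auto simp: nonvanishing_def)
  ultimately have "nonvanishing (\<lambda>v. g v * g' v)" using forms_domain[OF g(1,2)] by blast
  then show False using assms(4) g(3,4) by (auto simp: nonvanishing_def)
qed

lemma regular_quotient_z:
  assumes "p \<noteq> 0" "\<phi> \<in> polyfuns"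
    and "\<And>e. e \<in> C \<Longrightarrow> \<exists>U\<in>polyfuns. \<exists>V\<in>polyfuns. V e \<noteq> 0 \<and> (\<forall>v\<in>C. \<phi> v * V v = poly p (v $ 4) * U v)"
  shows "\<exists>r\<in>polyfuns. \<forall>v\<in>C. \<phi> v = poly p (v $ 4) * r v"
  using assms
proof (induction "Polynomial.degree p" arbitrary: p \<phi>)
  case 0
  obtain c where c: "p = [:c:]" using 0(1) by (metis degree_eq_zeroE)
  then have "c \<noteq> 0" using 0(2) by auto
  note c = c this
  have "(\<lambda>v. inverse c * \<phi> v) \<in> polyfuns"
    by (rule polyfuns_mult[OF polyfuns_form[OF F_const] 0(3)])
  then show ?case using c by (intro bexI[of _ "\<lambda>v. inverse c * \<phi> v"]) auto
next
  case (Suc n p \<phi>)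
  obtain c where c: "poly p c = 0" using alg_closed_imp_poly_has_root[of p] Suc(2) by auto
  then obtain p1 where p1: "p = [:-c, 1:] * p1" by (auto simp: poly_eq_0_iff_dvd elim: dvdE)
  have p10: "p1 \<noteq> 0" using p1 Suc.prems(1) by auto
  have deg: "n = Polynomial.degree p1" using p1 p10 Suc(2) degree_mult_eq[of "[:-c, 1:]" p1] by simp
  have ev: "poly p z = (z - c) * poly p1 z" for z unfolding p1 by (simp only: poly_mult) simp
  have "\<phi> v = 0" if v: "v \<in> C" "v $ 4 = c" for v
  proof -
    obtain U V where "V v \<noteq> 0" "\<forall>v\<in>C. \<phi> v * V v = poly p (v $ 4) * U v" using Suc.prems(3)[OF v(1)] by blast
    then show ?thesis using v c by auto
  qed
  then obtain \<psi> where \<psi>: "\<psi> \<in> polyfuns" "\<And>v. v \<in> C \<Longrightarrow> \<phi> v = (v $ 4 - c) * \<psi> v"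
    using polyfuns_divide[OF Suc.prems(2)] by blast
  have "\<exists>r\<in>polyfuns. \<forall>v\<in>C. \<psi> v = poly p1 (v $ 4) * r v"
  proof (rule Suc.hyps(1)[OF deg p10 \<psi>(1)])
    fix e assume e: "e \<in> C"
    obtain U V where UV: "U \<in> polyfuns" "V \<in> polyfuns" "V e \<noteq> 0"
      "\<And>v. v \<in> C \<Longrightarrow> \<phi> v * V v = poly p (v $ 4) * U v" using Suc.prems(3)[OF e] by blast
    have l: "(\<lambda>v. v $ 4 - c) \<in> polyfuns"
      using polyfuns_poly[of "[:-c, 1:]" 4] by simp
    have nl: "nonvanishing (\<lambda>v. v $ 4 - c)"
    proof -
      obtain z where z: "z \<noteq> c" using ex_new_if_finite[OF infinite_K, of "{c}"] by auto
      obtain x y where "vec4 1 x y z \<in> C" using C_over_z by blast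
      then show ?thesis using z by (auto simp: nonvanishing_def intro!: bexI[of _ "vec4 1 x y z"])
    qed
    have f: "(\<lambda>v. \<psi> v * V v + (- 1) * (poly p1 (v $ 4) * U v)) \<in> polyfuns"
      by (intro polyfuns_add polyfuns_mult \<psi>(1) UV polyfuns_poly polyfuns_form[OF F_const])
    have z: "(v $ 4 - c) * (\<psi> v * V v + (- 1) * (poly p1 (v $ 4) * U v)) = 0" if v: "v \<in> C" for v
    proof -
      have "(v $ 4 - c) * (\<psi> v * V v + (- 1) * (poly p1 (v $ 4) * U v))
        = ((v $ 4 - c) * \<psi> v) * V v - ((v $ 4 - c) * poly p1 (v $ 4)) * U v"
        by (simp add: algebra_simps)
      also have "\<dots> = \<phi> v * V v - poly p (v $ 4) * U v" by (simp only: \<psi>(2)[OF v] ev)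
      finally show ?thesis using UV(4)[OF v] by simp
    qed
    have "\<psi> v * V v = poly p1 (v $ 4) * U v" if v: "v \<in> C" for v
      using polyfuns_domain[OF l f nl z v] by simp
    then show "\<exists>U\<in>polyfuns. \<exists>V\<in>polyfuns. V e \<noteq> 0 \<and> (\<forall>v\<in>C. \<psi> v * V v = poly p1 (v $ 4) * U v)"
      using UV by blast
  qed
  then obtain r where "r \<in> polyfuns" "\<And>v. v \<in> C \<Longrightarrow> \<psi> v = poly p1 (v $ 4) * r v" by blast
  then show ?case using \<psi>(2) by (intro bexI[of _ r]) (auto simp: ev mult.assoc)
qed

lemma regular_quotient:
  assumes \<phi>: "\<phi> \<in> forms UNIV d" and h: "h \<in> forms UNIV d'" "nonvanishing h"
    and reg: "\<And>e. e \<in> C \<Longrightarrow> \<exists>U\<in>polyfuns. \<exists>V\<in>polyfuns. V e \<noteq> 0 \<and> (\<forall>v\<in>C. \<phi> v * V v = h v * U v)"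
  shows "\<exists>r\<in>polyfuns. \<forall>v\<in>C. \<phi> v = h v * r v"
proof -
  obtain es s p where s: "s \<in> forms UNIV es" "p \<noteq> 0" "\<And>v. v \<in> C \<Longrightarrow> h v * s v = poly p (v $ 4)"
    using norm_to_z[OF h] by blast
  have "\<exists>r\<in>polyfuns. \<forall>v\<in>C. \<phi> v * s v = poly p (v $ 4) * r v"
  proof (rule regular_quotient_z[OF s(2)])
    show "(\<lambda>v. \<phi> v * s v) \<in> polyfuns" by (rule polyfuns_form[OF F_mult[OF \<phi> s(1)]])
    fix e assume "e \<in> C"
    then obtain U V where UV: "U \<in> polyfuns" "V \<in> polyfuns" "V e \<noteq> 0"
      "\<And>v. v \<in> C \<Longrightarrow> \<phi> v * V v = h v * U v" using reg by blast
    have "\<phi> v * s v * V v = poly p (v $ 4) * U v" if v: "v \<in> C" for v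
    proof -
      have "\<phi> v * s v * V v = (\<phi> v * V v) * s v" by (simp only: mult_ac)
      also have "\<dots> = (h v * U v) * s v" by (simp only: UV(4)[OF v])
      also have "\<dots> = (h v * s v) * U v" by (simp only: mult_ac)
      finally show ?thesis by (simp only: s(3)[OF v])
    qed
    then show "\<exists>U\<in>polyfuns. \<exists>V\<in>polyfuns. V e \<noteq> 0 \<and> (\<forall>v\<in>C. \<phi> v * s v * V v = poly p (v $ 4) * U v)"
      using UV by blast
  qed
  then obtain r where r: "r \<in> polyfuns" "\<And>v. v \<in> C \<Longrightarrow> \<phi> v * s v = poly p (v $ 4) * r v" by blast
  have ns: "nonvanishing s"
  proof (rule ccontr)
    assume "\<not> nonvanishing s"
    then have z: "poly p (v $ 4) = 0" if "v \<in> C" for v using s(3)[OF that] that by (auto simp: nonvanishing_def)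
    have "poly p z = 0" for z
    proof -
      obtain x y where "vec4 1 x y z \<in> C" using C_over_z by blast
      from z[OF this] show ?thesis by simp
    qed
    then show False using poly_zero_if_all_roots s(2) by blast
  qed
  have f: "(\<lambda>v. \<phi> v + (- 1) * (h v * r v)) \<in> polyfuns"
    by (intro polyfuns_add polyfuns_mult polyfuns_form[OF \<phi>] polyfuns_form[OF h(1)] r(1) polyfuns_form[OF F_const])
  have z: "s v * (\<phi> v + (- 1) * (h v * r v)) = 0" if v: "v \<in> C" for v
  proof -
    have "s v * (\<phi> v + (- 1) * (h v * r v)) = \<phi> v * s v - (h v * s v) * r v" by (simp add: algebra_simps)
    then show ?thesis by (simp only: r(2)[OF v] s(3)[OF v]) simp
  qed
  have "\<phi> v = h v * r v" if v: "v \<in> C" for v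
    using polyfuns_domain[OF polyfuns_form[OF s(1)] f ns z v] by simp
  then show ?thesis using r(1) by blast
qed

end

section \<open>The projective curve and its function field\<close>

lemma proj_class_scale: "c \<noteq> 0 \<Longrightarrow> proj_class (c *s v) = proj_class v"
proof -
  assume c: "c \<noteq> 0"
  have "\<exists>b. b \<noteq> 0 \<and> a *s (c *s v) = b *s v" if "a \<noteq> 0" for a
    using that c by (intro exI[of _ "a * c"]) (simp add: vector_smult_assoc)
  moreover have "\<exists>b. b \<noteq> 0 \<and> a *s v = b *s (c *s v)" if "a \<noteq> 0" for a
    using that c by (intro exI[of _ "a / c"]) (simp add: vector_smult_assoc)
  ultimately show ?thesis unfolding proj_class_def by blast
qed

lemma proj_class_self: "v \<in> proj_class v"
  unfolding proj_class_def by (intro CollectI exI[of _ 1]) simp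

lemma vanishes_on_proj_class:
  assumes "homogeneous4 d F"
  shows "vanishes_on (proj_class ` S) F \<longleftrightarrow> (\<forall>v\<in>S. eval4 F v = 0)"
proof -
  have "(\<forall>u\<in>proj_class v. eval4 F u = 0) \<longleftrightarrow> eval4 F v = 0" for v
  proof
    assume "\<forall>u\<in>proj_class v. eval4 F u = 0"
    then show "eval4 F v = 0" using proj_class_self by blast
  next
    assume "eval4 F v = 0"
    then show "\<forall>u\<in>proj_class v. eval4 F u = 0"
      using forms_homogeneous[OF forms_eval4[OF assms]] by (auto simp: proj_class_def)
  qed
  then show ?thesis by (simp add: vanishes_on_def)
qed

lemma vanishes_on_point:
  assumes "homogeneous4 d F"
  shows "vanishes_on {proj_class v} F \<longleftrightarrow> eval4 F v = 0"
  using vanishes_on_proj_class[OF assms, of "{v}"] by simp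

lemma UN_pair_const:
  assumes "(a, b) \<in> A" "(c, d) \<in> B"
    and "\<And>x y x' y'. (x, y) \<in> A \<Longrightarrow> (x', y') \<in> B \<Longrightarrow> S x y x' y' = r"
  shows "(\<Union>(x, y)\<in>A. \<Union>(x', y')\<in>B. S x y x' y') = r"
proof -
  have "(case p of (x, y) \<Rightarrow> \<Union>(x', y')\<in>B. S x y x' y') = r" if p: "p \<in> A" for p
  proof (cases p)
    case (Pair x y)
    have "(case p' of (x', y') \<Rightarrow> S x y x' y') = r" if p': "p' \<in> B" for p'
      using assms(3)[of x y "fst p'" "snd p'"] p p' Pair by (simp add: case_prod_unfold)
    then have "(\<Union>(x', y')\<in>B. S x y x' y') = (\<Union>p'\<in>B. r)" by simp
    then show ?thesis using assms(2) Pair by auto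
  qed
  then have "(\<Union>(x, y)\<in>A. \<Union>(x', y')\<in>B. S x y x' y') = (\<Union>p\<in>A. r)" by simp
  then show ?thesis using assms(1) by auto
qed

text \<open>The exponent in the representation of an element as a unit times a power of a uniformizer is unique,
  for any choice \<open>s \<otimes> t\<close> of the uniformizer.\<close>

lemma (in comm_group) exponent_unique:
  assumes U: "subgroup U G" and t: "t \<in> carrier G" "\<And>k::int. t [^] k \<in> U \<Longrightarrow> k = 0"
    and "s \<in> U" "u \<in> U" "u0 \<in> U" and eq: "u \<otimes> (s \<otimes> t) [^] (n::int) = u0 \<otimes> t [^] (n0::int)"
  shows "n = n0"
proof -
  interpret U: subgroup U G by (rule U)
  have c: "s \<in> carrier G" "u \<in> carrier G" "u0 \<in> carrier G" using assms by (auto intro: U.mem_carrier)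
  have sn: "s [^] n \<in> U" using assms(4) subgroup_int_pow_closed[OF U] by blast
  then have snc: "s [^] n \<in> carrier G" by (rule U.mem_carrier)
  have "(u \<otimes> s [^] n) \<otimes> t [^] n = u0 \<otimes> t [^] n0"
    using eq c t(1) snc by (simp add: int_pow_distrib m_assoc)
  then have "t [^] n = inv (u \<otimes> s [^] n) \<otimes> (u0 \<otimes> t [^] n0)"
    using c t(1) snc by (metis inv_solve_left int_pow_closed m_closed)
  then have "t [^] n \<otimes> inv (t [^] n0) = inv (u \<otimes> s [^] n) \<otimes> u0"
    using c t(1) snc by (simp add: m_assoc)
  then have "t [^] (n - n0) = inv (u \<otimes> s [^] n) \<otimes> u0"
    using t(1) by (simp add: int_pow_diff)
  then have "t [^] (n - n0) \<in> U" using sn assms by simp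
  then show ?thesis using t(2) by fastforce
qed

lemma (in monoid) units_of_int_pow:
  "x \<in> Units G \<Longrightarrow> x [^]\<^bsub>units_of G\<^esub> (n::int) = x [^] n"
proof -
  assume x: "x \<in> Units G"
  have "inv\<^bsub>units_of G\<^esub> (x [^]\<^bsub>units_of G\<^esub> k) = inv (x [^] k)" for k :: nat
    using x by (simp only: units_of_pow units_of_inv Units_pow_closed)
  then show ?thesis
    unfolding int_pow_def2 using x by (simp only: units_of_pow split: if_split)
qed

context gk
begin

abbreviation XX :: "'a proj_point set" where "XX \<equiv> gk_curve q"

lemma affine_points: "affine_point ` (gk_affine q :: ('a \<times> 'a \<times> 'a) set) = proj_class ` C"
proof
  show "affine_point ` (gk_affine q :: ('a \<times> 'a \<times> 'a) set) \<subseteq> proj_class ` C"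
  proof
    fix P assume "P \<in> affine_point ` (gk_affine q :: ('a \<times> 'a \<times> 'a) set)"
    then obtain x y z where 1: "(x, y, z) \<in> gk_affine q" "P = affine_point (x, y, z :: 'a)" by auto
    then have "vec4 1 x y z \<in> C" by (simp add: gk_affine_def vec4_in_C N_alt)
    then show "P \<in> proj_class ` C" using 1(2) by (auto simp: affine_point_def vec4_def)
  qed
next
  show "proj_class ` C \<subseteq> affine_point ` (gk_affine q :: ('a \<times> 'a \<times> 'a) set)"
  proof
    fix P assume "P \<in> proj_class ` C"
    then obtain v where v: "v \<in> C" "P = proj_class v" by auto
    have "(v $ 2, v $ 3, v $ 4) \<in> gk_affine q"
      using C_D(2,3)[OF v(1)] by (simp add: gk_affine_def N_alt)
    moreover have "P = affine_point (v $ 2, v $ 3, v $ 4)"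
      using C_expand[OF v(1)] v(2) by (simp add: affine_point_def vec4_def)
    ultimately show "P \<in> affine_point ` (gk_affine q :: ('a \<times> 'a \<times> 'a) set)" by blast
  qed
qed

lemma einf_neq: "einf \<noteq> 0" "v \<in> C \<Longrightarrow> v \<noteq> 0"
  by (metis einf_nth(2) zero_index zero_neq_one) (metis C_D(1) zero_index zero_neq_one)

text \<open>The projective closure adds a single point to the affine curve.\<close>

lemma curve_points: "XX = proj_class ` insert einf C"
proof (intro equalityI subsetI)
  fix P assume "P \<in> proj_class ` insert einf C"
  then obtain e where e: "e \<in> insert einf C" "P = proj_class e" by auto
  have "vanishes_on {P} F" if F: "homogeneous4 d F" "vanishes_on (proj_class ` C) F" for F d
  proof -
    have "eval4 F v = 0" if "v \<in> C" for v using F that by (simp add: vanishes_on_proj_class)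
    then have "eval4 F e = 0" using form_eq_at[OF forms_eval4[OF F(1)] F_zero _ e(1)] by simp
    then show ?thesis using F(1) by (simp add: e(2) vanishes_on_point)
  qed
  moreover have "P \<in> PG3" using e einf_neq by (auto simp: PG3_def)
  ultimately show "P \<in> XX"
    unfolding gk_curve_def projective_closure_def affine_points by blast
next
  fix P assume P: "P \<in> XX"
  then obtain v where v: "v \<noteq> 0" "P = proj_class v"
    unfolding gk_curve_def projective_closure_def PG3_def by blast
  have zero: "g v = 0" if g: "g \<in> forms UNIV d" "\<And>u. u \<in> C \<Longrightarrow> g u = 0" for g d
  proof -
    obtain F where F: "homogeneous4 d F" "g = eval4 F" using g(1) by (auto simp: forms_def)
    have "vanishes_on (proj_class ` C) F" using F g(2) by (simp add: vanishes_on_proj_class)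
    then have "vanishes_on {P} F"
      using P F(1) unfolding gk_curve_def projective_closure_def affine_points by blast
    then show ?thesis using F by (simp add: v(2) vanishes_on_point)
  qed
  show "P \<in> proj_class ` insert einf C"
  proof (cases "v $ 1 = 0")
    case True
    have "v $ 1 * E2 v - v $ 3 ^ (q + 1) = 0"
    proof (rule zero)
      show "(\<lambda>v. v $ 1 * E2 v - v $ 3 ^ (q + 1)) \<in> forms UNIV (q + 1)"
        by (intro forms_diff F_coord_power F_multI[OF F_coord E2_form]) simp
    qed (use wE2 in auto)
    then have y: "v $ 3 = 0" using True by auto
    have "v $ 1 * EE v - v $ 4 ^ (q ^ 3 + 1) = 0"
    proof (rule zero)
      show "(\<lambda>v. v $ 1 * EE v - v $ 4 ^ (q ^ 3 + 1)) \<in> forms UNIV (q ^ 3 + 1)"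
        by (intro forms_diff F_coord_power F_multI[OF F_coord EE_form]) simp
    qed (use wEE in auto)
    then have z: "v $ 4 = 0" using True by auto
    have eq: "v = (v $ 2) *s einf" using True y z by (simp add: vec4_eq_iff)
    then have "v $ 2 \<noteq> 0" using v(1) by auto
    then have "P = proj_class einf" using v(2) eq proj_class_scale by metis
    then show ?thesis by blast
  next
    case False
    define u where "u = (1 / v $ 1) *s v"
    have Pu: "P = proj_class u" unfolding u_def using v(2) False by (simp add: proj_class_scale)
    have zero': "g u = 0" if g: "g \<in> forms UNIV d" "\<And>u. u \<in> C \<Longrightarrow> g u = 0" for g d
      unfolding u_def using forms_homogeneous[OF g(1)] zero[OF g] by simp
    have u1: "u $ 1 = 1" using False by (simp add: u_def)
    have "u $ 1 * E2 u - u $ 3 ^ (q + 1) = 0"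
    proof (rule zero')
      show "(\<lambda>v. v $ 1 * E2 v - v $ 3 ^ (q + 1)) \<in> forms UNIV (q + 1)"
        by (intro forms_diff F_coord_power F_multI[OF F_coord E2_form]) simp
    qed (use wE2 in auto)
    then have 1: "u $ 3 ^ (q + 1) = u $ 2 ^ q + u $ 2" by (simp add: E2_def u1)
    have q2: "N + (q - 1) = q\<^sup>2" "1 + (q\<^sup>2 - 1) = q\<^sup>2"
      using N_q q_ge_2 by auto
    have "u $ 4 ^ N * u $ 1 ^ (q - 1) - (u $ 3 ^ q\<^sup>2 - u $ 3 * u $ 1 ^ (q\<^sup>2 - 1)) = 0"
    proof (rule zero')
      show "(\<lambda>v :: 'a ^ 4. v $ 4 ^ N * v $ 1 ^ (q - 1) - (v $ 3 ^ q\<^sup>2 - v $ 3 * v $ 1 ^ (q\<^sup>2 - 1))) \<in> forms UNIV (q\<^sup>2)"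
        by (intro forms_diff F_coord_power F_multI[OF F_coord_power F_coord_power q2(1)]
            F_multI[OF F_coord F_coord_power q2(2)])
    qed (simp add: C_D(1) C_D(3))
    then have 2: "u $ 4 ^ N = u $ 3 ^ q\<^sup>2 - u $ 3" by (simp add: u1)
    show ?thesis using Pu 1 2 u1 by (auto simp: C_def)
  qed
qed

lemma vanishes_on_curve:
  assumes F: "homogeneous4 d F"
  shows "vanishes_on XX F \<longleftrightarrow> (\<forall>v\<in>C. eval4 F v = 0)"
proof -
  have "eval4 F einf = 0" if "\<forall>v\<in>C. eval4 F v = 0"
    using form_eq_at[OF forms_eval4[OF F] F_zero, of einf] that by simp
  then show ?thesis unfolding curve_points vanishes_on_proj_class[OF F] by auto
qed

text \<open>The rational function \<open>\<phi> / \<psi>\<close> as an element of the function field.\<close>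

definition fr :: "('a ^ 4 \<Rightarrow> 'a) \<Rightarrow> ('a ^ 4 \<Rightarrow> 'a) \<Rightarrow> 'a rat_fun" where
  "fr \<phi> \<psi> = {(F, H). (F, H) \<in> fractions XX \<and> (\<forall>v\<in>C. eval4 F v * \<psi> v = \<phi> v * eval4 H v)}"

text \<open>Admissible numerators and denominators.\<close>

definition quotient_pair :: "nat \<Rightarrow> ('a ^ 4 \<Rightarrow> 'a) \<Rightarrow> ('a ^ 4 \<Rightarrow> 'a) \<Rightarrow> bool" where
  "quotient_pair d \<phi> \<psi> \<longleftrightarrow> \<phi> \<in> forms UNIV d \<and> \<psi> \<in> forms UNIV d \<and> nonvanishing \<psi>"

lemma fractionsE:
  assumes "(F, H) \<in> fractions XX"
  obtains d where "homogeneous4 d F" "homogeneous4 d H" "nonvanishing (eval4 H)"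
    "quotient_pair d (eval4 F) (eval4 H)"
proof -
  obtain d where d: "homogeneous4 d F" "homogeneous4 d H" "\<not> vanishes_on XX H"
    using assms unfolding fractions_def by blast
  then have "nonvanishing (eval4 H)" by (auto simp: vanishes_on_curve nonvanishing_def)
  then show thesis using d that by (simp add: quotient_pair_def forms_eval4)
qed

lemma fractionsI:
  "homogeneous4 d F \<Longrightarrow> homogeneous4 d H \<Longrightarrow> nonvanishing (eval4 H) \<Longrightarrow> (F, H) \<in> fractions XX"
  unfolding fractions_def by (auto simp: vanishes_on_curve nonvanishing_def)

lemma quotient_pairE:
  assumes "quotient_pair d \<phi> \<psi>"
  obtains F H where "homogeneous4 d F" "homogeneous4 d H" "\<phi> = eval4 F" "\<psi> = eval4 H"
    "(F, H) \<in> fractions XX"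
proof -
  obtain F H where 1: "homogeneous4 d F" "homogeneous4 d H" "\<phi> = eval4 F" "\<psi> = eval4 H"
    using assms by (auto simp: quotient_pair_def forms_def)
  then have "(F, H) \<in> fractions XX" using assms fractionsI by (simp add: quotient_pair_def)
  then show thesis using 1 that by blast
qed

lemma fr_class:
  assumes "(F, H) \<in> fractions XX"
  shows "fraction_rel XX `` {(F, H)} = fr (eval4 F) (eval4 H)"
proof -
  obtain d where d: "homogeneous4 d F" "homogeneous4 d H" using assms by (rule fractionsE)
  have "vanishes_on XX (F * H' - F' * H) \<longleftrightarrow> (\<forall>v\<in>C. eval4 F' v * eval4 H v = eval4 F v * eval4 H' v)"
    if FH': "(F', H') \<in> fractions XX" for F' H'
  proof -
    obtain d' where d': "homogeneous4 d' F'" "homogeneous4 d' H'" using FH' by (rule fractionsE)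
    have "homogeneous4 (d + d') (F * H' - F' * H)"
      using homogeneous4_mult[OF d(1) d'(2)] homogeneous4_mult[OF d'(1) d(2)]
      by (intro homogeneous4_diff) (simp_all add: add.commute)
    then show ?thesis by (auto simp: vanishes_on_curve eval4_diff eval4_mult)
  qed
  then show ?thesis using assms by (auto simp: fraction_rel_def fr_def)
qed

lemma fr_self: "(F, H) \<in> fractions XX \<Longrightarrow> (F, H) \<in> fr (eval4 F) (eval4 H)"
  by (simp add: fr_def)

lemma fr_eq_iff:
  assumes 1: "quotient_pair d \<phi> \<psi>" and 2: "quotient_pair d' \<phi>' \<psi>'"
  shows "fr \<phi> \<psi> = fr \<phi>' \<psi>' \<longleftrightarrow> (\<forall>v\<in>C. \<phi> v * \<psi>' v = \<phi>' v * \<psi> v)"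
proof
  assume eq: "fr \<phi> \<psi> = fr \<phi>' \<psi>'"
  obtain F H where FH: "\<phi> = eval4 F" "\<psi> = eval4 H" "(F, H) \<in> fractions XX" using 1 by (rule quotient_pairE)
  then have "(F, H) \<in> fr \<phi>' \<psi>'" using fr_self eq by metis
  then show "\<forall>v\<in>C. \<phi> v * \<psi>' v = \<phi>' v * \<psi> v" using FH by (simp add: fr_def)
next
  assume eq: "\<forall>v\<in>C. \<phi> v * \<psi>' v = \<phi>' v * \<psi> v"
  have aux: "(\<forall>v\<in>C. eval4 F v * \<psi>' v = \<phi>' v * eval4 H v)"
    if FH: "(F, H) \<in> fractions XX" "\<forall>v\<in>C. eval4 F v * \<psi> v = \<phi> v * eval4 H v"
      and p: "quotient_pair d \<phi> \<psi>" "quotient_pair d' \<phi>' \<psi>'" and eq: "\<forall>v\<in>C. \<phi> v * \<psi>' v = \<phi>' v * \<psi> v"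
    for F H \<phi> \<psi> \<phi>' \<psi>' d d'
  proof
    fix v assume v: "v \<in> C"
    obtain e where e: "quotient_pair e (eval4 F) (eval4 H)" using FH(1) by (rule fractionsE)
    have A: "(\<lambda>v. eval4 F v * \<psi>' v) \<in> forms UNIV (e + d')"
      using e p(2) by (intro F_mult) (auto simp: quotient_pair_def)
    have B: "(\<lambda>v. \<phi>' v * eval4 H v) \<in> forms UNIV (e + d')"
      using e p(2) unfolding quotient_pair_def by (intro F_multI[where a = d' and b = e]) auto
    show "eval4 F v * \<psi>' v = \<phi>' v * eval4 H v"
    proof (rule forms_cancel[OF _ _ A B _ v])
      show "\<psi> \<in> forms UNIV d" "nonvanishing \<psi>" using p by (auto simp: quotient_pair_def)
      fix v assume v: "v \<in> C"
      have "\<psi> v * (eval4 F v * \<psi>' v) = (eval4 F v * \<psi> v) * \<psi>' v" by (simp only: mult_ac)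
      also have "\<dots> = (\<phi> v * eval4 H v) * \<psi>' v" by (simp only: bspec[OF FH(2) v])
      also have "\<dots> = (\<phi> v * \<psi>' v) * eval4 H v" by (simp only: mult_ac)
      also have "\<dots> = (\<phi>' v * \<psi> v) * eval4 H v" by (simp only: bspec[OF eq v])
      finally show "\<psi> v * (eval4 F v * \<psi>' v) = \<psi> v * (\<phi>' v * eval4 H v)" by (simp only: mult_ac)
    qed
  qed
  have eq': "\<forall>v\<in>C. \<phi>' v * \<psi> v = \<phi> v * \<psi>' v" using eq by simp
  have "(F, H) \<in> fr \<phi> \<psi> \<longleftrightarrow> (F, H) \<in> fr \<phi>' \<psi>'" for F H
    using aux[OF _ _ 1 2 eq, of F H] aux[OF _ _ 2 1 eq', of F H] unfolding fr_def by blast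
  then show "fr \<phi> \<psi> = fr \<phi>' \<psi>'" by auto
qed

abbreviation FF :: "'a rat_fun ring" where "FF \<equiv> function_field XX"

lemma carrier_FF: "f \<in> carrier FF \<longleftrightarrow> (\<exists>d \<phi> \<psi>. quotient_pair d \<phi> \<psi> \<and> f = fr \<phi> \<psi>)"
proof
  assume "f \<in> carrier FF"
  then obtain F H where FH: "(F, H) \<in> fractions XX" "f = fraction_rel XX `` {(F, H)}"
    by (auto simp: function_field_def quotient_def)
  then show "\<exists>d \<phi> \<psi>. quotient_pair d \<phi> \<psi> \<and> f = fr \<phi> \<psi>"
    using fr_class fractionsE by metis
next
  assume "\<exists>d \<phi> \<psi>. quotient_pair d \<phi> \<psi> \<and> f = fr \<phi> \<psi>"
  then obtain d \<phi> \<psi> where "quotient_pair d \<phi> \<psi>" "f = fr \<phi> \<psi>" by blast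
  then obtain F H where "f = fr (eval4 F) (eval4 H)" "(F, H) \<in> fractions XX" by (metis quotient_pairE)
  then show "f \<in> carrier FF" using fr_class[of F H]
    by (auto simp: function_field_def quotient_def)
qed

lemma quotient_pair_mult:
  "quotient_pair d \<phi> \<psi> \<Longrightarrow> quotient_pair d' \<phi>' \<psi>' \<Longrightarrow>
    quotient_pair (d + d') (\<lambda>v. \<phi> v * \<phi>' v) (\<lambda>v. \<psi> v * \<psi>' v)"
  unfolding quotient_pair_def using F_mult forms_domain by blast

lemma mult_FF:
  assumes 1: "quotient_pair d \<phi> \<psi>" and 2: "quotient_pair d' \<phi>' \<psi>'"
  shows "fr \<phi> \<psi> \<otimes>\<^bsub>FF\<^esub> fr \<phi>' \<psi>' = fr (\<lambda>v. \<phi> v * \<phi>' v) (\<lambda>v. \<psi> v * \<psi>' v)"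
proof -
  let ?r = "fr (\<lambda>v. \<phi> v * \<phi>' v) (\<lambda>v. \<psi> v * \<psi>' v)"
  have cl: "fraction_rel XX `` {(F * F', H * H')} = ?r"
    if "(F, H) \<in> fr \<phi> \<psi>" "(F', H') \<in> fr \<phi>' \<psi>'" for F H F' H'
  proof -
    have FH: "(F, H) \<in> fractions XX" "(F', H') \<in> fractions XX"
      "\<And>v. v \<in> C \<Longrightarrow> eval4 F v * \<psi> v = \<phi> v * eval4 H v"
      "\<And>v. v \<in> C \<Longrightarrow> eval4 F' v * \<psi>' v = \<phi>' v * eval4 H' v" using that by (auto simp: fr_def)
    obtain e where e: "homogeneous4 e F" "homogeneous4 e H" "quotient_pair e (eval4 F) (eval4 H)"
      using FH(1) by (rule fractionsE)
    obtain e' where e': "homogeneous4 e' F'" "homogeneous4 e' H'" "quotient_pair e' (eval4 F') (eval4 H')"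
      using FH(2) by (rule fractionsE)
    have p: "quotient_pair (e + e') (eval4 (F * F')) (eval4 (H * H'))"
      using quotient_pair_mult[OF e(3) e'(3)] by (simp add: eval4_mult[abs_def])
    then have "(F * F', H * H') \<in> fractions XX"
      using homogeneous4_mult e e' by (intro fractionsI[of "e + e'"]) (auto simp: quotient_pair_def)
    then have "fraction_rel XX `` {(F * F', H * H')} = fr (eval4 (F * F')) (eval4 (H * H'))" by (rule fr_class)
    also have "\<dots> = ?r"
      unfolding fr_eq_iff[OF p quotient_pair_mult[OF 1 2]]
    proof
      fix v assume v: "v \<in> C"
      have "eval4 (F * F') v * (\<psi> v * \<psi>' v) = (eval4 F v * \<psi> v) * (eval4 F' v * \<psi>' v)"
        by (simp only: eval4_mult mult_ac)
      also have "\<dots> = (\<phi> v * eval4 H v) * (\<phi>' v * eval4 H' v)" by (simp only: FH(3)[OF v] FH(4)[OF v])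
      finally show "eval4 (F * F') v * (\<psi> v * \<psi>' v) = \<phi> v * \<phi>' v * eval4 (H * H') v"
        by (simp only: eval4_mult mult_ac)
    qed
    finally show ?thesis .
  qed
  obtain F H where ne: "(F, H) \<in> fr \<phi> \<psi>" using quotient_pairE[OF 1] fr_self by metis
  obtain F' H' where ne': "(F', H') \<in> fr \<phi>' \<psi>'" using quotient_pairE[OF 2] fr_self by metis
  have "fr \<phi> \<psi> \<otimes>\<^bsub>FF\<^esub> fr \<phi>' \<psi>' =
    (\<Union>(F, H)\<in>fr \<phi> \<psi>. \<Union>(F', H')\<in>fr \<phi>' \<psi>'. fraction_rel XX `` {(F * F', H * H')})"
    by (simp only: function_field_def monoid.select_convs)
  also have "\<dots> = ?r" using ne ne' cl by (rule UN_pair_const)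
  finally show ?thesis .
qed

lemma quotient_pair_one: "quotient_pair 0 (\<lambda>_. 1) (\<lambda>_. 1)" "quotient_pair 0 (\<lambda>_. 0) (\<lambda>_. 1)"
  using C_generic F_const F_zero by (auto simp: quotient_pair_def nonvanishing_def)

lemma one_FF: "\<one>\<^bsub>FF\<^esub> = fr (\<lambda>_. 1) (\<lambda>_. 1)"
proof -
  have "eval4 1 = (\<lambda>_. 1 :: 'a)" by auto
  moreover have "homogeneous4 0 (1 :: 'a poly4)" by (simp add: homogeneous4_def)
  ultimately show ?thesis
    using fr_class[of 1 1] fractionsI[of 0 1 1] quotient_pair_one(1)
    by (simp add: function_field_def quotient_pair_def)
qed

lemma zero_FF: "\<zero>\<^bsub>FF\<^esub> = fr (\<lambda>_. 0) (\<lambda>_. 1)"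
proof -
  have "eval4 1 = (\<lambda>_. 1 :: 'a)" "eval4 0 = (\<lambda>_. 0 :: 'a)" by auto
  moreover have "homogeneous4 0 (1 :: 'a poly4)" "homogeneous4 0 (0 :: 'a poly4)" by (simp_all add: homogeneous4_def)
  ultimately show ?thesis
    using fr_class[of 0 1] fractionsI[of 0 0 1] quotient_pair_one(1)
    by (simp add: function_field_def quotient_pair_def)
qed

lemma fr_zero_iff:
  assumes "quotient_pair d \<phi> \<psi>"
  shows "fr \<phi> \<psi> = \<zero>\<^bsub>FF\<^esub> \<longleftrightarrow> \<not> nonvanishing \<phi>"
  unfolding zero_FF fr_eq_iff[OF assms quotient_pair_one(2)] by (auto simp: nonvanishing_def)

lemma comm_monoid_FF: "comm_monoid FF"
proof (rule comm_monoidI)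
  fix f g assume "f \<in> carrier FF" "g \<in> carrier FF"
  then obtain d \<phi> \<psi> d' \<phi>' \<psi>' where 1: "quotient_pair d \<phi> \<psi>" "f = fr \<phi> \<psi>" and 2: "quotient_pair d' \<phi>' \<psi>'" "g = fr \<phi>' \<psi>'"
    unfolding carrier_FF by blast
  then show "f \<otimes>\<^bsub>FF\<^esub> g \<in> carrier FF"
    using quotient_pair_mult mult_FF unfolding carrier_FF by blast
  show "f \<otimes>\<^bsub>FF\<^esub> g = g \<otimes>\<^bsub>FF\<^esub> f"
    using 1 2 by (simp add: mult_FF mult.commute)
next
  show "\<one>\<^bsub>FF\<^esub> \<in> carrier FF" using one_FF quotient_pair_one unfolding carrier_FF by blast
next
  fix f g h assume "f \<in> carrier FF" "g \<in> carrier FF" "h \<in> carrier FF"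
  then obtain d \<phi> \<psi> d' \<phi>' \<psi>' d'' \<phi>'' \<psi>'' where 1: "quotient_pair d \<phi> \<psi>" "f = fr \<phi> \<psi>"
    and 2: "quotient_pair d' \<phi>' \<psi>'" "g = fr \<phi>' \<psi>'" and 3: "quotient_pair d'' \<phi>'' \<psi>''" "h = fr \<phi>'' \<psi>''"
    unfolding carrier_FF by blast
  show "f \<otimes>\<^bsub>FF\<^esub> g \<otimes>\<^bsub>FF\<^esub> h = f \<otimes>\<^bsub>FF\<^esub> (g \<otimes>\<^bsub>FF\<^esub> h)"
    using mult_FF[OF 1(1) 2(1)] mult_FF[OF 2(1) 3(1)] mult_FF[OF quotient_pair_mult[OF 1(1) 2(1)] 3(1)]
      mult_FF[OF 1(1) quotient_pair_mult[OF 2(1) 3(1)]] 1(2) 2(2) 3(2) by (simp add: mult.assoc)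
next
  fix f assume "f \<in> carrier FF"
  then obtain d \<phi> \<psi> where 1: "quotient_pair d \<phi> \<psi>" "f = fr \<phi> \<psi>" unfolding carrier_FF by blast
  then show "\<one>\<^bsub>FF\<^esub> \<otimes>\<^bsub>FF\<^esub> f = f"
    using mult_FF[OF quotient_pair_one(1) 1(1)] by (simp add: one_FF)
qed

lemma fr_inverse:
  assumes "quotient_pair d \<phi> \<psi>" "nonvanishing \<phi>"
  shows "quotient_pair d \<psi> \<phi>" "fr \<psi> \<phi> \<otimes>\<^bsub>FF\<^esub> fr \<phi> \<psi> = \<one>\<^bsub>FF\<^esub>"
proof -
  show q: "quotient_pair d \<psi> \<phi>" using assms by (auto simp: quotient_pair_def)
  show "fr \<psi> \<phi> \<otimes>\<^bsub>FF\<^esub> fr \<phi> \<psi> = \<one>\<^bsub>FF\<^esub>"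
    unfolding mult_FF[OF q assms(1)] one_FF fr_eq_iff[OF quotient_pair_mult[OF q assms(1)] quotient_pair_one(1)]
    by (simp add: mult.commute)
qed

lemma Units_FF: "quotient_pair d \<phi> \<psi> \<Longrightarrow> nonvanishing \<phi> \<Longrightarrow> fr \<phi> \<psi> \<in> Units FF"
proof -
  assume a: "quotient_pair d \<phi> \<psi>" "nonvanishing \<phi>"
  interpret comm_monoid FF by (rule comm_monoid_FF)
  have "fr \<phi> \<psi> \<in> carrier FF" "fr \<psi> \<phi> \<in> carrier FF" using a fr_inverse(1)[OF a] carrier_FF by blast+
  then show ?thesis using fr_inverse(2)[OF a] m_comm[of "fr \<phi> \<psi>" "fr \<psi> \<phi>"] unfolding Units_def
    by (intro CollectI conjI bexI[of _ "fr \<psi> \<phi>"]) simp_all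
qed

section \<open>Local rings and orders\<close>

lemma nonvanishing_at:
  assumes "\<psi> \<in> forms UNIV d" "e \<in> insert einf C" "\<psi> e \<noteq> 0"
  shows "nonvanishing \<psi>"
proof (rule ccontr)
  assume "\<not> nonvanishing \<psi>"
  then have "\<psi> v = 0" if "v \<in> C" for v using that by (auto simp: nonvanishing_def)
  then show False using form_eq_at[OF assms(1) F_zero _ assms(2)] assms(3) by blast
qed

lemma local_ring_iff:
  assumes e: "e \<in> insert einf C"
  shows "f \<in> local_ring XX (proj_class e) \<longleftrightarrow>
    (\<exists>d \<phi> \<psi>. quotient_pair d \<phi> \<psi> \<and> \<psi> e \<noteq> 0 \<and> f = fr \<phi> \<psi>)"
proof
  assume f: "f \<in> local_ring XX (proj_class e)"
  then obtain F H where FH: "(F, H) \<in> f" "\<not> vanishes_on {proj_class e} H" "f \<in> carrier FF"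
    unfolding local_ring_def by blast
  obtain d \<phi> \<psi> where 1: "quotient_pair d \<phi> \<psi>" "f = fr \<phi> \<psi>" using FH(3) carrier_FF by blast
  then have fr: "(F, H) \<in> fractions XX" "\<forall>v\<in>C. eval4 F v * \<psi> v = \<phi> v * eval4 H v" using FH(1) by (auto simp: fr_def)
  then obtain d' where d': "homogeneous4 d' H" "quotient_pair d' (eval4 F) (eval4 H)" by (metis fractionsE)
  have "eval4 H e \<noteq> 0" using FH(2) d'(1) by (simp add: vanishes_on_point)
  moreover have "f = fr (eval4 F) (eval4 H)" using fr_eq_iff[OF d'(2) 1(1)] fr(2) 1(2) by simp
  ultimately show "\<exists>d \<phi> \<psi>. quotient_pair d \<phi> \<psi> \<and> \<psi> e \<noteq> 0 \<and> f = fr \<phi> \<psi>" using d'(2) by blast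
next
  assume "\<exists>d \<phi> \<psi>. quotient_pair d \<phi> \<psi> \<and> \<psi> e \<noteq> 0 \<and> f = fr \<phi> \<psi>"
  then obtain d \<phi> \<psi> where 1: "quotient_pair d \<phi> \<psi>" "\<psi> e \<noteq> 0" "f = fr \<phi> \<psi>" by blast
  from 1(1) obtain F H where FH: "homogeneous4 d F" "homogeneous4 d H" "\<phi> = eval4 F" "\<psi> = eval4 H" "(F, H) \<in> fractions XX"
    by (rule quotient_pairE)
  have "(F, H) \<in> f" using fr_self[OF FH(5)] FH(3,4) 1(3) by simp
  moreover have "\<not> vanishes_on {proj_class e} H" using FH(2,4) 1(2) by (simp add: vanishes_on_point)
  moreover have "f \<in> carrier FF" using 1 carrier_FF by blast
  ultimately show "f \<in> local_ring XX (proj_class e)" unfolding local_ring_def by blast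
qed

lemma value_at_fr:
  assumes e: "e \<in> insert einf C" and p: "quotient_pair d \<phi> \<psi>" "\<psi> e \<noteq> 0"
  shows "value_at (fr \<phi> \<psi>) (proj_class e) = \<phi> e / \<psi> e"
  unfolding value_at_def
proof (rule the_equality)
  obtain F H where FH: "\<phi> = eval4 F" "\<psi> = eval4 H" "(F, H) \<in> fractions XX" using p(1) by (rule quotient_pairE)
  show "\<exists>(F, H)\<in>fr \<phi> \<psi>. \<exists>v\<in>proj_class e. eval4 H v \<noteq> 0 \<and> \<phi> e / \<psi> e = eval4 F v / eval4 H v"
    using fr_self[OF FH(3)] FH(1,2) p(2) proj_class_self by (intro bexI[of _ "(F, H)"]) auto
next
  fix a assume "\<exists>(F, H)\<in>fr \<phi> \<psi>. \<exists>v\<in>proj_class e. eval4 H v \<noteq> 0 \<and> a = eval4 F v / eval4 H v"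
  then obtain F H v where FH: "(F, H) \<in> fr \<phi> \<psi>" "v \<in> proj_class e" "eval4 H v \<noteq> 0" "a = eval4 F v / eval4 H v" by auto
  then have fr: "(F, H) \<in> fractions XX" "\<And>v. v \<in> C \<Longrightarrow> eval4 F v * \<psi> v = \<phi> v * eval4 H v" by (auto simp: fr_def)
  obtain d' where d': "quotient_pair d' (eval4 F) (eval4 H)" using fr(1) by (rule fractionsE)
  obtain c where c: "c \<noteq> 0" "v = c *s e" using FH(2) by (auto simp: proj_class_def)
  have f: "eval4 F \<in> forms UNIV d'" "eval4 H \<in> forms UNIV d'" "\<phi> \<in> forms UNIV d" "\<psi> \<in> forms UNIV d"
    using d' p(1) by (auto simp: quotient_pair_def)
  have h: "eval4 F v = c ^ d' * eval4 F e" "eval4 H v = c ^ d' * eval4 H e"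
    unfolding c(2) by (rule forms_homogeneous[OF f(1)], rule forms_homogeneous[OF f(2)])
  have eq: "eval4 F e * \<psi> e = \<phi> e * eval4 H e"
    by (rule form_eq_at[OF F_mult[OF f(1) f(4)] F_multI[OF f(3) f(2) add.commute] fr(2) e])
  have "eval4 H e \<noteq> 0" using h(2) FH(3) by auto
  then show "a = \<phi> e / \<psi> e"
    using FH(4) c(1) p(2) eq by (simp add: h frac_eq_eq)
qed

lemma max_ideal_iff:
  assumes e: "e \<in> insert einf C"
  shows "f \<in> max_ideal XX (proj_class e) \<longleftrightarrow>
    (\<exists>d \<phi> \<psi>. quotient_pair d \<phi> \<psi> \<and> \<psi> e \<noteq> 0 \<and> \<phi> e = 0 \<and> f = fr \<phi> \<psi>)"
proof -
  have "\<phi> e = 0" if "quotient_pair d \<phi> \<psi>" "\<psi> e \<noteq> 0" "value_at (fr \<phi> \<psi>) (proj_class e) = 0" for d \<phi> \<psi>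
    using value_at_fr[OF e that(1,2)] that by simp
  moreover have "value_at (fr \<phi> \<psi>) (proj_class e) = 0" if "quotient_pair d \<phi> \<psi>" "\<psi> e \<noteq> 0" "\<phi> e = 0" for d \<phi> \<psi>
    using value_at_fr[OF e that(1,2)] that by simp
  ultimately show ?thesis unfolding max_ideal_def mem_Collect_eq local_ring_iff[OF e] by metis
qed

lemma local_unit_iff:
  assumes e: "e \<in> insert einf C"
  shows "f \<in> local_ring XX (proj_class e) - max_ideal XX (proj_class e) \<longleftrightarrow>
    (\<exists>d \<phi> \<psi>. quotient_pair d \<phi> \<psi> \<and> \<psi> e \<noteq> 0 \<and> \<phi> e \<noteq> 0 \<and> f = fr \<phi> \<psi>)"
proof -
  have "value_at (fr \<phi> \<psi>) (proj_class e) = 0 \<longleftrightarrow> \<phi> e = 0" if "quotient_pair d \<phi> \<psi>" "\<psi> e \<noteq> 0" for d \<phi> \<psi>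
    using value_at_fr[OF e that] that by simp
  then show ?thesis unfolding max_ideal_def Diff_iff mem_Collect_eq local_ring_iff[OF e] by metis
qed

end

lemma uniformizerD:
  assumes "uniformizer \<X> P t"
  shows "t \<in> max_ideal \<X> P"
    and "f \<in> max_ideal \<X> P \<Longrightarrow> \<exists>r\<in>local_ring \<X> P. f = r \<otimes>\<^bsub>function_field \<X>\<^esub> t"
proof -
  have u: "t \<in> max_ideal \<X> P" "max_ideal \<X> P = {r \<otimes>\<^bsub>function_field \<X>\<^esub> t | r. r \<in> local_ring \<X> P}"
    using assms unfolding uniformizer_def by (rule conjunct1, rule conjunct2)
  show "t \<in> max_ideal \<X> P" by (rule u(1))
  assume "f \<in> max_ideal \<X> P"
  then have "f \<in> {r \<otimes>\<^bsub>function_field \<X>\<^esub> t | r. r \<in> local_ring \<X> P}" by (simp only: u(2)[symmetric])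
  then show "\<exists>r\<in>local_ring \<X> P. f = r \<otimes>\<^bsub>function_field \<X>\<^esub> t" by blast
qed

context gk
begin

lemma quotient_pair_power:
  assumes "quotient_pair d \<phi> \<psi>"
  shows "quotient_pair (k * d) (\<lambda>v. \<phi> v ^ k) (\<lambda>v. \<psi> v ^ k)"
proof (induction k)
  case 0
  then show ?case using quotient_pair_one(1) by simp
next
  case (Suc k)
  show ?case using quotient_pair_mult[OF assms Suc] by simp
qed

lemma fr_power:
  assumes "quotient_pair d \<phi> \<psi>"
  shows "fr \<phi> \<psi> [^]\<^bsub>FF\<^esub> (k::nat) = fr (\<lambda>v. \<phi> v ^ k) (\<lambda>v. \<psi> v ^ k)"
proof (induction k)
  case 0
  then show ?case by (simp add: one_FF)
next
  case (Suc k)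
  have "fr \<phi> \<psi> [^]\<^bsub>FF\<^esub> Suc k = fr \<phi> \<psi> [^]\<^bsub>FF\<^esub> k \<otimes>\<^bsub>FF\<^esub> fr \<phi> \<psi>" by simp
  also have "\<dots> = fr (\<lambda>v. \<phi> v ^ k * \<phi> v) (\<lambda>v. \<psi> v ^ k * \<psi> v)"
    unfolding Suc by (rule mult_FF[OF quotient_pair_power[OF assms] assms])
  finally show ?case by (simp add: mult.commute)
qed

lemma fr_eqI:
  assumes "quotient_pair d \<phi> \<psi>" "quotient_pair d' \<phi>' \<psi>'" "\<And>v. v \<in> C \<Longrightarrow> \<phi> v * \<psi>' v = \<phi>' v * \<psi> v"
  shows "fr \<phi> \<psi> = fr \<phi>' \<psi>'"
  using fr_eq_iff[OF assms(1,2)] assms(3) by blast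

context
  fixes e :: "'a ^ 4" and s :: 4 and T :: "'a ^ 4 \<Rightarrow> 'a"
  assumes lp: "local_param e s T"
begin

lemma lp_point: "e \<in> insert einf C" "e $ s = 1"
  and lp_T: "T \<in> forms UNIV 1" "T e = 0" "nonvanishing T"
  and lp_s: "nonvanishing (\<lambda>v. v $ s)"
  using lp by (auto simp: local_param_def)

lemma lp_div:
  assumes "\<phi> \<in> forms UNIV d" "\<phi> e = 0"
  obtains a b h g where "h \<in> forms UNIV a" "g \<in> forms UNIV b"
        "d + a = Suc b" "h e \<noteq> 0" "\<forall>v\<in>C. \<phi> v * h v = T v * g v"
  using lp assms unfolding local_param_def by blast

lemma lp_factors:
  assumes "\<phi> \<in> forms UNIV d" "nonvanishing \<phi>"
  obtains n where "factors e T d \<phi> n"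
  using lp assms unfolding local_param_def by blast

text \<open>The local parameter as a rational function.\<close>

definition tt :: "'a rat_fun" where "tt = fr T (\<lambda>v. v $ s)"

lemma tt_pair: "quotient_pair 1 T (\<lambda>v. v $ s)"
  using lp_T lp_s F_coord by (simp add: quotient_pair_def)

lemma tt_pow: "tt [^]\<^bsub>FF\<^esub> (k::nat) = fr (\<lambda>v. T v ^ k) (\<lambda>v. v $ s ^ k)"
  and tt_pow_pair: "quotient_pair k (\<lambda>v. T v ^ k) (\<lambda>v. v $ s ^ k)"
  using fr_power[OF tt_pair, of k] quotient_pair_power[OF tt_pair, of k] by (simp_all add: tt_def)

abbreviation LR :: "'a rat_fun set" where "LR \<equiv> local_ring XX (proj_class e)"
abbreviation MI :: "'a rat_fun set" where "MI \<equiv> max_ideal XX (proj_class e)"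

lemma qp_nonvan:
  assumes "\<phi> \<in> forms UNIV d" "\<psi> \<in> forms UNIV d" "\<psi> e \<noteq> 0"
  shows "quotient_pair d \<phi> \<psi>"
  using assms nonvanishing_at[OF assms(2) lp_point(1) assms(3)] by (simp add: quotient_pair_def)

lemma tt_uniformizer: "uniformizer XX (proj_class e) tt"
proof -
  have "tt \<in> MI" unfolding max_ideal_iff[OF lp_point(1)] tt_def
    using tt_pair lp_T(2) lp_point(2) by (intro exI[of _ 1] exI[of _ T] exI[of _ "\<lambda>v. v $ s"]) simp
  moreover have "f \<in> {r \<otimes>\<^bsub>FF\<^esub> tt | r. r \<in> LR}" if f: "f \<in> MI" for f
  proof -
    obtain d \<phi> \<psi> where 1: "quotient_pair d \<phi> \<psi>" "\<psi> e \<noteq> 0" "\<phi> e = 0" "f = fr \<phi> \<psi>"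
      using f unfolding max_ideal_iff[OF lp_point(1)] by blast
    have F: "\<phi> \<in> forms UNIV d" "\<psi> \<in> forms UNIV d" using 1(1) by (auto simp: quotient_pair_def)
    obtain a b h g where h: "h \<in> forms UNIV a" "g \<in> forms UNIV b" "d + a = Suc b" "h e \<noteq> 0"
      "\<forall>v\<in>C. \<phi> v * h v = T v * g v" using F(1) 1(3) by (rule lp_div)
    have p: "quotient_pair (d + a) (\<lambda>v. g v * v $ s) (\<lambda>v. \<psi> v * h v)"
      using h(3) 1(2) h(4) by (intro qp_nonvan F_multI[OF h(2) F_coord] F_mult[OF F(2) h(1)]) simp_all
    have "fr (\<lambda>v. g v * v $ s) (\<lambda>v. \<psi> v * h v) \<otimes>\<^bsub>FF\<^esub> tt =
       fr (\<lambda>v. g v * v $ s * T v) (\<lambda>v. \<psi> v * h v * v $ s)"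
      unfolding tt_def by (rule mult_FF[OF p tt_pair])
    also have "\<dots> = f" unfolding 1(4)
    proof (rule fr_eqI[OF quotient_pair_mult[OF p tt_pair] 1(1)])
      fix v assume v: "v \<in> C"
      have "g v * v $ s * T v * \<psi> v = (T v * g v) * (v $ s * \<psi> v)" by (simp only: mult_ac)
      also have "\<dots> = (\<phi> v * h v) * (v $ s * \<psi> v)" by (simp only: bspec[OF h(5) v])
      finally show "g v * v $ s * T v * \<psi> v = \<phi> v * (\<psi> v * h v * v $ s)" by (simp only: mult_ac)
    qed
    finally have "f = fr (\<lambda>v. g v * v $ s) (\<lambda>v. \<psi> v * h v) \<otimes>\<^bsub>FF\<^esub> tt" by (rule sym)
    moreover have "fr (\<lambda>v. g v * v $ s) (\<lambda>v. \<psi> v * h v) \<in> LR"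
      unfolding local_ring_iff[OF lp_point(1)] using p 1(2) h(4)
      by (intro exI[of _ "d + a"] exI[of _ "\<lambda>v. g v * v $ s"] exI[of _ "\<lambda>v. \<psi> v * h v"]) simp
    ultimately show ?thesis by blast
  qed
  moreover have "r \<otimes>\<^bsub>FF\<^esub> tt \<in> MI" if r: "r \<in> LR" for r
  proof -
    obtain d \<phi> \<psi> where 1: "quotient_pair d \<phi> \<psi>" "\<psi> e \<noteq> 0" "r = fr \<phi> \<psi>"
      using r unfolding local_ring_iff[OF lp_point(1)] by blast
    have "r \<otimes>\<^bsub>FF\<^esub> tt = fr (\<lambda>v. \<phi> v * T v) (\<lambda>v. \<psi> v * v $ s)"
      unfolding 1(3) tt_def by (rule mult_FF[OF 1(1) tt_pair])
    then show ?thesis unfolding max_ideal_iff[OF lp_point(1)]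
      using quotient_pair_mult[OF 1(1) tt_pair] 1(2) lp_T(2) lp_point(2)
      by (intro exI[of _ "d + 1"] exI[of _ "\<lambda>v. \<phi> v * T v"] exI[of _ "\<lambda>v. \<psi> v * v $ s"]) simp
  qed
  ultimately show ?thesis unfolding uniformizer_def by (intro conjI equalityI subsetI) auto
qed

lemma max_ideal_absorb:
  assumes "r \<in> LR" "f \<in> MI"
  shows "r \<otimes>\<^bsub>FF\<^esub> f \<in> MI"
proof -
  obtain d \<phi> \<psi> where 1: "quotient_pair d \<phi> \<psi>" "\<psi> e \<noteq> 0" "r = fr \<phi> \<psi>"
    using assms(1) unfolding local_ring_iff[OF lp_point(1)] by blast
  obtain d' \<phi>' \<psi>' where 2: "quotient_pair d' \<phi>' \<psi>'" "\<psi>' e \<noteq> 0" "\<phi>' e = 0" "f = fr \<phi>' \<psi>'"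
    using assms(2) unfolding max_ideal_iff[OF lp_point(1)] by blast
  have "r \<otimes>\<^bsub>FF\<^esub> f = fr (\<lambda>v. \<phi> v * \<phi>' v) (\<lambda>v. \<psi> v * \<psi>' v)"
    unfolding 1(3) 2(4) by (rule mult_FF[OF 1(1) 2(1)])
  then show ?thesis unfolding max_ideal_iff[OF lp_point(1)]
    using quotient_pair_mult[OF 1(1) 2(1)] 1(2) 2(2,3)
    by (intro exI[of _ "d + d'"] exI[of _ "\<lambda>v. \<phi> v * \<phi>' v"] exI[of _ "\<lambda>v. \<psi> v * \<psi>' v"]) simp
qed

lemma one_not_max: "\<one>\<^bsub>FF\<^esub> \<notin> MI"
proof -
  have "\<one>\<^bsub>FF\<^esub> \<in> LR - MI" unfolding local_unit_iff[OF lp_point(1)] one_FF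
    using quotient_pair_one(1)
    by (intro exI[of _ 0] exI[of _ "\<lambda>_. 1 :: 'a"]) simp
  then show ?thesis by blast
qed

lemma local_units_subgroup: "subgroup (LR - MI) (units_of FF)"
proof -
  interpret comm_monoid FF by (rule comm_monoid_FF)
  interpret G: comm_group "units_of FF" by (rule units_comm_group)
  note iff = local_unit_iff[OF lp_point(1)]
  have nv: "nonvanishing \<phi>" if "quotient_pair d \<phi> \<psi>" "\<phi> e \<noteq> 0" for d \<phi> \<psi>
    using that nonvanishing_at[OF _ lp_point(1)] by (auto simp: quotient_pair_def)
  show ?thesis
  proof (rule G.subgroupI)
    show "LR - MI \<subseteq> carrier (units_of FF)"
    proof
      fix f assume "f \<in> LR - MI"
      then obtain d \<phi> \<psi> where 1: "quotient_pair d \<phi> \<psi>" "\<phi> e \<noteq> 0" "f = fr \<phi> \<psi>" unfolding iff by blast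
      then show "f \<in> carrier (units_of FF)" using Units_FF nv by (simp add: units_of_carrier)
    qed
    have "\<one>\<^bsub>FF\<^esub> \<in> LR - MI" unfolding iff one_FF
      using quotient_pair_one(1) by (intro exI[of _ 0] exI[of _ "\<lambda>_. 1 :: 'a"]) simp
    then show "LR - MI \<noteq> {}" by blast
  next
    fix f assume "f \<in> LR - MI"
    then obtain d \<phi> \<psi> where 1: "quotient_pair d \<phi> \<psi>" "\<psi> e \<noteq> 0" "\<phi> e \<noteq> 0" "f = fr \<phi> \<psi>" unfolding iff by blast
    note i = fr_inverse[OF 1(1) nv[OF 1(1,3)]]
    have "inv\<^bsub>units_of FF\<^esub> f = fr \<psi> \<phi>"
      using i(2) Units_FF[OF 1(1) nv[OF 1(1,3)]] Units_FF[OF i(1)] 1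
      by (intro G.inv_equality) (auto simp: units_of_carrier units_of_mult units_of_one quotient_pair_def)
    then show "inv\<^bsub>units_of FF\<^esub> f \<in> LR - MI" unfolding iff using i(1) 1(2,3)
      by (intro exI[of _ d] exI[of _ \<psi>] exI[of _ \<phi>]) simp
  next
    fix f g assume "f \<in> LR - MI" "g \<in> LR - MI"
    then obtain d \<phi> \<psi> d' \<phi>' \<psi>' where 1: "quotient_pair d \<phi> \<psi>" "\<psi> e \<noteq> 0" "\<phi> e \<noteq> 0" "f = fr \<phi> \<psi>"
      and 2: "quotient_pair d' \<phi>' \<psi>'" "\<psi>' e \<noteq> 0" "\<phi>' e \<noteq> 0" "g = fr \<phi>' \<psi>'" unfolding iff by blast
    have "f \<otimes>\<^bsub>units_of FF\<^esub> g = fr (\<lambda>v. \<phi> v * \<phi>' v) (\<lambda>v. \<psi> v * \<psi>' v)"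
      unfolding 1(4) 2(4) units_of_mult by (rule mult_FF[OF 1(1) 2(1)])
    then show "f \<otimes>\<^bsub>units_of FF\<^esub> g \<in> LR - MI" unfolding iff
      using quotient_pair_mult[OF 1(1) 2(1)] 1(2,3) 2(2,3)
      by (intro exI[of _ "d + d'"] exI[of _ "\<lambda>v. \<phi> v * \<phi>' v"] exI[of _ "\<lambda>v. \<psi> v * \<psi>' v"]) simp
  qed
qed

lemma tt_unit: "tt \<in> Units FF"
  unfolding tt_def using Units_FF[OF tt_pair lp_T(3)] .

lemma tt_pow_max: "0 < (k::nat) \<Longrightarrow> tt [^]\<^bsub>FF\<^esub> k \<in> MI"
  unfolding tt_pow max_ideal_iff[OF lp_point(1)]
  using tt_pow_pair[of k] lp_T(2) lp_point(2)
  by (intro exI[of _ k] exI[of _ "\<lambda>v. T v ^ k"] exI[of _ "\<lambda>v. v $ s ^ k"]) simp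

lemma tt_int_pow_unit:
  assumes "tt [^]\<^bsub>units_of FF\<^esub> (k::int) \<in> LR - MI"
  shows "k = 0"
proof -
  interpret comm_monoid FF by (rule comm_monoid_FF)
  interpret G: comm_group "units_of FF" by (rule units_comm_group)
  have c: "tt \<in> carrier (units_of FF)" using tt_unit by (simp add: units_of_carrier)
  have pos: False if "tt [^]\<^bsub>units_of FF\<^esub> (int n) \<in> LR - MI" "0 < n" for n
    using that tt_pow_max[OF that(2)] units_of_int_pow[OF tt_unit, of "int n"] by (simp add: int_pow_int)
  show ?thesis
  proof (rule ccontr)
    assume k: "k \<noteq> 0"
    show False
    proof (cases "k > 0")
      case True
      then show False using pos[of "nat k"] assms by simp
    next
      case False
      have "inv\<^bsub>units_of FF\<^esub> (tt [^]\<^bsub>units_of FF\<^esub> k) \<in> LR - MI"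
        by (rule subgroup.m_inv_closed[OF local_units_subgroup assms])
      then have "tt [^]\<^bsub>units_of FF\<^esub> (- k) \<in> LR - MI" using c by (simp add: G.int_pow_neg)
      then show False using pos[of "nat (- k)"] False k by simp
    qed
  qed
qed

lemma ord_at_eq:
  assumes u: "u \<in> LR - MI" and f: "f = u \<otimes>\<^bsub>FF\<^esub> (tt [^]\<^bsub>FF\<^esub> (n::int))"
  shows "ord_at XX (proj_class e) f = n"
  unfolding ord_at_def
proof (rule the_equality)
  show "\<exists>t u. uniformizer XX (proj_class e) t \<and> u \<in> LR - MI \<and> f = u \<otimes>\<^bsub>FF\<^esub> (t [^]\<^bsub>FF\<^esub> n)"
    using tt_uniformizer u f by blast
next
  fix k :: int
  assume "\<exists>t u. uniformizer XX (proj_class e) t \<and> u \<in> LR - MI \<and> f = u \<otimes>\<^bsub>FF\<^esub> (t [^]\<^bsub>FF\<^esub> k)"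
  then obtain t u' where t: "uniformizer XX (proj_class e) t" "u' \<in> LR - MI" "f = u' \<otimes>\<^bsub>FF\<^esub> (t [^]\<^bsub>FF\<^esub> k)" by blast
  interpret comm_monoid FF by (rule comm_monoid_FF)
  interpret G: comm_group "units_of FF" by (rule units_comm_group)
  have OOc: "r \<in> carrier FF" if "r \<in> LR" for r using that by (simp add: local_ring_def)
  obtain r where r: "r \<in> LR" "t = r \<otimes>\<^bsub>FF\<^esub> tt"
    using uniformizerD(2)[OF tt_uniformizer uniformizerD(1)[OF t(1)]] by blast
  obtain r' where r': "r' \<in> LR" "tt = r' \<otimes>\<^bsub>FF\<^esub> t"
    using uniformizerD(2)[OF t(1) uniformizerD(1)[OF tt_uniformizer]] by blast
  have c: "r \<in> carrier FF" "r' \<in> carrier FF" "tt \<in> carrier FF" using r(1) r'(1) OOc tt_unit by (auto simp: Units_closed)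
  have "\<one>\<^bsub>FF\<^esub> \<otimes>\<^bsub>FF\<^esub> tt = r' \<otimes>\<^bsub>FF\<^esub> r \<otimes>\<^bsub>FF\<^esub> tt" using r'(2) r(2) c by (simp add: m_assoc)
  moreover have "tt \<otimes>\<^bsub>FF\<^esub> \<one>\<^bsub>FF\<^esub> = tt \<otimes>\<^bsub>FF\<^esub> (r' \<otimes>\<^bsub>FF\<^esub> r)"
    using calculation c by (simp add: m_comm)
  ultimately have rr: "r' \<otimes>\<^bsub>FF\<^esub> r = \<one>\<^bsub>FF\<^esub>"
    using Units_l_cancel[OF tt_unit one_closed m_closed[OF c(2,1)]] by simp
  then have "r \<notin> MI" using max_ideal_absorb[OF r'(1), of r] one_not_max by auto
  then have rU: "r \<in> LR - MI" using r(1) by blast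
  have units: "r \<in> Units FF" "u \<in> Units FF" "u' \<in> Units FF"
    using subgroup.subset[OF local_units_subgroup] rU u t(2) by (auto simp: units_of_carrier)
  have tU: "t \<in> Units FF" unfolding r(2) using units tt_unit by simp
  have "u' \<otimes>\<^bsub>units_of FF\<^esub> ((r \<otimes>\<^bsub>units_of FF\<^esub> tt) [^]\<^bsub>units_of FF\<^esub> k) = u \<otimes>\<^bsub>units_of FF\<^esub> (tt [^]\<^bsub>units_of FF\<^esub> n)"
    using t(3) f units_of_int_pow[OF tU, of k] units_of_int_pow[OF tt_unit, of n]
    by (simp add: units_of_mult r(2))
  then show "k = n"
    using G.exponent_unique[OF local_units_subgroup _ tt_int_pow_unit rU t(2) u] tt_unit
    by (simp add: units_of_carrier)
qed

lemma fr_decompose: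
  assumes p: "quotient_pair d \<phi> \<psi>" and nz: "nonvanishing \<phi>"
  obtains u n where "u \<in> LR - MI" "fr \<phi> \<psi> = u \<otimes>\<^bsub>FF\<^esub> (tt [^]\<^bsub>FF\<^esub> (n::int))"
proof -
  interpret comm_monoid FF by (rule comm_monoid_FF)
  interpret G: comm_group "units_of FF" by (rule units_comm_group)
  have F: "\<phi> \<in> forms UNIV d" "\<psi> \<in> forms UNIV d" "nonvanishing \<psi>" using p by (auto simp: quotient_pair_def)
  obtain n where n: "factors e T d \<phi> n" using lp_factors[OF F(1) nz] .
  obtain n' where n': "factors e T d \<psi> n'" using lp_factors[OF F(2,3)] .
  obtain a b h g where 1: "h \<in> forms UNIV a" "g \<in> forms UNIV b" "d + a = n + b" "h e \<noteq> 0" "g e \<noteq> 0"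
    "\<And>v. v \<in> C \<Longrightarrow> \<phi> v * h v = T v ^ n * g v" using n unfolding factors_def by blast
  obtain a' b' h' g' where 2: "h' \<in> forms UNIV a'" "g' \<in> forms UNIV b'" "d + a' = n' + b'" "h' e \<noteq> 0" "g' e \<noteq> 0"
    "\<And>v. v \<in> C \<Longrightarrow> \<psi> v * h' v = T v ^ n' * g' v" using n' unfolding factors_def by blast
  let ?\<phi> = "\<lambda>v. g v * h' v * v $ s ^ n" and ?\<psi> = "\<lambda>v. g' v * h v * v $ s ^ n'"
  have q: "quotient_pair (d + a + a') ?\<phi> ?\<psi>"
  proof (rule qp_nonvan)
    show "?\<phi> \<in> forms UNIV (d + a + a')"
      by (rule F_multI[OF F_mult[OF 1(2) 2(1)] F_coord_power]) (use 1(3) in simp)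
    show "?\<psi> \<in> forms UNIV (d + a + a')"
      by (rule F_multI[OF F_mult[OF 2(2) 1(1)] F_coord_power]) (use 2(3) in simp)
    show "?\<psi> e \<noteq> 0" using 1 2 lp_point(2) by simp
  qed
  let ?u = "fr ?\<phi> ?\<psi>"
  have uU: "?u \<in> LR - MI" unfolding local_unit_iff[OF lp_point(1)]
    using q 1(4,5) 2(4,5) lp_point(2) by (intro exI[of _ "d + a + a'"] exI[of _ ?\<phi>] exI[of _ ?\<psi>]) simp
  have eq: "?u \<otimes>\<^bsub>FF\<^esub> tt [^]\<^bsub>FF\<^esub> n = fr \<phi> \<psi> \<otimes>\<^bsub>FF\<^esub> tt [^]\<^bsub>FF\<^esub> n'"
    unfolding tt_pow mult_FF[OF q tt_pow_pair] mult_FF[OF p tt_pow_pair]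
  proof (rule fr_eqI[OF quotient_pair_mult[OF q tt_pow_pair] quotient_pair_mult[OF p tt_pow_pair]])
    fix v assume v: "v \<in> C"
    have "g v * h' v * v $ s ^ n * T v ^ n * (\<psi> v * v $ s ^ n')
      = (T v ^ n * g v) * (\<psi> v * h' v) * (v $ s ^ n * v $ s ^ n')" by (simp only: mult_ac)
    also have "\<dots> = (\<phi> v * h v) * (T v ^ n' * g' v) * (v $ s ^ n * v $ s ^ n')"
      by (simp only: 1(6)[OF v] 2(6)[OF v])
    finally show "g v * h' v * v $ s ^ n * T v ^ n * (\<psi> v * v $ s ^ n') =
      \<phi> v * T v ^ n' * (g' v * h v * v $ s ^ n' * v $ s ^ n)" by (simp only: mult_ac)
  qed
  have U: "?u \<in> carrier (units_of FF)" "fr \<phi> \<psi> \<in> carrier (units_of FF)" "tt \<in> carrier (units_of FF)"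
    using subgroup.subset[OF local_units_subgroup] uU Units_FF[OF p nz] tt_unit by (auto simp: units_of_carrier)
  let ?G = "units_of FF"
  have eq': "?u \<otimes>\<^bsub>?G\<^esub> tt [^]\<^bsub>?G\<^esub> (int n) = fr \<phi> \<psi> \<otimes>\<^bsub>?G\<^esub> tt [^]\<^bsub>?G\<^esub> (int n')"
    using eq tt_unit by (simp add: units_of_mult units_of_pow units_of_int_pow int_pow_int)
  have "fr \<phi> \<psi> = fr \<phi> \<psi> \<otimes>\<^bsub>?G\<^esub> tt [^]\<^bsub>?G\<^esub> (int n') \<otimes>\<^bsub>?G\<^esub> inv\<^bsub>?G\<^esub> (tt [^]\<^bsub>?G\<^esub> (int n'))"
    using U G.int_pow_closed[OF U(3), of "int n'"] by (simp only: G.m_assoc G.r_inv G.r_one G.inv_closed)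
  also have "\<dots> = ?u \<otimes>\<^bsub>?G\<^esub> (tt [^]\<^bsub>?G\<^esub> (int n) \<otimes>\<^bsub>?G\<^esub> inv\<^bsub>?G\<^esub> (tt [^]\<^bsub>?G\<^esub> (int n')))"
    unfolding eq'[symmetric] using U G.int_pow_closed[OF U(3)] by (simp only: G.m_assoc G.inv_closed)
  also have "\<dots> = ?u \<otimes>\<^bsub>?G\<^esub> tt [^]\<^bsub>?G\<^esub> (int n - int n')"
    by (simp only: G.int_pow_diff[OF U(3)])
  finally have "fr \<phi> \<psi> = ?u \<otimes>\<^bsub>FF\<^esub> tt [^]\<^bsub>FF\<^esub> (int n - int n')"
    using tt_unit by (simp only: units_of_mult units_of_int_pow)
  then show thesis by (rule that[OF uU])
qed

text \<open>A nonzero function \<open>\<phi> / \<psi>\<close> has order at least \<open>- k\<close> iff its product with the \<open>k\<close>-th power of the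
  local parameter is regular.\<close>

lemma ord_at_ge:
  assumes p: "quotient_pair d \<phi> \<psi>" and nz: "nonvanishing \<phi>"
  shows "0 \<le> ord_at XX (proj_class e) (fr \<phi> \<psi>) + int k \<longleftrightarrow>
    (\<exists>b U V. U \<in> forms UNIV b \<and> V \<in> forms UNIV b \<and> V e \<noteq> 0 \<and>
      (\<forall>v\<in>C. \<phi> v * T v ^ k * V v = \<psi> v * v $ s ^ k * U v))"
proof -
  interpret comm_monoid FF by (rule comm_monoid_FF)
  interpret G: comm_group "units_of FF" by (rule units_comm_group)
  let ?G = "units_of FF"
  obtain u n where un: "u \<in> LR - MI" "fr \<phi> \<psi> = u \<otimes>\<^bsub>FF\<^esub> (tt [^]\<^bsub>FF\<^esub> (n::int))"
    using fr_decompose[OF p nz] by blast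
  have ord: "ord_at XX (proj_class e) (fr \<phi> \<psi>) = n" by (rule ord_at_eq[OF un])
  have U: "u \<in> carrier ?G" "tt \<in> carrier ?G"
    using subgroup.subset[OF local_units_subgroup] un(1) tt_unit by (auto simp: units_of_carrier)
  have prod: "fr \<phi> \<psi> \<otimes>\<^bsub>FF\<^esub> tt [^]\<^bsub>FF\<^esub> k = u \<otimes>\<^bsub>?G\<^esub> tt [^]\<^bsub>?G\<^esub> (n + int k)"
  proof -
    have "fr \<phi> \<psi> \<otimes>\<^bsub>FF\<^esub> tt [^]\<^bsub>FF\<^esub> k = u \<otimes>\<^bsub>?G\<^esub> tt [^]\<^bsub>?G\<^esub> n \<otimes>\<^bsub>?G\<^esub> tt [^]\<^bsub>?G\<^esub> (int k)"
      using un(2) tt_unit by (simp add: units_of_mult units_of_pow units_of_int_pow int_pow_int)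
    then show ?thesis using U by (simp only: G.m_assoc G.m_closed G.int_pow_closed G.int_pow_mult)
  qed
  have 1: "0 \<le> n + int k \<longleftrightarrow> fr \<phi> \<psi> \<otimes>\<^bsub>FF\<^esub> tt [^]\<^bsub>FF\<^esub> k \<in> LR"
  proof (cases "0 \<le> n + int k")
    case True
    define j where "j = nat (n + int k)"
    have j: "n + int k = int j" using True by (simp add: j_def)
    have "tt [^]\<^bsub>?G\<^esub> (n + int k) = tt [^]\<^bsub>FF\<^esub> j"
      unfolding j units_of_int_pow[OF tt_unit] by (rule int_pow_int)
    then have eq: "fr \<phi> \<psi> \<otimes>\<^bsub>FF\<^esub> tt [^]\<^bsub>FF\<^esub> k = u \<otimes>\<^bsub>FF\<^esub> tt [^]\<^bsub>FF\<^esub> j"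
      unfolding prod by (simp add: units_of_mult)
    show ?thesis
    proof (cases "j = 0")
      case True
      then have "fr \<phi> \<psi> \<otimes>\<^bsub>FF\<^esub> tt [^]\<^bsub>FF\<^esub> k = u"
        unfolding eq using U by (simp add: units_of_carrier Units_closed)
      then show ?thesis using un(1) \<open>0 \<le> n + int k\<close> by simp
    next
      case False
      then have "fr \<phi> \<psi> \<otimes>\<^bsub>FF\<^esub> tt [^]\<^bsub>FF\<^esub> k \<in> MI"
        unfolding eq using max_ideal_absorb[OF _ tt_pow_max[of j], of u] un(1) by blast
      then show ?thesis using \<open>0 \<le> n + int k\<close> by (simp add: max_ideal_def)
    qed
  next
    case False
    define j where "j = nat (- (n + int k))"
    have j: "0 < j" using False by (simp add: j_def)
    have "fr \<phi> \<psi> \<otimes>\<^bsub>FF\<^esub> tt [^]\<^bsub>FF\<^esub> k \<notin> LR"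
    proof
      assume w: "fr \<phi> \<psi> \<otimes>\<^bsub>FF\<^esub> tt [^]\<^bsub>FF\<^esub> k \<in> LR"
      have "fr \<phi> \<psi> \<otimes>\<^bsub>FF\<^esub> tt [^]\<^bsub>FF\<^esub> k \<otimes>\<^bsub>FF\<^esub> tt [^]\<^bsub>FF\<^esub> j
         = u \<otimes>\<^bsub>?G\<^esub> tt [^]\<^bsub>?G\<^esub> (n + int k) \<otimes>\<^bsub>?G\<^esub> tt [^]\<^bsub>?G\<^esub> (int j)"
        unfolding prod using tt_unit by (simp add: units_of_mult units_of_pow units_of_int_pow int_pow_int)
      also have "\<dots> = u \<otimes>\<^bsub>?G\<^esub> tt [^]\<^bsub>?G\<^esub> (n + int k + int j)"
        using U by (simp only: G.m_assoc G.m_closed G.int_pow_closed G.int_pow_mult)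
      also have "n + int k + int j = 0" using False by (simp add: j_def)
      also have "u \<otimes>\<^bsub>?G\<^esub> tt [^]\<^bsub>?G\<^esub> (0::int) = u" using U by simp
      finally have "u \<in> MI" using max_ideal_absorb[OF w tt_pow_max[OF j]] by simp
      then show False using un(1) by blast
    qed
    then show ?thesis using False by simp
  qed
  have m: "fr \<phi> \<psi> \<otimes>\<^bsub>FF\<^esub> tt [^]\<^bsub>FF\<^esub> k = fr (\<lambda>v. \<phi> v * T v ^ k) (\<lambda>v. \<psi> v * v $ s ^ k)"
    unfolding tt_pow by (rule mult_FF[OF p tt_pow_pair])
  have 2: "fr \<phi> \<psi> \<otimes>\<^bsub>FF\<^esub> tt [^]\<^bsub>FF\<^esub> k \<in> LR \<longleftrightarrow> (\<exists>b U V. U \<in> forms UNIV b \<and> V \<in> forms UNIV b \<and> V e \<noteq> 0 \<and>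
      (\<forall>v\<in>C. \<phi> v * T v ^ k * V v = \<psi> v * v $ s ^ k * U v))"
  proof
    assume "fr \<phi> \<psi> \<otimes>\<^bsub>FF\<^esub> tt [^]\<^bsub>FF\<^esub> k \<in> LR"
    then obtain b U V where UV: "quotient_pair b U V" "V e \<noteq> 0"
      "fr (\<lambda>v. \<phi> v * T v ^ k) (\<lambda>v. \<psi> v * v $ s ^ k) = fr U V"
      unfolding local_ring_iff[OF lp_point(1)] m by blast
    then have eq: "\<forall>v\<in>C. \<phi> v * T v ^ k * V v = U v * (\<psi> v * v $ s ^ k)"
      using fr_eq_iff[OF quotient_pair_mult[OF p tt_pow_pair] UV(1)] by simp
    have "\<phi> v * T v ^ k * V v = \<psi> v * v $ s ^ k * U v" if "v \<in> C" for v
      using bspec[OF eq that] by (simp only: mult_ac)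
    then show "\<exists>b U V. U \<in> forms UNIV b \<and> V \<in> forms UNIV b \<and> V e \<noteq> 0 \<and>
      (\<forall>v\<in>C. \<phi> v * T v ^ k * V v = \<psi> v * v $ s ^ k * U v)"
      using UV(1,2) unfolding quotient_pair_def by blast
  next
    assume "\<exists>b U V. U \<in> forms UNIV b \<and> V \<in> forms UNIV b \<and> V e \<noteq> 0 \<and>
      (\<forall>v\<in>C. \<phi> v * T v ^ k * V v = \<psi> v * v $ s ^ k * U v)"
    then obtain b U V where UV: "U \<in> forms UNIV b" "V \<in> forms UNIV b" "V e \<noteq> 0"
      "\<And>v. v \<in> C \<Longrightarrow> \<phi> v * T v ^ k * V v = \<psi> v * v $ s ^ k * U v" by blast
    have q: "quotient_pair b U V" by (rule qp_nonvan[OF UV(1-3)])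
    have "fr (\<lambda>v. \<phi> v * T v ^ k) (\<lambda>v. \<psi> v * v $ s ^ k) = fr U V"
    proof (rule fr_eqI[OF quotient_pair_mult[OF p tt_pow_pair] q])
      fix v assume "v \<in> C"
      from UV(4)[OF this] show "\<phi> v * T v ^ k * V v = U v * (\<psi> v * v $ s ^ k)"
        by (simp only: mult.commute[of "U v"])
    qed
    then show "fr \<phi> \<psi> \<otimes>\<^bsub>FF\<^esub> tt [^]\<^bsub>FF\<^esub> k \<in> LR"
      unfolding local_ring_iff[OF lp_point(1)] m using q UV(3) by blast
  qed
  show ?thesis unfolding ord using 1 2 by simp
qed

end


section \<open>Rational points\<close>

lemma rational_affine:
  assumes "v \<in> C"
  shows "proj_class v \<in> rational_points XX M \<longleftrightarrow> (\<forall>i. v $ i ^ M = v $ i)"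
proof
  assume "proj_class v \<in> rational_points XX M"
  then obtain u where u: "u \<in> proj_class v" "\<And>i. u $ i ^ M = u $ i" unfolding rational_points_def by blast
  obtain c where c: "c \<noteq> 0" "u = c *s v" using u(1) by (auto simp: proj_class_def)
  have cM: "c ^ M = c" using u(2)[of 1] C_D(1)[OF assms] by (simp add: c(2))
  have "v $ i ^ M = v $ i" for i
    using u(2)[of i] c(1) by (simp add: c(2) power_mult_distrib cM)
  then show "\<forall>i. v $ i ^ M = v $ i" by blast
next
  assume "\<forall>i. v $ i ^ M = v $ i"
  then show "proj_class v \<in> rational_points XX M"
    using assms proj_class_self unfolding rational_points_def curve_points by blast
qed

lemma rational_infinity: "0 < M \<Longrightarrow> proj_class einf \<in> rational_points XX M"
proof -
  assume "0 < M"
  then have "einf $ i ^ M = einf $ i" for i :: 4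
    using exhaust_4[of i] by (auto simp: power_0_left)
  then show ?thesis using proj_class_self unfolding rational_points_def curve_points by blast
qed

lemma rational_q2:
  assumes "v \<in> C"
  shows "proj_class v \<in> rational_points XX (q\<^sup>2) \<longleftrightarrow> v $ 4 = 0"
  unfolding rational_affine[OF assms]
proof
  assume "\<forall>i. v $ i ^ q\<^sup>2 = v $ i"
  then have "v $ 4 ^ N = 0" using C_D(3)[OF assms] by simp
  then show "v $ 4 = 0" by simp
next
  assume z: "v $ 4 = 0"
  then have y: "v $ 3 ^ q\<^sup>2 = v $ 3" using C_D(3)[OF assms] N_pos by (simp add: power_0_left)
  have qq: "(a ^ q) ^ q = a ^ q\<^sup>2" for a :: 'a by (simp add: power2_eq_square power_mult)
  have "(v $ 2 ^ q) ^ q + v $ 2 ^ q = (v $ 2 ^ q + v $ 2) ^ q" by (simp only: frob_add1)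
  also have "\<dots> = (v $ 3 ^ (q + 1)) ^ q" by (simp only: C_D(2)[OF assms])
  also have "\<dots> = (v $ 3 ^ q) ^ q * v $ 3 ^ q" by (simp add: power_mult_distrib)
  also have "\<dots> = v $ 3 ^ (q + 1)" by (simp add: qq y)
  also have "\<dots> = v $ 2 ^ q + v $ 2" by (rule C_D(2)[OF assms])
  finally have x: "v $ 2 ^ q\<^sup>2 = v $ 2" by (simp add: qq)
  show "\<forall>i. v $ i ^ q\<^sup>2 = v $ i"
    using x y z q_ge_2 C_D(1)[OF assms] by (simp add: forall_4 power_0_left)
qed

section \<open>The monomial basis\<close>

text \<open>The exponents of the reduced monomials of degree at most \<open>m\<close>, and their values.\<close>

definition mono_exps :: "nat \<Rightarrow> (nat \<times> nat \<times> nat) set" where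
  "mono_exps m = {(i, j, k). j < q + 1 \<and> k < N \<and> i + j + k \<le> m}"

definition mono_at :: "nat \<times> nat \<times> nat \<Rightarrow> 'a ^ 4 \<Rightarrow> 'a" where
  "mono_at = (\<lambda>(i, j, k) v. v $ 2 ^ i * v $ 3 ^ j * v $ 4 ^ k)"

lemma monos_subset: "mono_exps m \<subseteq> {..m} \<times> {..<q + 1} \<times> {..<N}"
  by (auto simp: mono_exps_def)

lemma finite_monos: "finite (mono_exps m)"
  by (rule finite_subset[OF monos_subset]) simp

lemma sum_monos:
  assumes "\<And>i j k. (i, j, k) \<notin> mono_exps m \<Longrightarrow> i \<le> m \<Longrightarrow> j < q + 1 \<Longrightarrow> k < N \<Longrightarrow> f i j k = 0"
  shows "(\<Sum>(i, j, k)\<in>mono_exps m. f i j k) = (\<Sum>j<q + 1. \<Sum>k<N. \<Sum>i\<le>m. f i j k)"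
proof -
  have "(\<Sum>(i, j, k)\<in>mono_exps m. f i j k) = (\<Sum>(i, j, k)\<in>{..m} \<times> {..<q + 1} \<times> {..<N}. f i j k)"
    by (rule sum.mono_neutral_left) (use monos_subset assms in auto)
  also have "\<dots> = (\<Sum>i\<le>m. \<Sum>j<q + 1. \<Sum>k<N. f i j k)"
    by (simp only: sum.cartesian_product[symmetric])
  also have "\<dots> = (\<Sum>j<q + 1. \<Sum>i\<le>m. \<Sum>k<N. f i j k)" by (rule sum.swap)
  also have "\<dots> = (\<Sum>j<q + 1. \<Sum>k<N. \<Sum>i\<le>m. f i j k)" by (intro sum.cong refl sum.swap)
  finally show ?thesis .
qed

lemma rep1_monos:
  assumes "r \<in> rep1 False m"
  shows "\<exists>a. \<forall>v\<in>C. r v = (\<Sum>b\<in>mono_exps m. a b * mono_at b v)"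
proof -
  obtain c where c: "\<And>j k. c j k \<noteq> 0 \<Longrightarrow> adm1 False m (Polynomial.degree (c j k)) j k"
    "\<And>v. v \<in> C \<Longrightarrow> r v = (\<Sum>j<q + 1. \<Sum>k<N. poly (c j k) (v $ 2) * v $ 3 ^ j * v $ 4 ^ k)"
    using assms by (rule repE) blast
  let ?a = "\<lambda>(i, j, k). Polynomial.coeff (c j k) i"
  have z: "Polynomial.coeff (c j k) i = 0" if "i + j + k > m" for i j k
    using c(1)[of j k] that by (cases "c j k = 0") (auto simp: adm1_def intro: coeff_eq_0)
  have "r v = (\<Sum>b\<in>mono_exps m. ?a b * mono_at b v)" if v: "v \<in> C" for v
  proof -
    have "(\<Sum>b\<in>mono_exps m. ?a b * mono_at b v) =
      (\<Sum>(i, j, k)\<in>mono_exps m. Polynomial.coeff (c j k) i * (v $ 2 ^ i * v $ 3 ^ j * v $ 4 ^ k))"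
      by (intro sum.cong) (auto simp: mono_at_def)
    also have "\<dots> = (\<Sum>j<q + 1. \<Sum>k<N. \<Sum>i\<le>m. Polynomial.coeff (c j k) i * (v $ 2 ^ i * v $ 3 ^ j * v $ 4 ^ k))"
      by (rule sum_monos) (auto simp: mono_exps_def z)
    also have "\<dots> = (\<Sum>j<q + 1. \<Sum>k<N. poly (c j k) (v $ 2) * v $ 3 ^ j * v $ 4 ^ k)"
    proof (intro sum.cong refl)
      fix j k
      have "poly (c j k) (v $ 2) = (\<Sum>i\<le>m. Polynomial.coeff (c j k) i * v $ 2 ^ i)"
        unfolding poly_altdef
        by (rule sum.mono_neutral_left) (use c(1)[of j k] in \<open>cases "c j k = 0"; auto simp: adm1_def intro: coeff_eq_0\<close>)+
      then show "(\<Sum>i\<le>m. Polynomial.coeff (c j k) i * (v $ 2 ^ i * v $ 3 ^ j * v $ 4 ^ k)) =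
          poly (c j k) (v $ 2) * v $ 3 ^ j * v $ 4 ^ k"
        by (simp add: sum_distrib_right mult.assoc)
    qed
    finally show ?thesis using c(2)[OF v] by simp
  qed
  then show ?thesis by blast
qed

lemma monos_indep:
  assumes "\<And>v. v \<in> C \<Longrightarrow> (\<Sum>b\<in>mono_exps m. a b * mono_at b v) = 0" "b \<in> mono_exps m"
  shows "a b = 0"
proof -
  obtain i0 j0 k0 where b: "b = (i0, j0, k0)" "j0 < q + 1" "k0 < N" "i0 \<le> m"
    using assms(2) by (auto simp: mono_exps_def)
  define a' where "a' = (\<lambda>i j k. if (i, j, k) \<in> mono_exps m then a (i, j, k) else 0)"
  define c where "c = (\<lambda>j k. \<Sum>i\<le>m. Polynomial.monom (a' i j k) i)"
  have "c j0 k0 = 0"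
  proof (rule rep1_indep[OF _ b(2,3)])
    fix v assume v: "v \<in> C"
    have "(\<Sum>j<q + 1. \<Sum>k<N. poly (c j k) (v $ 2) * v $ 3 ^ j * v $ 4 ^ k)
      = (\<Sum>j<q + 1. \<Sum>k<N. \<Sum>i\<le>m. a' i j k * (v $ 2 ^ i * v $ 3 ^ j * v $ 4 ^ k))"
      by (simp add: c_def poly_sum poly_monom sum_distrib_right mult.assoc del: sum.lessThan_Suc)
    also have "\<dots> = (\<Sum>(i, j, k)\<in>mono_exps m. a' i j k * (v $ 2 ^ i * v $ 3 ^ j * v $ 4 ^ k))"
      by (rule sum_monos[symmetric]) (simp add: a'_def)
    also have "\<dots> = (\<Sum>b\<in>mono_exps m. a b * mono_at b v)"
      by (intro sum.cong refl) (auto simp: a'_def mono_at_def)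
    finally show "(\<Sum>j<q + 1. \<Sum>k<N. poly (c j k) (v $ 2) * v $ 3 ^ j * v $ 4 ^ k) = 0"
      using assms(1)[OF v] by simp
  qed
  then have "Polynomial.coeff (c j0 k0) i0 = 0" by simp
  moreover have "Polynomial.coeff (c j0 k0) i0 = a' i0 j0 k0"
    using b(4) by (simp add: c_def coeff_sum sum.delta)
  ultimately show ?thesis using assms(2) by (simp add: a'_def b(1))
qed

lemma mono_form:
  fixes S :: "'a set"
  assumes S: "coeff_ring S" and b: "(i, j, k) \<in> mono_exps m"
  shows "(\<lambda>v. v $ 1 ^ (m - i - j - k) * (v $ 2 ^ i * v $ 3 ^ j * v $ 4 ^ k)) \<in> forms S m"
proof -
  have p: "(\<lambda>v :: 'a ^ 4. v $ l ^ n) \<in> forms S n" for l n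
    using forms_power[OF S forms_coord[OF S], of l n] by simp
  have "(m - i - j - k) + ((i + j) + k) = m" using b by (auto simp: mono_exps_def)
  moreover have "(\<lambda>v :: 'a ^ 4. v $ 1 ^ (m - i - j - k) * (v $ 2 ^ i * v $ 3 ^ j * v $ 4 ^ k))
      \<in> forms S ((m - i - j - k) + ((i + j) + k))"
    by (intro forms_mult[OF S] p)
  ultimately show ?thesis by simp
qed

text \<open>The linear combinations of the reduced monomials, made homogeneous of degree \<open>m\<close>.\<close>

definition hom_sum :: "nat \<Rightarrow> (nat \<times> nat \<times> nat \<Rightarrow> 'a) \<Rightarrow> 'a ^ 4 \<Rightarrow> 'a" where
  "hom_sum m a v = (\<Sum>(i, j, k)\<in>mono_exps m. a (i, j, k) * (v $ 1 ^ (m - i - j - k) * (v $ 2 ^ i * v $ 3 ^ j * v $ 4 ^ k)))"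

lemma hom_sum_form:
  assumes S: "coeff_ring S" and "\<And>b. b \<in> mono_exps m \<Longrightarrow> a b \<in> S"
  shows "hom_sum m a \<in> forms S m"
proof -
  have "(\<lambda>v. a (i, j, k) * (v $ 1 ^ (m - i - j - k) * (v $ 2 ^ i * v $ 3 ^ j * v $ 4 ^ k))) \<in> forms S m"
    if "(i, j, k) \<in> mono_exps m" for i j k
    by (rule forms_scale[OF S assms(2)[OF that] mono_form[OF S that]])
  then show ?thesis unfolding hom_sum_def[abs_def]
    by (intro forms_sum[OF S]) (auto simp: case_prod_unfold)
qed

lemma hom_sum_C: "v \<in> C \<Longrightarrow> hom_sum m a v = (\<Sum>b\<in>mono_exps m. a b * mono_at b v)"
  unfolding hom_sum_def by (intro sum.cong refl) (auto simp: mono_at_def C_D(1))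

lemma card_monos:
  assumes "q\<^sup>2 \<le> m + 1"
  shows "real (card (mono_exps m)) = (real q ^ 3 + 1) * (real m + 1 - real q ^ 2 / 2)"
proof -
  have "card (mono_exps m) = (\<Sum>b\<in>mono_exps m. 1)" by simp
  also have "\<dots> = (\<Sum>(i, j, k)\<in>mono_exps m. if i + j + k \<le> m then 1 else 0)"
    by (intro sum.cong refl) (auto simp: mono_exps_def)
  also have "\<dots> = (\<Sum>j<q + 1. \<Sum>k<N. \<Sum>i\<le>m. if i + j + k \<le> m then 1 else 0)"
    by (rule sum_monos) (auto simp: mono_exps_def)
  also have "\<dots> = (\<Sum>j<q + 1. \<Sum>k<N. m + 1 - (j + k))"
  proof (intro sum.cong refl)
    fix j k assume "j \<in> {..<q + 1}" "k \<in> {..<N}"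
    then have jk: "j + k \<le> m + 1" using assms N_q by auto
    have "(\<Sum>i\<le>m. if i + j + k \<le> m then 1 else 0 :: nat) = card {i \<in> {..m}. i + j + k \<le> m}"
      by (simp add: sum.If_cases Int_def)
    also have "{i \<in> {..m}. i + j + k \<le> m} = {..<m + 1 - (j + k)}" by auto
    finally show "(\<Sum>i\<le>m. if i + j + k \<le> m then 1 else 0) = m + 1 - (j + k)" by simp
  qed
  finally have "real (card (mono_exps m)) = (\<Sum>j<q + 1. \<Sum>k<N. real (m + 1 - (j + k)))" by simp
  also have "\<dots> = (\<Sum>j<q + 1. \<Sum>k<N. real m + 1 - real j - real k)"
  proof (intro sum.cong refl)
    fix j k assume "j \<in> {..<q + 1}" "k \<in> {..<N}"
    then have jk: "j + k \<le> m + 1" using assms N_q by auto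
    then show "real (m + 1 - (j + k)) = real m + 1 - real j - real k" by (simp add: of_nat_diff)
  qed
  also have "\<dots> = (\<Sum>j<q + 1. real N * (real m + 1 - real j) - real N * (real N - 1) / 2)"
  proof (intro sum.cong refl)
    fix j
    have "(\<Sum>k<n. real m + 1 - real j - real k) = real n * (real m + 1 - real j) - real n * (real n - 1) / 2" for n
      by (induction n) (simp_all add: field_simps)
    then show "(\<Sum>k<N. real m + 1 - real j - real k) = real N * (real m + 1 - real j) - real N * (real N - 1) / 2" .
  qed
  also have "\<dots> = real N * (real q + 1) * (real m + 1 - real q / 2 - (real N - 1) / 2)"
  proof -
    define A where "A = real m + 1 - (real N - 1) / 2"
    have "(\<Sum>j<q + 1. real N * (real m + 1 - real j) - real N * (real N - 1) / 2) =
        (\<Sum>j<q + 1. real N * (A - real j))"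
      by (intro sum.cong refl) (simp add: A_def algebra_simps)
    also have "\<dots> = real N * (\<Sum>j<q + 1. A - real j)" by (simp only: sum_distrib_left)
    also have "(\<Sum>j<n. A - real j) = real n * A - real n * (real n - 1) / 2" for n
      by (induction n) (simp_all add: field_simps)
    also have "real (q + 1) * A - real (q + 1) * (real (q + 1) - 1) / 2
        = (real q + 1) * (real m + 1 - real q / 2 - (real N - 1) / 2)"
      by (simp add: A_def algebra_simps)
    finally show ?thesis by (simp only: mult.assoc)
  qed
  also have "real N * (real q + 1) = real q ^ 3 + 1"
    using arg_cong[OF N_mult, of real] by (simp add: distrib_left add.commute)
  also have "real m + 1 - real q / 2 - (real N - 1) / 2 = real m + 1 - real q ^ 2 / 2"
    using arg_cong[OF N_q, of real] by (simp add: field_simps)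
  finally show ?thesis .
qed

section \<open>The Riemann-Roch space\<close>

text \<open>The coefficients of \<open>G\<close>.\<close>

definition pole_bound :: "nat \<Rightarrow> 'a proj_point \<Rightarrow> int" where
  "pole_bound m P = (if P \<in> rational_points XX (q\<^sup>2) then int m else 0)"

text \<open>The plane \<open>Z = 0\<close> meets the curve exactly in the points of \<open>G\<close>, each with multiplicity one; so
  the functions with poles bounded by \<open>m\<close> at these points are the forms of degree \<open>m\<close> divided
  by \<open>Z\<^sup>m\<close>.\<close>

lemma riemann_roch_functions:
  assumes p: "quotient_pair d \<phi> \<psi>" and nz: "nonvanishing \<phi>"
  shows "(\<forall>P\<in>XX. 0 \<le> ord_at XX P (fr \<phi> \<psi>) + pole_bound m P) \<longleftrightarrow>
    (\<exists>a. \<forall>v\<in>C. \<phi> v * v $ 4 ^ m = hom_sum m a v * \<psi> v)"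
proof
  assume ord: "\<forall>P\<in>XX. 0 \<le> ord_at XX P (fr \<phi> \<psi>) + pole_bound m P"
  have F: "\<phi> \<in> forms UNIV d" "\<psi> \<in> forms UNIV d" "nonvanishing \<psi>" using p by (auto simp: quotient_pair_def)
  have \<phi>m: "(\<lambda>v. \<phi> v * v $ 4 ^ m) \<in> forms UNIV (d + m)" by (rule F_mult[OF F(1) F_coord_power])
  have "\<exists>r\<in>polyfuns. \<forall>v\<in>C. \<phi> v * v $ 4 ^ m = \<psi> v * r v"
  proof (rule regular_quotient[OF \<phi>m F(2,3)])
    fix e assume e: "e \<in> C"
    have XXe: "proj_class e \<in> XX" using e unfolding curve_points by blast
    let ?T = "\<lambda>v :: 'a ^ 4. v $ 4 - e $ 4 * v $ 1"
    let ?k = "if e $ 4 = 0 then m else 0"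
    have "0 \<le> ord_at XX (proj_class e) (fr \<phi> \<psi>) + int ?k"
      using bspec[OF ord XXe] rational_q2[OF e] by (simp add: pole_bound_def split: if_splits)
    then obtain b U V where UV: "U \<in> forms UNIV b" "V \<in> forms UNIV b" "V e \<noteq> 0"
      "\<And>v. v \<in> C \<Longrightarrow> \<phi> v * ?T v ^ ?k * V v = \<psi> v * v $ 1 ^ ?k * U v"
      unfolding ord_at_ge[OF local_param_affine[OF e] p nz] by blast
    show "\<exists>U\<in>polyfuns. \<exists>V\<in>polyfuns. V e \<noteq> 0 \<and> (\<forall>v\<in>C. \<phi> v * v $ 4 ^ m * V v = \<psi> v * U v)"
    proof (cases "e $ 4 = 0")
      case True
      have "\<phi> v * v $ 4 ^ m * V v = \<psi> v * U v" if "v \<in> C" for v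
        using UV(4)[OF that] True C_D(1)[OF that] by simp
      then show ?thesis using UV(1-3) polyfuns_form by blast
    next
      case False
      have eq: "\<phi> v * v $ 4 ^ m * V v = \<psi> v * (v $ 4 ^ m * U v)" if "v \<in> C" for v
        using UV(4)[OF that] False by (simp add: mult_ac)
      have pU: "(\<lambda>v. v $ 4 ^ m * U v) \<in> polyfuns" by (rule polyfuns_form[OF F_mult[OF F_coord_power UV(1)]])
      show ?thesis
      proof (rule bexI[OF _ pU], rule bexI[OF _ polyfuns_form[OF UV(2)]], intro conjI ballI)
        show "V e \<noteq> 0" by (rule UV(3))
        show "\<phi> v * v $ 4 ^ m * V v = \<psi> v * (v $ 4 ^ m * U v)" if "v \<in> C" for v by (rule eq[OF that])
      qed
    qed
  qed
  then obtain r where r: "r \<in> polyfuns" "\<And>v. v \<in> C \<Longrightarrow> \<phi> v * v $ 4 ^ m = \<psi> v * r v" by blast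
  obtain D g where g: "g \<in> forms UNIV D" "\<And>v. v \<in> C \<Longrightarrow> r v = g v" using r(1) unfolding polyfuns_def by blast
  have "proj_class einf \<in> XX" unfolding curve_points by blast
  then have "0 \<le> ord_at XX (proj_class einf) (fr \<phi> \<psi>) + int m"
    using ord rational_infinity[of "q\<^sup>2"] q_ge_2 by (fastforce simp: pole_bound_def)
  then obtain b U V where UV: "U \<in> forms UNIV b" "V \<in> forms UNIV b" "V einf \<noteq> 0"
      "\<And>v. v \<in> C \<Longrightarrow> \<phi> v * v $ 4 ^ m * V v = \<psi> v * v $ 2 ^ m * U v"
    unfolding ord_at_ge[OF local_param_infinity p nz] by blast
  have pf: "(\<lambda>v. r v * V v + (- 1) * (v $ 2 ^ m * U v)) \<in> polyfuns"
    by (intro polyfuns_add polyfuns_mult r(1) polyfuns_form[OF UV(2)] polyfuns_form[OF UV(1)]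
        polyfuns_form[OF F_coord_power] polyfuns_form[OF F_const])
  have z: "\<psi> v * (r v * V v + (- 1) * (v $ 2 ^ m * U v)) = 0" if v: "v \<in> C" for v
  proof -
    have "\<psi> v * (r v * V v + (- 1) * (v $ 2 ^ m * U v)) = (\<psi> v * r v) * V v - \<psi> v * v $ 2 ^ m * U v"
      by (simp add: algebra_simps)
    then show ?thesis by (simp only: r(2)[OF v, symmetric] UV(4)[OF v]) simp
  qed
  have eq: "g v * V v = v $ 2 ^ m * U v" if v: "v \<in> C" for v
    using polyfuns_domain[OF polyfuns_form[OF F(2)] pf F(3) z v] g(2)[OF v] by simp
  have "g \<in> rep1 False D" using forms_rep1[OF g(1)] by blast
  then have "g \<in> rep1 False m" by (rule degree_bound_infinity[OF _ UV(1-3) eq])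
  then obtain a where a: "\<forall>v\<in>C. g v = (\<Sum>b\<in>mono_exps m. a b * mono_at b v)" using rep1_monos by blast
  have "\<phi> v * v $ 4 ^ m = hom_sum m a v * \<psi> v" if v: "v \<in> C" for v
    using r(2)[OF v] g(2)[OF v] bspec[OF a v] hom_sum_C[OF v, of m a] by simp
  then show "\<exists>a. \<forall>v\<in>C. \<phi> v * v $ 4 ^ m = hom_sum m a v * \<psi> v" by blast
next
  assume "\<exists>a. \<forall>v\<in>C. \<phi> v * v $ 4 ^ m = hom_sum m a v * \<psi> v"
  then obtain a where a: "\<And>v. v \<in> C \<Longrightarrow> \<phi> v * v $ 4 ^ m = hom_sum m a v * \<psi> v" by blast
  have R: "hom_sum m a \<in> forms UNIV m" by (rule hom_sum_form) simp_all
  show "\<forall>P\<in>XX. 0 \<le> ord_at XX P (fr \<phi> \<psi>) + pole_bound m P"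
  proof
    fix P assume "P \<in> XX"
    then consider "P = proj_class einf" | e where "e \<in> C" "P = proj_class e" unfolding curve_points by blast
    then show "0 \<le> ord_at XX P (fr \<phi> \<psi>) + pole_bound m P"
    proof cases
      case 1
      have "0 \<le> ord_at XX (proj_class einf) (fr \<phi> \<psi>) + int m"
        unfolding ord_at_ge[OF local_param_infinity p nz]
      proof (intro exI conjI ballI)
        show "hom_sum m a \<in> forms UNIV m" by (rule R)
        show "(\<lambda>v :: 'a ^ 4. v $ 2 ^ m) \<in> forms UNIV m" by (rule F_coord_power)
        show "einf $ 2 ^ m \<noteq> 0" by simp
        fix v assume "v \<in> C"
        then show "\<phi> v * v $ 4 ^ m * v $ 2 ^ m = \<psi> v * v $ 2 ^ m * hom_sum m a v"
          by (simp add: a mult_ac)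
      qed
      moreover have "P \<in> rational_points XX (q\<^sup>2)" using rational_infinity[of "q\<^sup>2"] q_ge_2 1 by simp
      ultimately show ?thesis by (simp add: pole_bound_def 1)
    next
      case (2 e)
      show ?thesis
      proof (cases "e $ 4 = 0")
        case True
        have "0 \<le> ord_at XX (proj_class e) (fr \<phi> \<psi>) + int m"
          unfolding ord_at_ge[OF local_param_affine[OF 2(1)] p nz]
        proof (intro exI conjI ballI)
          show "hom_sum m a \<in> forms UNIV m" by (rule R)
          show "(\<lambda>v :: 'a ^ 4. v $ 1 ^ m) \<in> forms UNIV m" by (rule F_coord_power)
          show "e $ 1 ^ m \<noteq> 0" using C_D(1)[OF 2(1)] by simp
          fix v assume "v \<in> C"
          then show "\<phi> v * (v $ 4 - e $ 4 * v $ 1) ^ m * v $ 1 ^ m = \<psi> v * v $ 1 ^ m * hom_sum m a v"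
            using True by (simp add: a mult_ac)
        qed
        then show ?thesis using rational_q2[OF 2(1)] True by (simp add: pole_bound_def 2(2))
      next
        case False
        have "0 \<le> ord_at XX (proj_class e) (fr \<phi> \<psi>) + int 0"
          unfolding ord_at_ge[OF local_param_affine[OF 2(1)] p nz]
        proof (intro exI conjI ballI)
          show "hom_sum m a \<in> forms UNIV m" by (rule R)
          show "(\<lambda>v :: 'a ^ 4. v $ 4 ^ m) \<in> forms UNIV m" by (rule F_coord_power)
          show "e $ 4 ^ m \<noteq> 0" using False by simp
          fix v assume "v \<in> C"
          then show "\<phi> v * (v $ 4 - e $ 4 * v $ 1) ^ 0 * v $ 4 ^ m = \<psi> v * v $ 1 ^ 0 * hom_sum m a v"
            by (simp add: a mult_ac)
        qed
        then show ?thesis using rational_q2[OF 2(1)] False by (simp add: pole_bound_def 2(2))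
      qed
    qed
  qed
qed

section \<open>Points over the field with \<open>q\<^sup>6\<close> elements\<close>

text \<open>For \<open>z \<noteq> 0\<close>, with \<open>u = z\<^sup>N\<close> and \<open>u\<^sub>i = u\<^bsup>q^i\<^esup>\<close>, the relation \<open>u\<^sub>0 u\<^sub>1 + u\<^sub>0 u\<^sub>3 + u\<^sub>2 u\<^sub>3 = 0\<close> makes all points over \<open>z\<close>
  rational over the field with \<open>q\<^sup>6\<close> elements.\<close>

lemma rational_fibre:
  assumes v: "v \<in> C" and u0: "v $ 4 \<noteq> 0"
    and R: "v $ 4 ^ N * (v $ 4 ^ N) ^ q + v $ 4 ^ N * (v $ 4 ^ N) ^ q ^ 3 + (v $ 4 ^ N) ^ q\<^sup>2 * (v $ 4 ^ N) ^ q ^ 3 = 0"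
  shows "v $ i ^ q ^ 6 = v $ i"
proof -
  define x where "x = (\<lambda>n. v $ 2 ^ q ^ n)"
  define y where "y = (\<lambda>n. v $ 3 ^ q ^ n)"
  define u where "u = (\<lambda>n. (v $ 4 ^ N) ^ q ^ n)"
  have pp: "(a ^ q ^ k) ^ q ^ n = a ^ q ^ (k + n)" for a :: 'a and k n
    by (simp only: power_mult[symmetric] power_add[symmetric])
  have Rn: "u n * u (n + 1) + u n * u (n + 3) + u (n + 2) * u (n + 3) = 0" for n
  proof -
    have R0: "u 0 * u 1 + u 0 * u 3 + u 2 * u 3 = 0" using R by (simp add: u_def)
    have un: "u k ^ q ^ n = u (n + k)" for k by (simp only: u_def pp add.commute)
    have "(u 0 * u 1 + u 0 * u 3 + u 2 * u 3) ^ q ^ n = u n * u (n + 1) + u n * u (n + 3) + u (n + 2) * u (n + 3)"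
      by (simp only: frob_add power_mult_distrib un add_0_right)
    then show ?thesis using R0 q_ge_2 by (simp add: power_0_left)
  qed
  have yn: "y (n + 2) = y n + u n" for n
  proof -
    have "(v $ 3 ^ q\<^sup>2) ^ q ^ n = (v $ 3 + v $ 4 ^ N) ^ q ^ n" using C_D(3)[OF v] by simp
    then show ?thesis unfolding y_def u_def frob_add by (simp only: pp add.commute)
  qed
  have xn: "x (n + 1) + x n = y n * y (n + 1)" for n
  proof -
    have "(v $ 2 ^ q ^ 1 + v $ 2) ^ q ^ n = (v $ 3 ^ q ^ 1 * v $ 3) ^ q ^ n"
      using C_D(2)[OF v] by (simp add: mult.commute)
    then show ?thesis unfolding x_def y_def frob_add power_mult_distrib
      by (simp only: pp add.commute[of 1] mult.commute)
  qed
  have un0: "u n \<noteq> 0" for n using u0 by (simp add: u_def)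
  \<comment> \<open>the trace of \<open>u\<close> to the field with \<open>q\<^sup>2\<close> elements, which vanishes\<close>
  define S where "S = u 0 + u 2 + u 4"
  have nums: "(0::nat) + n = n" "(1::nat) + 1 = 2" "(1::nat) + 2 = 3" "(1::nat) + 3 = 4" "(2::nat) + 1 = 3"
    "(3::nat) + 1 = 4" "(4::nat) + 1 = 5" "(5::nat) + 1 = 6" "(2::nat) + 2 = 4" "(3::nat) + 2 = 5"
    "(4::nat) + 2 = 6" for n by simp_all
  have R0: "u 0 * u 1 + u 0 * u 3 + u 2 * u 3 = 0" using Rn[of 0] by (simp only: nums)
  have R1: "u 1 * u 2 + u 1 * u 4 + u 3 * u 4 = 0" using Rn[of 1] by (simp only: nums)
  have "S * (u 1 + u 3) = (u 0 * u 1 + u 0 * u 3 + u 2 * u 3) + (u 1 * u 2 + u 1 * u 4 + u 3 * u 4)"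
    by (simp add: S_def algebra_simps)
  then have "S * (u 1 + u 3) = 0" using R0 R1 by simp
  moreover have "u 1 + u 3 \<noteq> 0"
  proof
    assume a: "u 1 + u 3 = 0"
    have "u 1 * u 2 + u 4 * (u 1 + u 3) = 0" using R1 by (simp add: algebra_simps)
    then show False using a un0 by simp
  qed
  ultimately have S0: "S = 0" by simp
  have y24: "y 2 = y 0 + u 0" "y 4 = y 2 + u 2" "y 6 = y 4 + u 4" "y 3 = y 1 + u 1" "y 5 = y 3 + u 3"
    using yn[of 0] yn[of 2] yn[of 4] yn[of 1] yn[of 3] by (simp_all only: nums)
  have y6: "y 6 = y 0" using S0 by (simp add: y24 S_def add.assoc)
  have xs: "x (n + 1) = y n * y (n + 1) - x n" for n using xn[of n] by (simp only: eq_diff_eq)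
  have "x 6 = y 5 * y 6 - (y 4 * y 5 - (y 3 * y 4 - (y 2 * y 3 - (y 1 * y 2 - (y 0 * y 1 - x 0)))))"
    using xs[of 0] xs[of 1] xs[of 2] xs[of 3] xs[of 4] xs[of 5] by (simp only: nums)
  also have "\<dots> = x 0 - (u 0 * u 1 + u 0 * u 3 + u 2 * u 3)"
    by (simp add: y6) (simp add: y24 algebra_simps)
  finally have x6: "x 6 = x 0" using R0 by simp
  have z6: "v $ 4 ^ q ^ 6 = v $ 4"
  proof -
    have u4: "u 4 = S - (u 0 + u 2)" by (simp add: S_def)
    have "u 3 * u 4 = u 0 * u 1 - (u 0 * u 1 + u 0 * u 3 + u 2 * u 3)"
      unfolding u4 S0 by (simp add: algebra_simps)
    then have "u 3 * u 4 = u 0 * u 1" unfolding R0 by (simp only: diff_0_right)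
    then have "v $ 4 ^ (N * q ^ 3 + N * q ^ 4) = v $ 4 ^ (N + N * q)"
      by (simp add: u_def power_mult power_add)
    moreover have "N * q ^ 3 + N * q ^ 4 = q ^ 6 + q ^ 3"
    proof -
      have "N * q ^ 3 + N * q ^ 4 = (N * (q + 1)) * q ^ 3" by (simp add: algebra_simps numeral_eq_Suc)
      also have "\<dots> = q ^ 6 + q ^ 3" unfolding N_mult by (simp add: distrib_right flip: power_add)
      finally show ?thesis .
    qed
    moreover have "N + N * q = q ^ 3 + 1" using N_mult by (simp add: algebra_simps)
    ultimately have "v $ 4 ^ q ^ 6 * v $ 4 ^ q ^ 3 = v $ 4 * v $ 4 ^ q ^ 3"
      by (simp add: power_add)
    then show ?thesis using u0 by simp
  qed
  show ?thesis
    using exhaust_4[of i] x6 y6 z6 C_D(1)[OF v] by (auto simp: x_def y_def)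
qed

text \<open>There are \<open>(q\<^sup>3 + 1) (q\<^sup>2 - 1)\<close> such values of \<open>z\<close>, the roots of a separable polynomial.\<close>

lemma rational_z_values:
  obtains Z :: "'a set" where "finite Z" "card Z = (q ^ 3 + 1) * (q\<^sup>2 - 1)"
    "\<And>v i. v \<in> C \<Longrightarrow> v $ 4 \<in> Z \<Longrightarrow> v $ 4 \<noteq> 0 \<and> v $ i ^ q ^ 6 = v $ i"
proof -
  define M where "M = q ^ 3 + q\<^sup>2 - q - 1"
  define M' where "M' = q ^ 3 - q"
  obtain r where r: "q = Suc (Suc r)" using q_ge_2 by (metis add_2_eq_Suc le_Suc_ex)
  have M: "M + (q + 1) = q ^ 3 + q\<^sup>2" unfolding M_def r by (simp add: power3_eq_cube power2_eq_square)
  have M': "M' + (q + 1) = q ^ 3 + 1" unfolding M'_def r by (simp add: power3_eq_cube)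
  have MM: "M = (q + 1) * (q\<^sup>2 - 1)" unfolding M_def r by (simp add: power3_eq_cube power2_eq_square algebra_simps)
  have M'M: "0 < M'" "M' < M" unfolding M'_def M_def r by (simp_all add: power3_eq_cube power2_eq_square)
  define h where "h = Polynomial.monom 1 (N * M) + (Polynomial.monom 1 (N * M') + (1 :: 'a poly))"
  have ev: "poly h z = (z ^ N) ^ M + (z ^ N) ^ M' + 1" for z
    by (simp add: h_def poly_monom power_mult add.assoc)
  have "Polynomial.degree (Polynomial.monom 1 (N * M') + (1 :: 'a poly)) \<le> N * M'"
    by (intro degree_add_le) (auto simp: degree_monom_le)
  also have "N * M' < N * M" using M'M N_pos by simp
  finally have lt: "Polynomial.degree (Polynomial.monom 1 (N * M') + (1 :: 'a poly)) < N * M" .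
  have deg: "Polynomial.degree h = N * M" unfolding h_def
    using lt by (subst degree_add_eq_left) (simp_all add: degree_monom_eq)
  have "of_nat (M + (q + 1)) = (of_nat (q ^ 3 + q\<^sup>2) :: 'a)" by (simp only: M)
  then have oM: "of_nat M = (- 1 :: 'a)" by (simp add: of_nat_q eq_neg_iff_add_eq_0 add.commute)
  have "of_nat (M' + (q + 1)) = (of_nat (q ^ 3 + 1) :: 'a)" by (simp only: M')
  then have oM': "of_nat M' = (0 :: 'a)" by (simp add: of_nat_q)
  have "pderiv h = Polynomial.monom (- 1) (N * M - 1)"
    unfolding h_def by (simp add: pderiv_add pderiv_monom of_nat_N oM oM')
  then have der: "poly (pderiv h) z = - (z ^ (N * M - 1))" for z by (simp add: poly_monom)
  have h0: "poly h 0 \<noteq> 0" using N_pos M'M by (simp add: ev power_0_left)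
  have sep: "poly (pderiv h) z \<noteq> 0" if "poly h z = 0" for z
    using that h0 by (cases "z = 0") (auto simp: der)
  note cr = card_separable_roots[OF sep]
  have "N * M = (q ^ 3 + 1) * (q\<^sup>2 - 1)" unfolding MM using N_mult by (metis mult.assoc)
  then have card: "card {z. poly h z = 0} = (q ^ 3 + 1) * (q\<^sup>2 - 1)" using cr(2) deg by simp
  have rat: "v $ 4 \<noteq> 0 \<and> v $ i ^ q ^ 6 = v $ i" if v: "v \<in> C" "v $ 4 \<in> {z. poly h z = 0}" for v i
  proof
    let ?u = "v $ 4 ^ N"
    show z0: "v $ 4 \<noteq> 0" using v(2) h0 by auto
    have "0 = ?u ^ (q + 1) * poly h (v $ 4)" using v(2) by simp
    also have "\<dots> = ?u ^ (M + (q + 1)) + ?u ^ (M' + (q + 1)) + ?u ^ (q + 1)"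
      by (simp only: ev power_add) (simp add: algebra_simps)
    also have "\<dots> = ?u * ?u ^ q + ?u * ?u ^ q ^ 3 + ?u ^ q\<^sup>2 * ?u ^ q ^ 3"
      by (simp only: M M' power_add power_one_right) (simp add: mult_ac add_ac)
    finally show "v $ i ^ q ^ 6 = v $ i"
      by (intro rational_fibre[OF v(1) z0]) simp
  qed
  show thesis by (rule that[OF cr(1) card rat])
qed

text \<open>A form of degree \<open>m < q\<^sup>3 (q\<^sup>2 - 1)\<close> is determined by its values at the rational points off the
  plane \<open>Z = 0\<close>.\<close>

lemma evaluation_injective:
  assumes g: "g \<in> forms UNIV m" and m: "m < q ^ 3 * (q\<^sup>2 - 1)"
    and zero: "\<And>v. v \<in> C \<Longrightarrow> v $ 4 \<noteq> 0 \<Longrightarrow> (\<And>i. v $ i ^ q ^ 6 = v $ i) \<Longrightarrow> g v = 0" and v: "v \<in> C"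
  shows "g v = 0"
proof -
  obtain Z :: "'a set" where Z: "finite Z" "card Z = (q ^ 3 + 1) * (q\<^sup>2 - 1)"
    "\<And>v i. v \<in> C \<Longrightarrow> v $ 4 \<in> Z \<Longrightarrow> v $ 4 \<noteq> 0 \<and> v $ i ^ q ^ 6 = v $ i"
    using rational_z_values by blast
  obtain c where c: "\<And>i j. c i j \<noteq> 0 \<Longrightarrow> adm2 ((q ^ 3 + 1) * m) (Polynomial.degree (c i j)) i j"
    "\<And>v. v \<in> C \<Longrightarrow> g v = (\<Sum>i<q. \<Sum>j<q\<^sup>2. poly (c i j) (v $ 4) * v $ 2 ^ i * v $ 3 ^ j)"
    using forms_rep2[OF g] by (rule repE) blast
  have root: "poly (c i j) z = 0" if ij: "i < q" "j < q\<^sup>2" and z: "z \<in> Z" for i j z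
  proof (rule fibre_coeffs_zero[of z "\<lambda>i j. poly (c i j) z", OF _ ij])
    fix x y assume u: "vec4 1 x y z \<in> C"
    have "g (vec4 1 x y z) = 0"
    proof (rule zero[OF u])
      show "vec4 1 x y z $ 4 \<noteq> 0" "vec4 1 x y z $ i ^ q ^ 6 = vec4 1 x y z $ i" for i
        using Z(3)[OF u, of i] z by simp_all
    qed
    then show "(\<Sum>i<q. \<Sum>j<q\<^sup>2. poly (c i j) z * x ^ i * y ^ j) = 0" using c(2)[OF u] by simp
  qed
  have "c i j = 0" if ij: "i < q" "j < q\<^sup>2" for i j
  proof (rule ccontr)
    assume ne: "c i j \<noteq> 0"
    have "q ^ 3 * Polynomial.degree (c i j) \<le> (q ^ 3 + 1) * m" using c(1)[OF ne] by (simp add: adm2_def)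
    also have "\<dots> < (q ^ 3 + 1) * (q ^ 3 * (q\<^sup>2 - 1))" using m by (intro mult_strict_left_mono) auto
    also have "\<dots> = q ^ 3 * ((q ^ 3 + 1) * (q\<^sup>2 - 1))" by (simp only: mult_ac)
    finally have "q ^ 3 * Polynomial.degree (c i j) < q ^ 3 * card Z" by (simp only: Z(2))
    then have "Polynomial.degree (c i j) < card Z" by simp
    moreover have "card Z \<le> card {z. poly (c i j) z = 0}"
      using root[OF ij] ne by (intro card_mono poly_roots_finite) auto
    moreover have "card {z. poly (c i j) z = 0} \<le> Polynomial.degree (c i j)"
      by (rule card_poly_roots_bound[OF ne])
    ultimately show False by linarith
  qed
  then show ?thesis using c(2)[OF v] by simp
qed

end

section \<open>The code over the finite field\<close>

lemma finite_field_power_card: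
  fixes x :: "'f::{field, finite}"
  shows "x ^ CARD('f) = x"
proof (cases "x = 0")
  case False
  define p where "p = (\<Prod>y\<in>UNIV - {0 :: 'f}. y)"
  have p0: "p \<noteq> 0" by (simp add: p_def)
  have "(\<Prod>y\<in>UNIV - {0}. x * y) = p" unfolding p_def
    by (rule prod.reindex_bij_witness[of _ "\<lambda>y. y / x" "\<lambda>y. x * y"]) (use False in auto)
  then have "x ^ card (UNIV - {0 :: 'f}) * p = p"
    by (simp only: prod.distrib prod_constant p_def)
  then have "x ^ card (UNIV - {0 :: 'f}) = 1" using p0 by simp
  moreover have "CARD('f) = Suc (card (UNIV - {0 :: 'f}))"
    by (rule card_Suc_Diff1[OF finite UNIV_I, symmetric])
  ultimately show ?thesis by (simp only: power_Suc mult_1_right)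
next
  case True
  have "CARD('f) > 0" by (simp add: card_gt_0_iff)
  with True show ?thesis by simp
qed

lemma lookup_sum_single:
  assumes "finite S"
  shows "Poly_Mapping.lookup (\<Sum>Q\<in>S. Poly_Mapping.single Q c) P = (if P \<in> S then c else 0)"
  using assms by (simp add: lookup_sum lookup_single when_def sum.delta)

lemma span_dim_family:
  fixes M :: "'b \<Rightarrow> 'f::field ^ 'n::finite"
  assumes "finite B" and indep: "\<And>\<alpha> b. (\<Sum>b\<in>B. \<alpha> b *s M b) = 0 \<Longrightarrow> b \<in> B \<Longrightarrow> \<alpha> b = 0"
  shows "vec.dim {\<Sum>b\<in>B. \<alpha> b *s M b | \<alpha>. True} = card B"
proof -
  have inj: "inj_on M B"
  proof (rule inj_onI)
    fix b b' assume b: "b \<in> B" "b' \<in> B" "M b = M b'"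
    show "b = b'"
    proof (rule ccontr)
      assume ne: "b \<noteq> b'"
      define \<alpha> where "\<alpha> = (\<lambda>x. if x = b then 1 else if x = b' then - 1 else (0::'f))"
      have "(\<Sum>x\<in>B. \<alpha> x *s M x) = (\<Sum>x\<in>{b, b'}. \<alpha> x *s M x)"
        using assms(1) b by (intro sum.mono_neutral_right) (auto simp: \<alpha>_def)
      also have "\<dots> = 0" using ne b(3) by (simp add: \<alpha>_def)
      finally have "\<alpha> b = 0" using indep b(1) by blast
      then show False by (simp add: \<alpha>_def)
    qed
  qed
  have ri: "(\<Sum>v\<in>M ` B. u v *s v) = (\<Sum>b\<in>B. u (M b) *s M b)" for u
    using inj by (simp add: sum.reindex)
  have "vec.independent (M ` B)"
    unfolding vec.dependent_finite[OF finite_imageI[OF assms(1)]] ri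
    using indep[of "\<lambda>b. _ (M b)"] by blast
  then have "vec.dim (vec.span (M ` B)) = card (M ` B)" by (rule vec.dim_span_eq_card_independent)
  moreover have "{\<Sum>b\<in>B. \<alpha> b *s M b | \<alpha>. True} = vec.span (M ` B)"
  proof -
    have "vec.span (M ` B) = range (\<lambda>u. \<Sum>b\<in>B. u (M b) *s M b)"
      unfolding vec.span_finite[OF finite_imageI[OF assms(1)]] ri by simp
    moreover have "(\<Sum>b\<in>B. \<alpha> b *s M b) \<in> range (\<lambda>u. \<Sum>b\<in>B. u (M b) *s M b)" for \<alpha>
    proof -
      have "(\<Sum>b\<in>B. \<alpha> b *s M b) = (\<Sum>b\<in>B. \<alpha> (inv_into B M (M b)) *s M b)"
        using inj by (intro sum.cong) auto
      then show ?thesis by (intro image_eqI[of _ _ "\<lambda>v. \<alpha> (inv_into B M v)"]) auto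
    qed
    ultimately show ?thesis by (intro equalityI subsetI) auto
  qed
  ultimately have "vec.dim {\<Sum>b\<in>B. \<alpha> b *s M b | \<alpha>. True} = card (M ` B)" by (simp only:)
  then show ?thesis using inj by (simp add: card_image)
qed

text \<open>The algebraic closure of the field with \<open>q\<^sup>6\<close> elements.\<close>

locale gk_finite =
  fixes q :: nat and K0 :: "'f::{field, finite} itself"
  assumes q_primepow: "primepow q" and card_field: "CARD('f) = q ^ 6"

sublocale gk_finite \<subseteq> gk q "TYPE('f alg_closure)"
proof
  have "CHAR('f) > 0" by (rule finite_imp_CHAR_pos) simp
  then have p: "Factorial_Ring.prime CHAR('f)" by (rule prime_CHAR_semidom)
  then show "Factorial_Ring.prime CHAR('f alg_closure)" by simp
  obtain p' k where q: "Factorial_Ring.prime p'" "k > 0" "q = p' ^ k"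
    using q_primepow by (auto simp: primepow_def)
  have "(\<Sum>x\<in>(UNIV :: 'f set). x + 1) = (\<Sum>x\<in>UNIV. x)"
    by (rule sum.reindex_bij_witness[of _ "\<lambda>x. x - 1" "\<lambda>x. x + 1"]) auto
  then have "of_nat (CARD('f)) = (0 :: 'f)" by (simp add: sum.distrib)
  then have "CHAR('f) dvd q ^ 6" by (simp only: of_nat_eq_0_iff_char_dvd card_field)
  then have "CHAR('f) dvd p'" using q p by (metis prime_dvd_power)
  then have "CHAR('f) = p'" using p q(1) by (simp add: primes_dvd_imp_eq)
  then show "\<exists>e>0. q = CHAR('f alg_closure) ^ e" using q by auto
qed

context gk_finite
begin

text \<open>The image of the finite field is the set of fixed points of the Frobenius map.\<close>

lemma range_to_ac: "range (to_ac :: 'f \<Rightarrow> _) = {a. a ^ q ^ 6 = a}"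
proof (rule card_subset_eq)
  have eq: "{a :: 'f alg_closure. a ^ q ^ 6 = a} = {a. a ^ q ^ 6 + (- 1) * a = 0}" by auto
  show "finite {a :: 'f alg_closure. a ^ q ^ 6 = a}"
    unfolding eq by (rule card_additive_fibre(1)) simp_all
  show "range (to_ac :: 'f \<Rightarrow> _) \<subseteq> {a. a ^ q ^ 6 = a}"
    using finite_field_power_card[where 'f = 'f] by (auto simp: card_field simp flip: to_ac_power)
  have "card {a :: 'f alg_closure. a ^ q ^ 6 = a} = q ^ 6"
    unfolding eq by (rule card_additive_fibre(2)) simp_all
  moreover have "card (range (to_ac :: 'f \<Rightarrow> _)) = q ^ 6"
    unfolding card_field[symmetric] by (rule card_image[OF inj_to_ac])
  ultimately show "card (range (to_ac :: 'f \<Rightarrow> _)) = card {a :: 'f alg_closure. a ^ q ^ 6 = a}" by simp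
qed

lemma coeff_ring_range: "coeff_ring (range (to_ac :: 'f \<Rightarrow> _))"
  unfolding coeff_ring_def range_to_ac
  using q_ge_2 by (simp add: frob_add power_mult_distrib power_0_left)

lemma forms_frobenius:
  assumes "g \<in> forms (range (to_ac :: 'f \<Rightarrow> _)) d" "\<And>i. v $ i = w $ i ^ q ^ 6"
  shows "g v = g w ^ q ^ 6"
  using assms(1)
proof (induction rule: forms_induct)
  case (zero d)
  then show ?case using q_ge_2 by (simp add: power_0_left)
next
  case (const c)
  then show ?case unfolding range_to_ac by simp
next
  case (add d g h)
  then show ?case by (simp add: frob_add)
next
  case (coord d i g)
  then show ?case by (simp add: power_mult_distrib assms(2))
qed

lemma frobenius_preimage:
  assumes v: "v \<in> C"
  obtains w where "w \<in> C" "\<And>i. v $ i = w $ i ^ q ^ 6"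
proof -
  have "\<exists>b. b ^ q ^ 6 = v $ i" for i by (rule frob_surj)
  then obtain f where f: "\<And>i. f i ^ q ^ 6 = v $ i" by metis
  define w where "w = vec4 1 (f 2) (f 3) (f 4)"
  have w: "w $ i ^ q ^ 6 = v $ i" for i
    using exhaust_4[of i] f C_D(1)[OF v] by (auto simp: w_def)
  have comm: "(a ^ n) ^ q ^ 6 = (a ^ q ^ 6) ^ n" for a :: "'f alg_closure" and n
    by (simp only: power_mult[symmetric] mult.commute)
  have "(w $ 3 ^ (q + 1)) ^ q ^ 6 = (w $ 2 ^ q + w $ 2) ^ q ^ 6"
    unfolding frob_add comm w by (rule C_D(2)[OF v])
  then have 1: "w $ 3 ^ (q + 1) = w $ 2 ^ q + w $ 2" unfolding frob_inj .
  have "(w $ 4 ^ N) ^ q ^ 6 = (w $ 3 ^ q\<^sup>2 - w $ 3) ^ q ^ 6"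
    unfolding frob_diff comm w by (rule C_D(3)[OF v])
  then have 2: "w $ 4 ^ N = w $ 3 ^ q\<^sup>2 - w $ 3" unfolding frob_inj .
  have "w \<in> C" using 1 2 by (simp add: C_def) (simp add: w_def)
  then show thesis using w that by metis
qed

text \<open>The function \<open>\<Sum> \<alpha>\<^sub>b b / z\<^sup>m\<close>, summed over the reduced monomials \<open>b\<close> of degree at most \<open>m\<close>, with
  coefficients in the finite field.\<close>

definition word_fun :: "nat \<Rightarrow> (nat \<times> nat \<times> nat \<Rightarrow> 'f) \<Rightarrow> 'f alg_closure rat_fun" where
  "word_fun m \<alpha> = fr (hom_sum m (\<lambda>b. to_ac (\<alpha> b))) (\<lambda>v. v $ 4 ^ m)"

lemma word_fun_pair: "quotient_pair m (hom_sum m a) (\<lambda>v. v $ 4 ^ m)"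
proof -
  have "nonvanishing (\<lambda>v :: 'f alg_closure ^ 4. v $ 4 ^ m)" using C_generic by (auto simp: nonvanishing_def)
  then show ?thesis unfolding quotient_pair_def
    using hom_sum_form[OF coeff_ring_UNIV UNIV_I, of m a] F_coord_power by blast
qed

text \<open>If \<open>F / H\<close> with coefficients in the finite field equals \<open>\<Sum> a\<^sub>b b / z\<^sup>m\<close>, then applying the
  Frobenius map to the coefficients \<open>a\<^sub>b\<close> gives the same function; as the monomials are
  independent, the \<open>a\<^sub>b\<close> lie in the finite field.\<close>

lemma coefficients_descend:
  assumes F: "F \<in> forms (range (to_ac :: 'f \<Rightarrow> _)) d" and H: "H \<in> forms (range (to_ac :: 'f \<Rightarrow> _)) d"
    and nz: "nonvanishing H" and eq: "\<And>v. v \<in> C \<Longrightarrow> F v * v $ 4 ^ m = hom_sum m a v * H v"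
    and b: "b \<in> mono_exps m"
  shows "a b \<in> range (to_ac :: 'f \<Rightarrow> _)"
proof -
  have Hf: "H \<in> forms UNIV d" using H by (auto simp: forms_def)
  let ?a = "\<lambda>b. a b ^ q ^ 6"
  have hs: "hom_sum m ?a \<in> polyfuns" "hom_sum m a \<in> polyfuns"
    by (rule polyfuns_form[OF hom_sum_form]; simp)+
  have frob: "F v * v $ 4 ^ m = hom_sum m ?a v * H v" if v: "v \<in> C" for v
  proof -
    obtain w where w: "w \<in> C" "\<And>i. v $ i = w $ i ^ q ^ 6" using frobenius_preimage[OF v] by blast
    have comm: "(c ^ n) ^ q ^ 6 = (c ^ q ^ 6) ^ n" for c :: "'f alg_closure" and n
      by (simp only: power_mult[symmetric] mult.commute)
    have fs: "(\<Sum>x\<in>S. f x) ^ q ^ 6 = (\<Sum>x\<in>S. f x ^ q ^ 6)" for S and f :: "nat \<times> nat \<times> nat \<Rightarrow> 'f alg_closure"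
      by (induction S rule: infinite_finite_induct) (use q_ge_2 in \<open>auto simp: frob_add power_0_left\<close>)
    have "hom_sum m a w ^ q ^ 6 = hom_sum m ?a v"
      unfolding hom_sum_def fs by (intro sum.cong refl) (simp add: case_prod_unfold power_mult_distrib comm w(2))
    moreover have "F v * v $ 4 ^ m = (F w * w $ 4 ^ m) ^ q ^ 6"
      by (simp add: forms_frobenius[OF F w(2)] power_mult_distrib comm w(2))
    moreover have "(hom_sum m a w * H w) ^ q ^ 6 = hom_sum m a w ^ q ^ 6 * H v"
      by (simp add: forms_frobenius[OF H w(2)] power_mult_distrib)
    ultimately show ?thesis using eq[OF w(1)] by simp
  qed
  have "(\<lambda>v. hom_sum m a v + (- 1) * hom_sum m ?a v) \<in> polyfuns"
    by (intro polyfuns_add polyfuns_mult polyfuns_form[OF F_const] hs)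
  moreover have "H v * (hom_sum m a v + (- 1) * hom_sum m ?a v) = 0" if v: "v \<in> C" for v
  proof -
    have "H v * (hom_sum m a v + (- 1) * hom_sum m ?a v) = hom_sum m a v * H v - hom_sum m ?a v * H v"
      by (simp add: algebra_simps)
    then show ?thesis by (simp only: eq[OF v, symmetric] frob[OF v, symmetric] diff_self)
  qed
  ultimately have z: "hom_sum m a v + (- 1) * hom_sum m ?a v = 0" if "v \<in> C" for v
    using polyfuns_domain[OF polyfuns_form[OF Hf] _ nz _ that] by blast
  have "a b - ?a b = 0"
  proof (rule monos_indep[OF _ b])
    fix v assume v: "v \<in> C"
    have "(\<Sum>b\<in>mono_exps m. (a b - ?a b) * mono_at b v) = hom_sum m a v - hom_sum m ?a v"
      by (simp add: hom_sum_C[OF v] left_diff_distrib sum_subtractf)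
    then show "(\<Sum>b\<in>mono_exps m. (a b - ?a b) * mono_at b v) = 0" using z[OF v] by simp
  qed
  then show ?thesis unfolding range_to_ac by simp
qed

lemma riemann_roch_space_eq:
  assumes G: "\<And>P. Poly_Mapping.lookup G P = pole_bound m P"
  shows "riemann_roch_space (gk_curve q) G = range (word_fun m)"
proof (intro equalityI subsetI)
  fix f :: "'f alg_closure rat_fun" assume f: "f \<in> riemann_roch_space (gk_curve q) G"
  show "f \<in> range (word_fun m)"
  proof (cases "f = \<zero>\<^bsub>FF\<^esub>")
    case True
    have "hom_sum m (\<lambda>b. to_ac (0::'f)) v = 0" for v by (simp add: hom_sum_def)
    then have "\<not> nonvanishing (hom_sum m (\<lambda>b. to_ac (0::'f)))" unfolding nonvanishing_def by blast
    then have "word_fun m (\<lambda>_. 0) = \<zero>\<^bsub>FF\<^esub>" unfolding word_fun_def by (rule iffD2[OF fr_zero_iff[OF word_fun_pair]])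
    then have "f = word_fun m (\<lambda>_. 0)" using True by simp
    then show ?thesis by blast
  next
    case False
    then have ord: "\<forall>P\<in>XX. 0 \<le> ord_at XX P f + pole_bound m P" and over: "f \<in> function_field_over XX"
      using f by (auto simp: riemann_roch_space_def G)
    obtain F H where FH: "(F, H) \<in> f" "f \<in> carrier FF"
      "\<And>e. Poly_Mapping.lookup F e \<in> range (to_ac :: 'f \<Rightarrow> _)" "\<And>e. Poly_Mapping.lookup H e \<in> range (to_ac :: 'f \<Rightarrow> _)"
      using over unfolding function_field_over_def by blast
    obtain d' \<phi> \<psi> where 1: "quotient_pair d' \<phi> \<psi>" "f = fr \<phi> \<psi>" using FH(2) carrier_FF by blast
    then have fr: "(F, H) \<in> fractions XX" "\<forall>v\<in>C. eval4 F v * \<psi> v = \<phi> v * eval4 H v" using FH(1) by (auto simp: fr_def)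
    obtain d where d: "homogeneous4 d F" "homogeneous4 d H" "nonvanishing (eval4 H)"
      "quotient_pair d (eval4 F) (eval4 H)" using fr(1) by (rule fractionsE)
    have feq: "f = fr (eval4 F) (eval4 H)" using fr_eq_iff[OF d(4) 1(1)] fr(2) 1(2) by simp
    have nz: "nonvanishing (eval4 F)" using False fr_zero_iff[OF d(4)] feq by simp
    obtain a where a: "\<forall>v\<in>C. eval4 F v * v $ 4 ^ m = hom_sum m a v * eval4 H v"
      using riemann_roch_functions[OF d(4) nz, of m] ord unfolding feq by blast
    have S: "eval4 F \<in> forms (range (to_ac :: 'f \<Rightarrow> _)) d" "eval4 H \<in> forms (range (to_ac :: 'f \<Rightarrow> _)) d"
      using d(1,2) FH(3,4) unfolding forms_def by blast+
    have r: "a b \<in> range (to_ac :: 'f \<Rightarrow> _)" if "b \<in> mono_exps m" for b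
      by (rule coefficients_descend[OF S d(3) _ that]) (use a in blast)
    define \<alpha> where "\<alpha> = (\<lambda>b. of_ac (a b) :: 'f)"
    have h: "hom_sum m (\<lambda>b. to_ac (\<alpha> b)) = hom_sum m a"
      unfolding hom_sum_def[abs_def]
      by (intro ext sum.cong refl) (auto simp: \<alpha>_def to_ac_of_ac[OF r])
    have "f = word_fun m \<alpha>" unfolding feq word_fun_def h
      by (rule fr_eqI[OF d(4) word_fun_pair]) (use a in blast)
    then show ?thesis by blast
  qed
next
  fix f :: "'f alg_closure rat_fun" assume "f \<in> range (word_fun m)"
  then obtain \<alpha> where f: "f = fr (hom_sum m (\<lambda>b. to_ac (\<alpha> b))) (\<lambda>v. v $ 4 ^ m)"
    unfolding word_fun_def by blast
  let ?h = "hom_sum m (\<lambda>b. to_ac (\<alpha> b))"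
  show "f \<in> riemann_roch_space (gk_curve q) G"
  proof (cases "nonvanishing ?h")
    case False
    then have "f = \<zero>\<^bsub>FF\<^esub>" unfolding f by (rule iffD2[OF fr_zero_iff[OF word_fun_pair]])
    then show ?thesis by (simp add: riemann_roch_space_def)
  next
    case True
    have "\<exists>a. \<forall>v\<in>C. ?h v * v $ 4 ^ m = hom_sum m a v * v $ 4 ^ m" by blast
    then have ord: "\<forall>P\<in>XX. 0 \<le> ord_at XX P f + pole_bound m P"
      using riemann_roch_functions[OF word_fun_pair True, of m] f by blast
    have S: "?h \<in> forms (range (to_ac :: 'f \<Rightarrow> _)) m"
      by (rule hom_sum_form[OF coeff_ring_range]) simp
    have S': "(\<lambda>v :: 'f alg_closure ^ 4. v $ 4 ^ m) \<in> forms (range (to_ac :: 'f \<Rightarrow> _)) m"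
      using forms_power[OF coeff_ring_range forms_coord[OF coeff_ring_range], of 4 m] by simp
    obtain F where F: "homogeneous4 m F" "\<And>e. Poly_Mapping.lookup F e \<in> range (to_ac :: 'f \<Rightarrow> _)" "?h = eval4 F"
      using S unfolding forms_def by blast
    obtain H where H: "homogeneous4 m H" "\<And>e. Poly_Mapping.lookup H e \<in> range (to_ac :: 'f \<Rightarrow> _)"
      "(\<lambda>v. v $ 4 ^ m) = eval4 H" using S' unfolding forms_def by blast
    have "nonvanishing (eval4 H)" using word_fun_pair unfolding quotient_pair_def H(3)[symmetric] by blast
    then have "(F, H) \<in> fractions XX" by (rule fractionsI[OF F(1) H(1)])
    then have "(F, H) \<in> f" unfolding f F(3) H(3) by (rule fr_self)
    moreover have "f \<in> carrier FF" unfolding carrier_FF using word_fun_pair f by blast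
    ultimately have over: "f \<in> function_field_over XX" unfolding function_field_over_def using F(2) H(2) by blast
    have "f \<noteq> \<zero>\<^bsub>FF\<^esub>" unfolding f fr_zero_iff[OF word_fun_pair] using True by blast
    then show ?thesis using over ord by (simp add: riemann_roch_space_def G)
  qed
qed

lemma finite_rational_points:
  assumes "0 < n"
  shows "finite (rational_points XX (q ^ n))"
proof -
  let ?A = "{a :: 'f alg_closure. a ^ q ^ n = a}"
  have eq: "?A = {a. a ^ q ^ n + (- 1) * a = 0}" by auto
  have A: "finite ?A" unfolding eq using assms by (intro card_additive_fibre(1)) auto
  let ?V = "(\<lambda>(x, y, z). vec4 1 x y z) ` (?A \<times> ?A \<times> ?A)"
  have "rational_points XX (q ^ n) \<subseteq> insert (proj_class einf) (proj_class ` ?V)"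
  proof
    fix P assume P: "P \<in> rational_points XX (q ^ n)"
    then have "P \<in> XX" by (simp add: rational_points_def)
    then consider "P = proj_class einf" | v where "v \<in> C" "P = proj_class v" unfolding curve_points by blast
    then show "P \<in> insert (proj_class einf) (proj_class ` ?V)"
    proof cases
      case (2 v)
      have "\<forall>i. v $ i ^ q ^ n = v $ i" using P rational_affine[OF 2(1)] 2(2) by simp
      then have "v \<in> ?V" using C_expand[OF 2(1)]
        by (intro image_eqI[of _ _ "(v $ 2, v $ 3, v $ 4)"]) auto
      then show ?thesis using 2(2) by blast
    qed simp
  qed
  then show ?thesis
    by (rule finite_subset) (intro finite.insertI finite_imageI finite_cartesian_product A)
qed

lemma proj_class_C_inj:
  assumes "v \<in> C" "w \<in> C" "proj_class v = proj_class w"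
  shows "v = w"
proof -
  have "v \<in> proj_class w" using proj_class_self assms(3) by metis
  then obtain c where "v = c *s w" by (auto simp: proj_class_def)
  moreover from this have "c = 1" using C_D(1)[OF assms(1)] C_D(1)[OF assms(2)] by simp
  ultimately show ?thesis by simp
qed

lemma code_points:
  "rational_points XX (q ^ 6) - rational_points XX (q\<^sup>2)
    = proj_class ` {v \<in> C. v $ 4 \<noteq> 0 \<and> (\<forall>i. v $ i ^ q ^ 6 = v $ i)}"
proof (intro equalityI subsetI)
  fix P assume P: "P \<in> rational_points XX (q ^ 6) - rational_points XX (q\<^sup>2)"
  then have "P \<in> XX" by (simp add: rational_points_def)
  moreover have "P \<noteq> proj_class einf" using P rational_infinity[of "q\<^sup>2"] q_ge_2 by auto
  ultimately obtain v where v: "v \<in> C" "P = proj_class v" unfolding curve_points by blast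
  then show "P \<in> proj_class ` {v \<in> C. v $ 4 \<noteq> 0 \<and> (\<forall>i. v $ i ^ q ^ 6 = v $ i)}"
    using P rational_q2[OF v(1)] rational_affine[OF v(1), of "q ^ 6"] by auto
next
  fix P assume "P \<in> proj_class ` {v \<in> C. v $ 4 \<noteq> 0 \<and> (\<forall>i. v $ i ^ q ^ 6 = v $ i)}"
  then obtain v where v: "v \<in> C" "v $ 4 \<noteq> 0" "\<forall>i. v $ i ^ q ^ 6 = v $ i" "P = proj_class v" by blast
  then show "P \<in> rational_points XX (q ^ 6) - rational_points XX (q\<^sup>2)"
    using rational_q2[OF v(1)] rational_affine[OF v(1), of "q ^ 6"] by simp
qed

lemma code_dimension:
  fixes P :: "'n::finite \<Rightarrow> 'f alg_closure proj_point"
  assumes G: "\<And>Q. Poly_Mapping.lookup G Q = pole_bound m Q"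
    and P: "range P = rational_points XX (q ^ 6) - rational_points XX (q\<^sup>2)"
    and m: "m < q ^ 3 * (q\<^sup>2 - 1)"
  shows "vec.dim (functional_code (gk_curve q) P G :: ('f ^ 'n) set) = card (mono_exps m)"
proof -
  have "\<exists>v. v \<in> C \<and> v $ 4 \<noteq> 0 \<and> (\<forall>j. v $ j ^ q ^ 6 = v $ j) \<and> P i = proj_class v" for i
    using P unfolding code_points by blast
  then obtain p where p: "\<And>i. p i \<in> C" "\<And>i. p i $ 4 \<noteq> 0" "\<And>i j. p i $ j ^ q ^ 6 = p i $ j"
    "\<And>i. P i = proj_class (p i)" by metis
  define M :: "nat \<times> nat \<times> nat \<Rightarrow> 'f ^ 'n" where
    "M = (\<lambda>b. \<chi> i. of_ac (mono_at b (p i) / p i $ 4 ^ m))"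
  have comm: "(c ^ n) ^ q ^ 6 = (c ^ q ^ 6) ^ n" for c :: "'f alg_closure" and n
    by (simp only: power_mult[symmetric] mult.commute)
  have M: "to_ac (M b $ i) = mono_at b (p i) / p i $ 4 ^ m" for b i
  proof -
    have "mono_at b (p i) / p i $ 4 ^ m \<in> range (to_ac :: 'f \<Rightarrow> _)"
      unfolding range_to_ac mono_at_def case_prod_unfold mem_Collect_eq power_divide power_mult_distrib comm p(3) ..
    then show ?thesis unfolding M_def vec_lambda_beta by (rule to_ac_of_ac)
  qed
  have val: "value_at (word_fun m \<alpha>) (P i) = to_ac ((\<Sum>b\<in>mono_exps m. \<alpha> b *s M b) $ i)" for \<alpha> i
  proof -
    have "value_at (word_fun m \<alpha>) (P i) = hom_sum m (\<lambda>b. to_ac (\<alpha> b)) (p i) / p i $ 4 ^ m"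
      unfolding p(4) word_fun_def by (rule value_at_fr[OF insertI2[OF p(1)] word_fun_pair]) (use p(2) in simp)
    also have "\<dots> = to_ac ((\<Sum>b\<in>mono_exps m. \<alpha> b *s M b) $ i)"
      by (simp add: hom_sum_C[OF p(1)] sum_divide_distrib to_ac_sum M)
    finally show ?thesis .
  qed
  have "functional_code (gk_curve q) P G = {\<Sum>b\<in>mono_exps m. \<alpha> b *s M b | \<alpha>. True}"
  proof -
    have "(\<chi> i. of_ac (value_at (word_fun m \<alpha>) (P i))) = (\<Sum>b\<in>mono_exps m. \<alpha> b *s M b)" for \<alpha>
      unfolding val by (simp add: vec_eq_iff)
    then show ?thesis unfolding functional_code_def riemann_roch_space_eq[OF G] image_image by auto
  qed
  moreover have "\<alpha> b = 0" if zero: "(\<Sum>b\<in>mono_exps m. \<alpha> b *s M b) = 0" and b: "b \<in> mono_exps m" for \<alpha> b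
  proof -
    let ?g = "hom_sum m (\<lambda>b. to_ac (\<alpha> b))"
    have g: "?g \<in> forms UNIV m" by (rule hom_sum_form) simp_all
    have gp: "?g (p i) = 0" for i
    proof -
      have "value_at (word_fun m \<alpha>) (P i) = 0" unfolding val zero by simp
      moreover have "value_at (word_fun m \<alpha>) (P i) = ?g (p i) / p i $ 4 ^ m"
        unfolding p(4) word_fun_def by (rule value_at_fr[OF insertI2[OF p(1)] word_fun_pair]) (use p(2) in simp)
      ultimately show ?thesis using p(2)[of i] by simp
    qed
    have gz: "?g v = 0" if v: "v \<in> C" "v $ 4 \<noteq> 0" "\<And>i. v $ i ^ q ^ 6 = v $ i" for v
    proof -
      have "proj_class v \<in> range P" unfolding P code_points using v by blast
      then obtain i where "proj_class v = P i" by blast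
      then have "v = p i" using proj_class_C_inj[OF v(1) p(1)] p(4) by simp
      then show ?thesis using gp by simp
    qed
    have "to_ac (\<alpha> b) = 0"
    proof (rule monos_indep[OF _ b])
      fix v assume v: "v \<in> C"
      have "?g v = 0" by (rule evaluation_injective[OF g m gz v])
      then show "(\<Sum>b\<in>mono_exps m. to_ac (\<alpha> b) * mono_at b v) = 0" by (simp only: hom_sum_C[OF v])
    qed
    then show ?thesis by simp
  qed
  ultimately show ?thesis using span_dim_family[OF finite_monos[of m], of M] by simp
qed

end

theorem proposition3p3:
  fixes q m k :: nat
    and \<X> :: "'f::{field, finite} alg_closure proj_point set"
    and G D :: "'f alg_closure divisor"
    and P :: "'n::finite \<Rightarrow> 'f alg_closure proj_point"
    and C :: "('f ^ 'n) set"
  assumes "primepow q"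
    and "CARD('f) = q ^ 6"
    and "\<X> = gk_curve q"
    and "G = (\<Sum>Q\<in>rational_points \<X> (q ^ 2). Poly_Mapping.single Q (int m))"
    and "D = (\<Sum>Q\<in>rational_points \<X> (q ^ 6) - rational_points \<X> (q ^ 2). Poly_Mapping.single Q 1)"
    and "inj P"
    and "D = (\<Sum>i\<in>UNIV. Poly_Mapping.single (P i) 1)"
    and "C = functional_code \<X> P G"
    and "k = vec.dim C"
    and "int q ^ 2 - 1 \<le> int m"
    and "int m \<le> int q ^ 5 - int q ^ 3 - 1"
  shows "real k = real m * (real q ^ 3 + 1)
           - 1 / 2 * (real q ^ 5 - 2 * real q ^ 3 + real q ^ 2 - 2)"
proof -
  interpret gk_finite q "TYPE('f)"
    by unfold_locales (rule assms(1), rule assms(2))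
  let ?R2 = "rational_points XX (q ^ 2) :: 'f alg_closure proj_point set"
  let ?R6 = "rational_points XX (q ^ 6) :: 'f alg_closure proj_point set"
  have fin: "finite ?R2" "finite (?R6 - ?R2)" by (simp_all add: finite_rational_points)
  have G: "Poly_Mapping.lookup G Q = pole_bound m Q" for Q
    unfolding assms(3,4) lookup_sum_single[OF fin(1)] pole_bound_def ..
  have "D = (\<Sum>Q\<in>range P. Poly_Mapping.single Q 1)"
    unfolding assms(7) sum.reindex[OF assms(6)] o_def ..
  then have "Poly_Mapping.lookup D Q = (if Q \<in> range P then 1 else 0)" for Q
    by (simp only: lookup_sum_single[OF finite_imageI[OF finite]])
  moreover have "Poly_Mapping.lookup D Q = (if Q \<in> ?R6 - ?R2 then 1 else 0)" for Q
    unfolding assms(3,5) lookup_sum_single[OF fin(2)] ..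
  ultimately have "Q \<in> range P \<longleftrightarrow> Q \<in> ?R6 - ?R2" for Q by (metis zero_neq_one)
  then have P: "range P = ?R6 - ?R2" by blast
  have "int (m + 1) \<le> int (q ^ 3 * (q\<^sup>2 - 1))"
  proof -
    have "int (q\<^sup>2 - 1) = int q ^ 2 - 1" using q_ge_2 by (simp add: of_nat_diff)
    then have "int (q ^ 3 * (q\<^sup>2 - 1)) = int q ^ 5 - int q ^ 3"
      by (simp add: right_diff_distrib flip: power_add)
    moreover have "int (m + 1) \<le> int q ^ 5 - int q ^ 3" using assms(11) by simp
    ultimately show ?thesis by (simp only:)
  qed
  then have m: "m < q ^ 3 * (q\<^sup>2 - 1)" by linarith
  have m2: "q\<^sup>2 \<le> m + 1"
  proof -
    have "int (q\<^sup>2) \<le> int (m + 1)" using assms(10) by simp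
    then show ?thesis by linarith
  qed
  have "k = card (mono_exps m)" unfolding assms(8,9,3) by (rule code_dimension[OF G P m])
  then have "real k = (real q ^ 3 + 1) * (real m + 1 - real q ^ 2 / 2)"
    using card_monos[OF m2] by simp
  also have "\<dots> = real m * (real q ^ 3 + 1)
           - 1 / 2 * (real q ^ 5 - 2 * real q ^ 3 + real q ^ 2 - 2)"
    by (simp add: algebra_simps flip: power_add)
  finally show ?thesis .
qed

end
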